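(* Let $n\ge2$ and let $\varphi:\mathbb{R}^n\to\mathbb{R}^n$ be a homeomorphism. Suppose that the mapping $f\mapsto f\circ\varphi$ induced by $\varphi$ is bounded on the homogeneous Triebel--Lizorkin space $\dot{F}^s_{n/s,q}(\mathbb{R}^n)$ for some $0<s<1$ and $0<q\le\infty$. Then $\varphi$ is quasiconformal.
   Context: Let $\psi$ be a Schwartz function on $\mathbb{R}^n$ with $\operatorname{supp}\widehat\psi\subset\{1/2\le|\xi|\le2\}$ and $|\widehat\psi|\ge c>0$ on $\{3/5\le|\xi|\le5/3\}$, and put $\psi_j=2^{jn}\psi(2^j\cdot)$, $j\in\mathbb{Z}$. For $0<p<\infty$, $0<q\le\infty$, $s\in\mathbb{R}$, $\|f\|_{\dot{F}^s_{p,q}(\mathbb{R}^n)}=\big\|\big(\sum_{j\in\mathbb{Z}}2^{jsq}|\psi_j*f|^q\big)^{1/q}\big\|_{L^p(\mathbb{R}^n)}$ (supremum over $j$ if $q=\infty$); $\dot{F}^s_{p,q}(\mathbb{R}^n)$ is the space of tempered distributions modulo polynomials with finite (quasi-)norm. For $p=n/s$, $0<s<1$, each class contains a function in $BMO(\mathbb{R}^n)$, unique up to additive constants, and the space is regarded as the space of such functions modulo constants. "The mapping induced by $\varphi$ is bounded on $\dot{F}^s_{n/s,q}(\mathbb{R}^n)$" means: there is $C$ such that for every continuous $f$ in this space, $f\circ\varphi$ belongs to the space and $\|f\circ\varphi\|_{\dot{F}^s_{n/s,q}(\mathbb{R}^n)}\le C\|f\|_{\dot{F}^s_{n/s,q}(\mathbb{R}^n)}$.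 A homeomorphism $\varphi$ of $\mathbb{R}^n$ is quasiconformal if there is $H<\infty$ such that for every $x\in\mathbb{R}^n$, $\limsup_{r\to0^+}\frac{\max_{|y-x|=r}|\varphi(y)-\varphi(x)|}{\min_{|y-x|=r}|\varphi(y)-\varphi(x)|}\le H$ (no orientation condition is imposed). *)

theory Defs
  imports "HOL-Analysis.Analysis"
begin

text \<open>Schwartz functions, tempered distributions and the Fourier transform\<close>

primrec iter_deriv ::
  "'a::euclidean_space list \<Rightarrow> ('a \<Rightarrow> complex) \<Rightarrow> 'a \<Rightarrow> complex" where
  "iter_deriv [] f = f"
| "iter_deriv (v # vs) f = (\<lambda>x. frechet_derivative (iter_deriv vs f) (at x) v)"

definition smooth :: "('a::euclidean_space \<Rightarrow> complex) \<Rightarrow> bool" where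
  "smooth f \<longleftrightarrow> (\<forall>vs \<in> lists Basis. \<forall>x. iter_deriv vs f differentiable (at x))"

definition schwartz :: "('a::euclidean_space \<Rightarrow> complex) set" where
  "schwartz = {f. smooth f \<and>
     (\<forall>k. \<forall>vs \<in> lists Basis. \<exists>B. \<forall>x. (1 + norm x) ^ k * norm (iter_deriv vs f x) \<le> B)}"

text \<open>The supremum below is finite for Schwartz functions; the seminorms indexed by
  \<open>N\<close> are increasing and generate the topology of the Schwartz space.\<close>

definition schwartz_seminorm :: "nat \<Rightarrow> ('a::euclidean_space \<Rightarrow> complex) \<Rightarrow> real" where
  "schwartz_seminorm N f =
     (SUP (vs, x) \<in> {vs \<in> lists Basis. length vs \<le> N} \<times> UNIV.
        (1 + norm x) ^ N * norm (iter_deriv vs f x))"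

text \<open>A distribution is represented by a total function; its values outside \<open>schwartz\<close>
  are irrelevant.\<close>

definition tempered_distribution ::
  "(('a::euclidean_space \<Rightarrow> complex) \<Rightarrow> complex) \<Rightarrow> bool" where
  "tempered_distribution T \<longleftrightarrow>
     (\<forall>f \<in> schwartz. \<forall>g \<in> schwartz. T (\<lambda>x. f x + g x) = T f + T g) \<and>
     (\<forall>c. \<forall>f \<in> schwartz. T (\<lambda>x. c * f x) = c * T f) \<and>
     (\<exists>C N. \<forall>f \<in> schwartz. norm (T f) \<le> C * schwartz_seminorm N f)"

definition regular_distribution ::
  "('a::euclidean_space \<Rightarrow> complex) \<Rightarrow> ('a \<Rightarrow> complex) \<Rightarrow> complex" where
  "regular_distribution f g = (LINT x|lebesgue. f x * g x)"

definition distr_convolution ::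
  "('a::euclidean_space \<Rightarrow> complex) \<Rightarrow> (('a \<Rightarrow> complex) \<Rightarrow> complex) \<Rightarrow> 'a \<Rightarrow> complex" where
  "distr_convolution g T x = T (\<lambda>y. g (x - y))"

text \<open>Normalisation: \<open>\<integral> f(x) e\<^sup>-\<^sup>i\<^sup>x\<^sup>\<cdot>\<^sup>\<xi> dx\<close>, without a factor \<open>2\<pi>\<close> in the exponent.\<close>

definition fourier :: "('a::euclidean_space \<Rightarrow> complex) \<Rightarrow> 'a \<Rightarrow> complex" where
  "fourier f \<xi> = (LINT x|lebesgue. cis (- (x \<bullet> \<xi>)) * f x)"

text \<open>Homogeneous Triebel--Lizorkin spaces\<close>

definition TL_generator :: "('a::euclidean_space \<Rightarrow> complex) \<Rightarrow> bool" where
  "TL_generator \<psi> \<longleftrightarrow>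
     \<psi> \<in> schwartz \<and>
     closure {\<xi>. fourier \<psi> \<xi> \<noteq> 0} \<subseteq> {\<xi>. 1/2 \<le> norm \<xi> \<and> norm \<xi> \<le> 2} \<and>
     (\<exists>c>0. \<forall>\<xi>. 3/5 \<le> norm \<xi> \<and> norm \<xi> \<le> 5/3 \<longrightarrow> c \<le> norm (fourier \<psi> \<xi>))"

definition dyadic_dilate ::
  "('a::euclidean_space \<Rightarrow> complex) \<Rightarrow> int \<Rightarrow> 'a \<Rightarrow> complex" where
  "dyadic_dilate \<psi> j x =
     of_real (2 powi (j * int DIM('a))) * \<psi> ((2 powi j) *\<^sub>R x)"

text \<open>Real powers on \<open>[0,\<infinity>]\<close>; used only for exponents \<open>r > 0\<close>.\<close>

definition epowr :: "ennreal \<Rightarrow> real \<Rightarrow> ennreal" where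
  "epowr a r = (if a = \<infinity> then \<infinity> else ennreal (enn2real a powr r))"

definition lq_norm :: "ennreal \<Rightarrow> (int \<Rightarrow> ennreal) \<Rightarrow> ennreal" where
  "lq_norm q a =
     (if q = \<infinity> then (SUP j. a j)
      else epowr (\<Sum>\<^sub>\<infinity>j\<in>UNIV. epowr (a j) (enn2real q)) (1 / enn2real q))"

definition Lp_norm :: "real \<Rightarrow> ('a::euclidean_space \<Rightarrow> ennreal) \<Rightarrow> ennreal" where
  "Lp_norm p g = epowr (\<integral>\<^sup>+x. epowr (g x) p \<partial>lebesgue) (1 / p)"

definition TL_norm ::
  "('a::euclidean_space \<Rightarrow> complex) \<Rightarrow> real \<Rightarrow> real \<Rightarrow> ennreal
     \<Rightarrow> (('a \<Rightarrow> complex) \<Rightarrow> complex) \<Rightarrow> ennreal" where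
  "TL_norm \<psi> s p q T =
     Lp_norm p (\<lambda>x. lq_norm q (\<lambda>j.
       ennreal (2 powr (of_int j * s) * norm (distr_convolution (dyadic_dilate \<psi> j) T x))))"

text \<open>The space consists of classes modulo polynomials. Since \<open>fourier \<psi>\<close> vanishes near
  the origin, \<open>TL_norm\<close> depends only on the class of \<open>T\<close>, so membership is expressed
  on representatives.\<close>

definition TL_space ::
  "('a::euclidean_space \<Rightarrow> complex) \<Rightarrow> real \<Rightarrow> real \<Rightarrow> ennreal
     \<Rightarrow> (('a \<Rightarrow> complex) \<Rightarrow> complex) set" where
  "TL_space \<psi> s p q = {T. tempered_distribution T \<and> TL_norm \<psi> s p q T < \<infinity>}"

definition ball_average :: "('a::euclidean_space \<Rightarrow> complex) \<Rightarrow> 'a \<Rightarrow> real \<Rightarrow> complex" where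
  "ball_average f x r = (LINT y:ball x r|lebesgue. f y) / of_real (measure lebesgue (ball x r))"

definition BMO :: "('a::euclidean_space \<Rightarrow> complex) set" where
  "BMO = {f. (\<forall>K. compact K \<longrightarrow> f absolutely_integrable_on K) \<and>
     (\<exists>B. \<forall>x. \<forall>r>0. (LINT y:ball x r|lebesgue. norm (f y - ball_average f x r))
                    / measure lebesgue (ball x r) \<le> B)}"

text \<open>The realisation, for \<open>p = n/s\<close> with \<open>0 < s < 1\<close>, of the Triebel--Lizorkin space as a
  space of BMO functions modulo constants. All representatives are included: constants
  belong to it and have norm \<open>0\<close>.\<close>

definition TL_functions ::
  "('a::euclidean_space \<Rightarrow> complex) \<Rightarrow> real \<Rightarrow> ennreal \<Rightarrow> ('a \<Rightarrow> complex) set" where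
  "TL_functions \<psi> s q =
     {f \<in> BMO. regular_distribution f \<in> TL_space \<psi> s (real DIM('a) / s) q}"

definition TL_fun_norm ::
  "('a::euclidean_space \<Rightarrow> complex) \<Rightarrow> real \<Rightarrow> ennreal \<Rightarrow> ('a \<Rightarrow> complex) \<Rightarrow> ennreal" where
  "TL_fun_norm \<psi> s q f = TL_norm \<psi> s (real DIM('a) / s) q (regular_distribution f)"

definition induces_bounded_map ::
  "('a::euclidean_space \<Rightarrow> complex) \<Rightarrow> real \<Rightarrow> ennreal \<Rightarrow> ('a \<Rightarrow> 'a) \<Rightarrow> bool" where
  "induces_bounded_map \<psi> s q \<phi> \<longleftrightarrow>
     (\<exists>C::real. \<forall>f. continuous_on UNIV f \<and> f \<in> TL_functions \<psi> s q \<longrightarrow>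
        f \<circ> \<phi> \<in> TL_functions \<psi> s q \<and>
        TL_fun_norm \<psi> s q (f \<circ> \<phi>) \<le> ennreal C * TL_fun_norm \<psi> s q f)"

text \<open>Quasiconformality (metric definition). For a homeomorphism the supremum and infimum
  over the sphere are a maximum and a positive minimum.\<close>

definition distortion :: "('a::euclidean_space \<Rightarrow> 'a) \<Rightarrow> 'a \<Rightarrow> real \<Rightarrow> real" where
  "distortion \<phi> x r =
     (SUP y\<in>sphere x r. norm (\<phi> y - \<phi> x)) / (INF y\<in>sphere x r. norm (\<phi> y - \<phi> x))"

definition homeomorphism_of_space :: "('a::euclidean_space \<Rightarrow> 'a) \<Rightarrow> bool" where
  "homeomorphism_of_space \<phi> \<longleftrightarrow> (\<exists>\<phi>'. homeomorphism UNIV UNIV \<phi> \<phi>')"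

definition quasiconformal :: "('a::euclidean_space \<Rightarrow> 'a) \<Rightarrow> bool" where
  "quasiconformal \<phi> \<longleftrightarrow>
     homeomorphism_of_space \<phi> \<and>
     (\<exists>H::real. \<forall>x. Limsup (at_right 0) (\<lambda>r. ereal (distortion \<phi> x r)) \<le> ereal H)"

end

theory Submission
  imports Defs "HOL-Probability.Characteristic_Functions"
begin

text \<open>Fix a sphere of radius \<open>r\<close> about \<open>x\<close>, and let \<open>l \<le> L\<close> be the extreme values of
  \<open>norm (\<phi> y - \<phi> x)\<close> on it. If \<open>L / l\<close> is large, a truncated logarithm \<open>f\<close>, written as an
  average of \<open>M\<close> dyadic dilates of one bump, is 1 on the ball of radius \<open>l\<close> about \<open>\<phi> x\<close> and 0
  outside the ball of radius \<open>L\<close>, and its norm is at most \<open>C * M powr (s/n - 1)\<close>: the dilates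
  are almost orthogonal, so their sum has norm about \<open>M powr (1/p)\<close> with \<open>p = n/s > 1\<close>.

  On the other hand \<open>g = f \<circ> \<phi>\<close> is 1 on a continuum joining \<open>x\<close> to the sphere and 0 on a
  connected set running from the sphere to infinity, which forces its norm to stay above a
  constant. Indeed, let \<open>\<theta>\<close> be a band-limited kernel such that the difference of its dilates at
  scales 1 and \<open>1/2\<close> is a convolution \<open>\<mu> * \<psi>\<close>. The averages of \<open>g\<close> against \<open>\<theta>\<close> at scale \<open>r\<close>
  are nearly constant near \<open>x\<close>, hence wrong on one of the two continua, and telescoping over
  the scales yields, at every point of that continuum, a scale \<open>2^-j\<close> at which \<open>\<psi>_j * g\<close> is
  at least a small power of \<open>2^-j / r\<close> on a ball. Since the continuum is one-dimensional, a
  Vitali covering adds these contributions up to a constant.\<close>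

section \<open>Integration of decaying functions\<close>

text \<open>The pulled-back function \<open>g\<close> is only known to be continuous and bounded by
  1, so the lower bound can rest on nothing but its values on the two continua, with a constant
  independent of \<open>g\<close> and \<open>r\<close>. Scale invariance makes this possible: since
  \<open>s * p = n\<close>, a ball of measure about 2^(-jn) on which \<open>\<psi>_j * g\<close> has
  size \<tau> contributes about \<tau>^p, whatever j is. A point e of the continuum receives a scale
  j = j0 + m, where 2^(-j0) is comparable to r, and a level \<tau> proportional to 2^(-\<eta> m).
  Finding this level near e and keeping it on a ball costs further powers: the ball has radius about
  2^(-j) \<tau>^2 and lies within about R = 2^(-j) / \<tau> of e. Its contribution \<tau>^(p + 2n)
  is proportional to R / r exactly when \<eta> = 1 / (p + 2n + 1), and radii are what a covering of
  a one-dimensional set can add up. One scale per point is enough, so every l^q norm, q =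
  \<infinity> included, enters the lower bound only by dominating its single terms. In the upper
  bound it is replaced by an l^r norm with r = min(1, q), where r-th powers of sums can be
  split.\<close>

lemma nn_integral_lborel_affine:
  fixes t :: "'a::euclidean_space"
  assumes [measurable]: "f \<in> borel_measurable borel" and c: "c \<noteq> 0"
  shows "(\<integral>\<^sup>+x. f x \<partial>lborel) = ennreal (\<bar>c\<bar> ^ DIM('a)) * (\<integral>\<^sup>+x. f (t + c *\<^sub>R x) \<partial>lborel)"
  by (subst lborel_affine[OF c, of t])
     (simp add: nn_integral_density nn_integral_distr nn_integral_cmult)

lemma lborel_integrable_affine:
  fixes t :: "'a::euclidean_space" and f :: "'a \<Rightarrow> 'b :: {banach, second_countable_topology}"
  assumes f: "integrable lborel f" and c: "c \<noteq> 0"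
  shows "integrable lborel (\<lambda>x. f (t + c *\<^sub>R x))"
proof -
  have m[measurable]: "f \<in> borel_measurable borel"
    using f by auto
  have "ennreal (\<bar>c\<bar> ^ DIM('a)) * (\<integral>\<^sup>+x. norm (f (t + c *\<^sub>R x)) \<partial>lborel) < \<infinity>"
    using f nn_integral_lborel_affine[of "\<lambda>x. ennreal (norm (f x))" c t] c
    by (simp add: integrable_iff_bounded)
  then show ?thesis
    using c by (auto simp: integrable_iff_bounded ennreal_mult_less_top)
qed

lemma lborel_integral_affine:
  fixes t :: "'a::euclidean_space" and f :: "'a \<Rightarrow> 'b :: {banach, second_countable_topology}"
  assumes f: "f \<in> borel_measurable borel" and c: "c \<noteq> 0"
  shows "(LINT x|lborel. f x) = (\<bar>c\<bar> ^ DIM('a)) *\<^sub>R (LINT x|lborel. f (t + c *\<^sub>R x))"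
  by (subst lborel_affine[OF c, of t])
     (use f in \<open>simp add: integral_density integral_distr\<close>)

lemma two_powi_eq_powr: "2 powi j = (2::real) powr (of_int j)"
  by (subst powr_real_of_int') auto

text \<open>Each point is charged to the smallest ball of radius 2^k about the origin that contains
  it, where the function is at most \<open>c k\<close>. The charges multiplied by the volumes form a
  geometric series of ratio 2^(n - p) < 1.\<close>

lemma integrable_radial_powr:
  assumes p: "p > real DIM('a)"
  shows "integrable lborel (\<lambda>x::'a::euclidean_space. (1 + norm x) powr (-p))"
proof -
  let ?n = "real DIM('a)"
  define w where "w = measure lborel (ball (0::'a) 1)"
  have w: "w \<ge> 0" by (simp add: w_def)
  define c where "c k = 2 powr p * 2 powr (- real k * p)" for k :: nat
  have em: "emeasure lborel (ball (0::'a) (2 ^ k)) = ennreal (2 powr (real k * ?n) * w)" for k :: nat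
    using content_ball_conv_unit_ball[of "2 ^ k" "0::'a"] emeasure_lborel_ball_finite[of "0::'a" "2 ^ k"]
    by (simp add: emeasure_eq_ennreal_measure w_def powr_realpow powr_powr flip: powr_powr power_mult)
  have pt: "ennreal ((1 + norm x) powr (-p)) \<le> (\<Sum>k. ennreal (c k) * indicator (ball 0 (2 ^ k)) x)" for x :: 'a
  proof -
    obtain k0 :: nat where "norm x < 2 ^ k0"
      using real_arch_pow[of 2 "norm x"] by auto
    define k where "k = (LEAST k::nat. norm x < 2 ^ k)"
    have k: "norm x < 2 ^ k"
      unfolding k_def by (rule LeastI) fact
    have "(1 + norm x) powr (-p) \<le> c k"
    proof (cases k)
      case 0
      have "(1 + norm x) powr (-p) \<le> 1"
        using p powr_mono2'[of "-p" 1 "1 + norm x"] by simp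
      also have "1 \<le> c k" using p by (simp add: 0 c_def ge_one_powr_ge_zero)
      finally show ?thesis .
    next
      case (Suc m)
      have "\<not> norm x < 2 ^ m"
        using not_less_Least[of m "\<lambda>k. norm x < 2 ^ k"] Suc by (simp add: k_def)
      then have "2 powr real m \<le> 1 + norm x" by (simp add: powr_realpow)
      then have "(1 + norm x) powr (-p) \<le> (2 powr real m) powr (-p)"
        using p by (intro powr_mono2') auto
      also have "\<dots> = c k"
        by (simp add: c_def Suc powr_powr flip: powr_add) (simp add: algebra_simps)
      finally show ?thesis .
    qed
    then have "ennreal ((1 + norm x) powr (-p)) \<le> (\<Sum>i\<in>{k}. ennreal (c i) * indicator (ball 0 (2 ^ i)) x)"
      using k by (simp add: ennreal_leI)
    also have "\<dots> \<le> (\<Sum>k. ennreal (c k) * indicator (ball 0 (2 ^ k)) x)"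
      by (rule sum_le_suminf) auto
    finally show ?thesis .
  qed
  have "(\<integral>\<^sup>+x. ennreal ((1 + norm (x::'a)) powr (-p)) \<partial>lborel)
      \<le> (\<integral>\<^sup>+x. (\<Sum>k. ennreal (c k) * indicator (ball (0::'a) (2 ^ k)) x) \<partial>lborel)"
    by (intro nn_integral_mono pt)
  also have "\<dots> = (\<Sum>k. \<integral>\<^sup>+x. ennreal (c k) * indicator (ball (0::'a) (2 ^ k)) x \<partial>lborel)"
    by (intro nn_integral_suminf borel_measurable_times_ennreal borel_measurable_const borel_measurable_indicator) auto
  also have "\<dots> = (\<Sum>k. ennreal (c k) * emeasure lborel (ball (0::'a) (2 ^ k)))"
    by (simp add: nn_integral_cmult_indicator)
  also have "\<dots> = (\<Sum>k. ennreal (2 powr p * w * (2 powr (?n - p)) ^ k))"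
  proof (intro suminf_cong)
    fix k
    have "2 powr (- real k * p) * 2 powr (real k * ?n) = 2 powr ((?n - p) * real k)"
      by (subst powr_add[symmetric]) (simp add: algebra_simps)
    then have "c k * (2 powr (real k * ?n) * w) = 2 powr p * w * (2 powr (?n - p)) ^ k"
      by (simp add: c_def powr_power mult.commute)
    then show "ennreal (c k) * emeasure lborel (ball (0::'a) (2 ^ k)) = ennreal (2 powr p * w * (2 powr (?n - p)) ^ k)"
      unfolding em using w by (subst ennreal_mult[symmetric]) (auto simp: c_def)
  qed
  also have "\<dots> = ennreal (\<Sum>k. 2 powr p * w * (2 powr (?n - p)) ^ k)"
    using p w powr_less_mono[of "?n - p" 0 2]
    by (intro suminf_ennreal2 summable_mult summable_geometric) auto
  finally have "(\<integral>\<^sup>+x. ennreal ((1 + norm (x::'a)) powr (-p)) \<partial>lborel) < \<infinity>"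
    using le_less_trans by fastforce
  then show ?thesis
    by (intro integrableI_bounded) auto
qed

text \<open>A single polynomial order in place of membership in \<open>schwartz\<close>: the kernels
  \<open>\<theta>\<close> and \<open>\<mu>\<close> constructed later come from multipliers with
  finitely many derivatives, which yields only a finite order of decay.\<close>

definition decay :: "real \<Rightarrow> ('a::euclidean_space \<Rightarrow> complex) \<Rightarrow> bool" where
  "decay N K \<longleftrightarrow> (\<exists>B\<ge>0. \<forall>x. norm (K x) \<le> B * (1 + norm x) powr (-N))"

lemma decayE:
  assumes "decay N K"
  obtains B where "B \<ge> 0" "\<And>x. norm (K x) \<le> B * (1 + norm x) powr (-N)"
  using assms by (auto simp: decay_def)

lemma decayI:
  assumes "\<And>x. norm (K x) \<le> B * (1 + norm x) powr (-N)"
  shows "decay N K"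
  unfolding decay_def
proof (intro exI[of _ "\<bar>B\<bar>"] conjI allI)
  fix x 
  show "norm (K x) \<le> \<bar>B\<bar> * (1 + norm x) powr (-N)"
    by (rule order_trans[OF assms]) (intro mult_right_mono, auto)
qed simp

lemma decay_mono: 
  assumes "decay N K" "M \<le> N" shows "decay M K"
proof -
  obtain B where B: "B \<ge> 0" "\<And>x. norm (K x) \<le> B * (1 + norm x) powr (-N)"
    using decayE[OF assms(1)] by blast
  show ?thesis
  proof (rule decayI)
    fix x
    show "norm (K x) \<le> B * (1 + norm x) powr (-M)"
      by (rule order_trans[OF B(2)]) (intro mult_left_mono powr_mono, use B(1) assms(2) in auto)
  qed
qed

lemma decay_integrable:
  fixes K :: "'a::euclidean_space \<Rightarrow> complex"
  assumes "decay N K" "N > real DIM('a)" "K \<in> borel_measurable borel"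
  shows "integrable lborel K"
proof -
  obtain B where B: "B \<ge> 0" "\<And>x. norm (K x) \<le> B * (1 + norm x) powr (-N)"
    using decayE[OF assms(1)] by blast
  show ?thesis
    by (rule Bochner_Integration.integrable_bound[OF integrable_mult_right[OF integrable_radial_powr[OF assms(2)]], of _ B])
       (use B assms(3) in \<open>auto simp: abs_mult\<close>)
qed

lemma decay_moment_integrable:
  fixes K :: "'a::euclidean_space \<Rightarrow> complex"
  assumes "decay (N + real k) K" "N > real DIM('a)" "K \<in> borel_measurable borel"
  shows "integrable lborel (\<lambda>x. (1 + norm x) ^ k * norm (K x))"
proof -
  obtain B where B: "B \<ge> 0" "\<And>x. norm (K x) \<le> B * (1 + norm x) powr (-(N + real k))"
    using decayE[OF assms(1)] by blast
  have "(1 + norm x) ^ k * norm (K x) \<le> B * (1 + norm x) powr (-N)" for x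
  proof -
    have "1 + norm x > 0" by (simp add: add_pos_nonneg)
    have "(1 + norm x) ^ k * norm (K x) \<le> (1 + norm x) powr (real k) * (B * (1 + norm x) powr (-(N + real k)))"
      using B(2)[of x] \<open>1 + norm x > 0\<close> by (simp add: powr_realpow mult_left_mono)
    also have "\<dots> = B * (1 + norm x) powr (-N)"
      by (simp add: mult_ac flip: powr_add)
    finally show ?thesis .
  qed
  then show ?thesis
    by (intro Bochner_Integration.integrable_bound[OF integrable_mult_right[OF integrable_radial_powr[OF assms(2)]], of _ B])
       (use B assms(3) in \<open>auto simp: abs_mult add_nonneg_nonneg\<close>)
qed

section \<open>Dyadic convolutions\<close>

lemma schwartz_differentiable: "\<psi> \<in> schwartz \<Longrightarrow> \<psi> differentiable (at x)"
  by (auto simp: schwartz_def smooth_def dest: bspec[of _ _ "[]"])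

lemma schwartz_continuous: "\<psi> \<in> schwartz \<Longrightarrow> continuous_on UNIV \<psi>"
  by (simp add: schwartz_differentiable differentiable_imp_continuous_on differentiable_at_imp_differentiable_on)

lemma schwartz_measurable: "\<psi> \<in> schwartz \<Longrightarrow> \<psi> \<in> borel_measurable borel"
  by (intro borel_measurable_continuous_onI schwartz_continuous)

lemma schwartz_decay:
  assumes "\<psi> \<in> schwartz" shows "decay (real k) \<psi>"
proof -
  obtain B where B: "\<And>x. (1 + norm x) ^ k * norm (\<psi> x) \<le> B"
  proof -
    have "[] \<in> lists (Basis :: 'a set)" by simp
    then have "\<exists>B. \<forall>x. (1 + norm x) ^ k * norm (iter_deriv [] \<psi> x) \<le> B"
      using assms unfolding schwartz_def by blast
    then show ?thesis using that by auto
  qed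
  show ?thesis
  proof (rule decayI)
    fix x :: 'a
    have "1 + norm x > 0" by (simp add: add_pos_nonneg)
    then show "norm (\<psi> x) \<le> B * (1 + norm x) powr (- real k)"
      using B[of x] by (simp add: powr_minus powr_realpow field_simps)
  qed
qed

lemma schwartz_integrable:
  fixes \<psi> :: "'a::euclidean_space \<Rightarrow> complex"
  assumes "\<psi> \<in> schwartz" shows "integrable lborel \<psi>"
  by (rule decay_integrable[OF schwartz_decay[OF assms, of "DIM('a) + 1"] _ schwartz_measurable[OF assms]]) simp

text \<open>The Schwartz bounds control the partial derivatives along \<open>Basis\<close>; their
  sum bounds the operator norm of the derivative, and the mean value inequality applies.\<close>

lemma schwartz_lipschitz:
  fixes \<psi> :: "'a::euclidean_space \<Rightarrow> complex"
  assumes "\<psi> \<in> schwartz"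
  obtains L where "L \<ge> 0" "\<And>x y. norm (\<psi> x - \<psi> y) \<le> L * norm (x - y)"
proof -
  have "\<exists>B. \<forall>x. norm (frechet_derivative \<psi> (at x) b) \<le> B" if "b \<in> Basis" for b
  proof -
    have "[b] \<in> lists Basis" using that by simp
    then have "\<exists>B. \<forall>x. (1 + norm x) ^ 0 * norm (iter_deriv [b] \<psi> x) \<le> B"
      using assms unfolding schwartz_def by blast
    then show ?thesis by simp
  qed
  then obtain B where B: "\<And>b x. b \<in> Basis \<Longrightarrow> norm (frechet_derivative \<psi> (at x) b) \<le> B b"
    by metis
  define L where "L = (\<Sum>b\<in>Basis. \<bar>B b\<bar>)"
  have lin: "linear (frechet_derivative \<psi> (at x))" for x
    using schwartz_differentiable[OF assms] by (simp add: linear_frechet_derivative)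
  have on: "onorm (frechet_derivative \<psi> (at x)) \<le> L" for x
  proof (rule onorm_le)
    fix h :: 'a
    have "norm (frechet_derivative \<psi> (at x) h) = norm (\<Sum>b\<in>Basis. (h \<bullet> b) *\<^sub>R frechet_derivative \<psi> (at x) b)"
      by (subst euclidean_representation[of h, symmetric]) (simp add: linear_sum[OF lin] linear_cmul[OF lin] del: euclidean_representation)
    also have "\<dots> \<le> (\<Sum>b\<in>Basis. \<bar>h \<bullet> b\<bar> * norm (frechet_derivative \<psi> (at x) b))"
      by (rule order_trans[OF norm_sum]) simp
    also have "\<dots> \<le> (\<Sum>b\<in>Basis. norm h * \<bar>B b\<bar>)"
      by (intro sum_mono mult_mono Basis_le_norm order_trans[OF B abs_ge_self]) auto
    finally show "norm (frechet_derivative \<psi> (at x) h) \<le> L * norm h"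
      by (simp add: L_def sum_distrib_left mult.commute)
  qed
  have "norm (\<psi> x - \<psi> y) \<le> L * norm (x - y)" for x y
    by (rule differentiable_bound[of UNIV \<psi> "\<lambda>x. frechet_derivative \<psi> (at x)"])
       (use on schwartz_differentiable[OF assms] in \<open>auto simp: frechet_derivative_works\<close>)
  moreover have "L \<ge> 0" by (simp add: L_def sum_nonneg)
  ultimately show ?thesis using that by blast
qed

lemma continuous_on_norm_lipschitz:
  assumes "L \<ge> 0" "\<And>x y. norm (f x - f y) \<le> L * norm (x - y)"
  shows "continuous_on UNIV f"
  by (rule lipschitz_on_continuous_on[OF lipschitz_onI[of _ _ L]]) (use assms in \<open>auto simp: dist_norm\<close>)

text \<open>This is \<open>K_j * g\<close> after the substitution \<open>y = x - 2^-j v\<close>, which removes the factors \<open>2^(jn)\<close>.\<close>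

definition dconv :: "('a::euclidean_space \<Rightarrow> complex) \<Rightarrow> int \<Rightarrow> ('a \<Rightarrow> complex) \<Rightarrow> 'a \<Rightarrow> complex" where
  "dconv K j g x = (LINT v|lborel. K v * g (x - (2 powi (-j)) *\<^sub>R v))"

lemma distr_convolution_eq_dconv:
  fixes g :: "'a::euclidean_space \<Rightarrow> complex"
  assumes [measurable]: "\<psi> \<in> borel_measurable borel" "g \<in> borel_measurable borel"
  shows "distr_convolution (dyadic_dilate \<psi> j) (regular_distribution g) x = dconv \<psi> j g x"
proof -
  let ?F = "\<lambda>y. g y * (of_real (2 powi (j * int DIM('a))) * \<psi> ((2 powi j) *\<^sub>R (x - y)))"
  have "distr_convolution (dyadic_dilate \<psi> j) (regular_distribution g) x = (LINT y|lborel. ?F y)"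
    unfolding distr_convolution_def regular_distribution_def dyadic_dilate_def
    by (intro integral_completion) measurable
  also have "\<dots> = (\<bar>- (2 powi (-j))\<bar> ^ DIM('a)) *\<^sub>R (LINT v|lborel. ?F (x + (- (2 powi (-j))) *\<^sub>R v))"
    by (intro lborel_integral_affine) auto
  also have "(\<lambda>v. ?F (x + (- (2 powi (-j))) *\<^sub>R v)) = (\<lambda>v. of_real (2 powi (j * int DIM('a))) * (\<psi> v * g (x - (2 powi (-j)) *\<^sub>R v)))"
    by (simp add: fun_eq_iff mult_ac flip: power_int_add)
  also have "(\<bar>- (2 powi (-j))\<bar> ^ DIM('a)) *\<^sub>R (LINT v|lborel. of_real (2 powi (j * int DIM('a))) * (\<psi> v * g (x - (2 powi (-j)) *\<^sub>R v)))
      = (\<bar>- (2 powi (-j))\<bar> ^ DIM('a) * 2 powi (j * int DIM('a))) *\<^sub>R dconv \<psi> j g x"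
    by (simp add: dconv_def scaleR_conv_of_real)
  also have "\<bar>- (2 powi (-j))\<bar> ^ DIM('a) * 2 powi (j * int DIM('a)) = (1::real)"
    by (simp add: power_int_mult power_int_minus field_simps flip: power_int_of_nat)
  finally show ?thesis by simp
qed

lemma dconv_integrable:
  fixes K g :: "'a::euclidean_space \<Rightarrow> complex"
  assumes "integrable lborel K" and [measurable]: "g \<in> borel_measurable borel" and "\<And>y. norm (g y) \<le> A"
  shows "integrable lborel (\<lambda>v. K v * g (x - c *\<^sub>R v))"
proof -
  have [measurable]: "K \<in> borel_measurable borel" using assms(1) by auto
  \<comment> \<open>\<open>undefined\<close> is just some point at which to evaluate the bound on
    \<open>g\<close>.\<close>
  have "A \<ge> 0" using assms(3)[of undefined] norm_ge_zero order_trans by blast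
  have "norm (g (x - c *\<^sub>R v) * K v) \<le> norm (A *\<^sub>R K v)" for v
    using mult_right_mono[OF assms(3)[of "x - c *\<^sub>R v"], of "norm (K v)"] \<open>A \<ge> 0\<close>
    by (simp add: norm_mult mult.commute)
  then show ?thesis
    by (intro Bochner_Integration.integrable_bound[OF integrable_scaleR_right[OF assms(1), of A]]) (auto simp: mult.commute)
qed

lemma dconv_bound:
  assumes "integrable lborel K" "g \<in> borel_measurable borel" "\<And>y. norm (g y) \<le> A"
  shows "norm (dconv K j g x) \<le> A * (LINT v|lborel. norm (K v))"
proof -
  have "norm (dconv K j g x) \<le> (LINT v|lborel. norm (K v * g (x - (2 powi (-j)) *\<^sub>R v)))"
    unfolding dconv_def by (rule integral_norm_bound)
  also have "\<dots> \<le> (LINT v|lborel. A * norm (K v))"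
    by (intro integral_mono integrable_norm dconv_integrable[OF assms] integrable_mult_right assms(1))
       (auto simp: norm_mult intro!: mult_right_mono assms(3) simp: mult.commute[of A] mult_left_mono[OF assms(3)])
  finally show ?thesis by simp
qed

text \<open>The substitution v = 2w moves the kernel at scale j + 1 to scale j, where it becomes 2^n
  \<theta>(2w). Passing from one scale to the next is thus convolution with one fixed kernel
  \<open>\<kappa>\<close>.\<close>

lemma dconv_telescope:
  fixes \<theta> :: "'a::euclidean_space \<Rightarrow> complex"
  assumes "integrable lborel \<theta>" and [measurable]: "g \<in> borel_measurable borel" and "\<And>y. norm (g y) \<le> A"
    and \<kappa>: "\<And>w. \<kappa> w = of_real (2 ^ DIM('a)) * \<theta> (2 *\<^sub>R w) - \<theta> w"
  shows "dconv \<theta> (j + 1) g x - dconv \<theta> j g x = dconv \<kappa> j g x"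
proof -
  have [measurable]: "\<theta> \<in> borel_measurable borel" using assms(1) by auto
  have i: "integrable lborel (\<lambda>v. \<theta> (2 *\<^sub>R v))"
    using lborel_integrable_affine[OF assms(1), of 2 0] by simp
  have eq: "dconv \<theta> (j + 1) g x = (LINT v|lborel. of_real (2 ^ DIM('a)) * \<theta> (2 *\<^sub>R v) * g (x - (2 powi (-j)) *\<^sub>R v))"
    unfolding dconv_def
    by (subst lborel_integral_affine[where c=2 and t=0])
       (auto simp: scaleR_conv_of_real power_int_add power_int_diff mult.assoc)
  show ?thesis
    unfolding eq unfolding dconv_def \<kappa>
    by (subst Bochner_Integration.integral_diff[symmetric])
       (auto intro!: dconv_integrable[OF _ _ assms(3)] integrable_mult_right i assms(1) simp: algebra_simps)
qed

text \<open>Fubini. When \<open>\<kappa>\<close> is the convolution of \<open>\<mu>\<close> and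
  \<open>\<psi>\<close>, its dyadic convolution with \<open>g\<close> is a
  \<open>\<mu>\<close>-weighted mean of values of \<open>\<psi>_j * g\<close> at the points x -
  2^(-j) v, so a large mean forces a large value at a point not far from x on the scale
  2^(-j).\<close>

lemma dconv_assoc:
  fixes \<mu> \<psi> :: "'a::euclidean_space \<Rightarrow> complex"
  assumes "integrable lborel \<mu>" "integrable lborel \<psi>"
    and [measurable]: "g \<in> borel_measurable borel" and gA: "\<And>y. norm (g y) \<le> A"
    and \<kappa>: "\<And>w. \<kappa> w = (LINT v|lborel. \<mu> v * \<psi> (w - v))"
  shows "dconv \<kappa> j g x = (LINT v|lborel. \<mu> v * dconv \<psi> j g (x - (2 powi (-j)) *\<^sub>R v))"
proof -
  have m[measurable]: "\<mu> \<in> borel_measurable borel" "\<psi> \<in> borel_measurable borel" using assms(1,2) by auto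
  have A: "A \<ge> 0" using gA[of undefined] norm_ge_zero order_trans by blast
  let ?c = "2 powi (-j) :: real"
  let ?F = "\<lambda>(v, w). \<mu> v * \<psi> (w - v) * g (x - ?c *\<^sub>R w)"
  have shift: "integrable lborel (\<lambda>w. \<psi> (w - v))" for v
    using lborel_integrable_affine[OF assms(2), of 1 "-v"] by simp
  have nshift: "(LINT w|lborel. norm (\<psi> (w - v))) = (LINT w|lborel. norm (\<psi> w))" for v
    using lborel_integral_affine[of "\<lambda>w. norm (\<psi> w)" 1 "-v"] by simp
  have int: "integrable (lborel \<Otimes>\<^sub>M lborel) ?F"
  proof (rule lborel_pair.Fubini_integrable)
    show "?F \<in> borel_measurable (lborel \<Otimes>\<^sub>M lborel)" by measurable
    have *: "integrable lborel (\<lambda>w. \<mu> v * \<psi> (w - v) * g (x - ?c *\<^sub>R w))" for v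
      by (intro dconv_integrable[OF integrable_mult_right[OF shift] assms(3) gA])
    show "AE v in lborel. integrable lborel (\<lambda>w. ?F (v, w))" using * by simp
    have "norm (LINT w|lborel. norm (?F (v, w))) \<le> norm ((A * (LINT w|lborel. norm (\<psi> w))) *\<^sub>R \<mu> v)" for v
    proof -
      have "(LINT w|lborel. norm (?F (v, w))) \<le> (LINT w|lborel. A * norm (\<mu> v) * norm (\<psi> (w - v)))"
      proof (rule integral_mono)
        show "integrable lborel (\<lambda>w. norm (?F (v, w)))" using integrable_norm[OF *[of v]] by simp
        show "integrable lborel (\<lambda>w. A * norm (\<mu> v) * norm (\<psi> (w - v)))"
          by (intro integrable_mult_right integrable_norm shift)
        show "norm (?F (v, w)) \<le> A * norm (\<mu> v) * norm (\<psi> (w - v))" for w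
          using mult_left_mono[OF gA[of "x - ?c *\<^sub>R w"], of "norm (\<mu> v) * norm (\<psi> (w - v))"] by (simp add: norm_mult mult_ac)
      qed
      also have "\<dots> = A * norm (\<mu> v) * (LINT w|lborel. norm (\<psi> w))" by (simp add: nshift)
      finally show ?thesis using A by (simp add: mult_ac abs_of_nonneg)
    qed
    then show "integrable lborel (\<lambda>v. LINT w|lborel. norm (?F (v, w)))"
      by (intro Bochner_Integration.integrable_bound[OF integrable_scaleR_right[OF assms(1)]]) auto
  qed
  have "dconv \<kappa> j g x = (LINT w|lborel. (LINT v|lborel. ?F (v, w)))"
    unfolding dconv_def \<kappa> by simp
  also have "\<dots> = (LINT v|lborel. (LINT w|lborel. ?F (v, w)))"
    using lborel_pair.Fubini_integral[OF int] by simp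
  also have "\<dots> = (LINT v|lborel. \<mu> v * dconv \<psi> j g (x - ?c *\<^sub>R v))"
  proof (rule Bochner_Integration.integral_cong[OF refl])
    fix v
    have "(LINT w|lborel. \<psi> (w - v) * g (x - ?c *\<^sub>R w)) = (LINT w|lborel. \<psi> w * g (x - ?c *\<^sub>R v - ?c *\<^sub>R w))"
      by (subst lborel_integral_affine[where c=1 and t=v]) (auto simp: algebra_simps)
    then show "(LINT w|lborel. ?F (v, w)) = \<mu> v * dconv \<psi> j g (x - ?c *\<^sub>R v)"
      by (simp add: dconv_def mult.assoc)
  qed
  finally show ?thesis .
qed

text \<open>An approximate identity, by dominated convergence. It identifies the end of the
  telescoping sum over scales.\<close>

lemma dconv_tendsto:
  assumes K: "integrable lborel K" and g: "continuous_on UNIV g" and gA: "\<And>y. norm (g y) \<le> A"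
  shows "(\<lambda>m. dconv K (j0 + int m) g x) \<longlonglongrightarrow> (LINT v|lborel. K v) * g x"
proof -
  have [measurable]: "g \<in> borel_measurable borel" using g by (rule borel_measurable_continuous_onI)
  have [measurable]: "K \<in> borel_measurable borel" using K by auto
  have lim: "(\<lambda>m. 2 powi (-(j0 + int m)) :: real) \<longlonglongrightarrow> 0"
  proof -
    have "(\<lambda>m. 2 powi (-j0) * (1/2) ^ m :: real) \<longlonglongrightarrow> 2 powi (-j0) * 0"
      by (intro tendsto_intros LIMSEQ_power_zero) auto
    then show ?thesis by (simp add: power_int_add power_int_diff power_int_minus power_divide field_simps)
  qed
  have "(\<lambda>m. LINT v|lborel. K v * g (x - (2 powi (-(j0 + int m))) *\<^sub>R v)) \<longlonglongrightarrow> (LINT v|lborel. K v * g x)"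
  proof (rule integral_dominated_convergence)
    show "integrable lborel (\<lambda>v. A * norm (K v))" using K by auto
    show "AE v in lborel. (\<lambda>m. K v * g (x - (2 powi (-(j0 + int m))) *\<^sub>R v)) \<longlonglongrightarrow> K v * g x"
    proof (intro AE_I2 tendsto_intros)
      fix v
      have "(\<lambda>m. x - (2 powi (-(j0 + int m))) *\<^sub>R v) \<longlonglongrightarrow> x - 0 *\<^sub>R v"
        by (intro tendsto_intros lim)
      then show "(\<lambda>m. g (x - (2 powi (-(j0 + int m))) *\<^sub>R v)) \<longlonglongrightarrow> g x"
        using g by (intro isCont_tendsto_compose[of x g]) (auto simp: continuous_on_eq_continuous_at)
    qed
    show "\<And>m. AE v in lborel. norm (K v * g (x - (2 powi (-(j0 + int m))) *\<^sub>R v)) \<le> A * norm (K v)"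
      by (intro AE_I2) (auto simp: norm_mult mult.commute[of A] mult_left_mono[OF gA])
  qed auto
  then show ?thesis by (simp add: dconv_def)
qed

lemma one_plus_norm_shift:
  assumes "norm (h::'a::real_normed_vector) \<le> 1"
  shows "1 + norm v \<le> 2 * (1 + norm (v + h))"
proof -
  have "norm v \<le> norm (v + h) + norm h" using norm_triangle_ineq4[of "v + h" h] by simp
  also have "\<dots> \<le> norm (v + h) + 1" using assms by simp
  also have "\<dots> \<le> 1 + 2 * norm (v + h)" by simp
  finally show ?thesis by simp
qed

text \<open>The geometric mean of the Lipschitz bound and the decay is integrable.\<close>

lemma dconv_hoelder:
  fixes K :: "'a::euclidean_space \<Rightarrow> complex"
  assumes d: "decay (2 * real DIM('a) + 2) K"
    and L: "L \<ge> 0" "\<And>x y. norm (K x - K y) \<le> L * norm (x - y)"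
  shows "\<exists>C\<ge>0. \<forall>j g x x'. g \<in> borel_measurable borel \<longrightarrow> (\<forall>y. norm (g y) \<le> 1) \<longrightarrow>
     norm (dconv K j g x - dconv K j g x') \<le> C * sqrt (2 powi j * norm (x - x'))"
proof -
  \<comment> \<open>Taking the square root halves the exponent of decay, and N / 2 = n + 1 is still
    integrable.\<close>
  define N where "N = 2 * real DIM('a) + 2"
  obtain B where B: "B \<ge> 0" "\<And>x. norm (K x) \<le> B * (1 + norm x) powr (-N)"
    using decayE[OF d[folded N_def]] by blast
  have contK: "continuous_on UNIV K"
    by (rule continuous_on_norm_lipschitz[OF L])
  have [measurable]: "K \<in> borel_measurable borel"
    by (rule borel_measurable_continuous_onI[OF contK])
  have iK: "integrable lborel K"
    by (rule decay_integrable[OF d]) auto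
  define I where "I = (LINT v::'a|lborel. (1 + norm v) powr (- (real DIM('a) + 1)))"
  define I1 where "I1 = (LINT v|lborel. norm (K v))"
  define E where "E = sqrt (L * (B * (1 + 2 powr N)))"
  have iI: "integrable lborel (\<lambda>v::'a. (1 + norm v) powr (- (real DIM('a) + 1)))"
    by (rule integrable_radial_powr) auto
  have I0: "I \<ge> 0" "I1 \<ge> 0" "E \<ge> 0" unfolding I_def I1_def E_def using B L by auto
  have sh: "integrable lborel (\<lambda>v. K (v + h))" for h
    using lborel_integrable_affine[OF iK, of 1 h] by (simp add: add.commute)
  have nsh: "(LINT v|lborel. norm (K (v + h))) = I1" for h
    using lborel_integral_affine[of "\<lambda>w. norm (K w)" 1 h] by (simp add: I1_def add.commute)
  have main: "(LINT v|lborel. norm (K (v + h) - K v)) \<le> (E * I + 2 * I1) * sqrt (norm h)" for h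
  proof (cases "norm h \<le> 1")
    case True
    have pt: "norm (K (v + h) - K v) \<le> sqrt (norm h) * E * (1 + norm v) powr (- (real DIM('a) + 1))" for v
    proof -
      have p: "1 + norm v > 0" "1 + norm (v + h) > 0" by (auto simp: add_pos_nonneg)
      have "(1 + norm (v + h)) powr (-N) \<le> ((1 + norm v) / 2) powr (-N)"
        using one_plus_norm_shift[OF True, of v] p by (intro powr_mono2') (auto simp: N_def)
      also have "\<dots> = 2 powr N * (1 + norm v) powr (-N)"
        using p by (simp add: powr_divide powr_minus_divide field_simps)
      finally have "norm (K (v + h)) \<le> B * (2 powr N * (1 + norm v) powr (-N))"
        using B mult_left_mono[of _ _ B] order_trans by blast
      then have "norm (K (v + h) - K v) \<le> B * (1 + 2 powr N) * (1 + norm v) powr (-N)"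
        using B(2)[of v] norm_triangle_ineq4[of "K (v + h)" "K v"] by (simp add: algebra_simps)
      then have "norm (K (v + h) - K v) * norm (K (v + h) - K v) \<le> (L * norm h) * (B * (1 + 2 powr N) * (1 + norm v) powr (-N))"
        using L(1) L(2)[of "v + h" v] by (intro mult_mono) auto
      then have "norm (K (v + h) - K v) \<le> sqrt ((L * norm h) * (B * (1 + 2 powr N) * (1 + norm v) powr (-N)))"
        by (intro real_le_rsqrt) (simp add: power2_eq_square)
      also have "\<dots> = sqrt (norm h) * E * sqrt ((1 + norm v) powr (-N))"
        by (simp add: E_def real_sqrt_mult mult_ac)
      also have "sqrt ((1 + norm v) powr (-N)) = (1 + norm v) powr (- (real DIM('a) + 1))"
      proof -
        have "- N / 2 = - (real DIM('a) + 1)" by (simp add: N_def)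
        then show ?thesis by (subst powr_half_sqrt[symmetric]) (simp_all add: powr_powr)
      qed
      finally show ?thesis .
    qed
    have "(LINT v|lborel. norm (K (v + h) - K v)) \<le> (LINT v::'a|lborel. sqrt (norm h) * E * (1 + norm v) powr (- (real DIM('a) + 1)))"
      by (rule integral_mono; (rule pt | intro integrable_norm Bochner_Integration.integrable_diff sh iK integrable_mult_right iI))
    also have "\<dots> = E * I * sqrt (norm h)" by (simp add: I_def)
    also have "\<dots> \<le> (E * I + 2 * I1) * sqrt (norm h)"
      using I0 by (intro mult_right_mono) auto
    finally show ?thesis .
  next
    case False
    have "(LINT v|lborel. norm (K (v + h) - K v)) \<le> (LINT v|lborel. norm (K (v + h)) + norm (K v))"
      by (intro integral_mono norm_triangle_ineq4) (auto intro!: sh iK)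
    also have "\<dots> = 2 * I1 * 1"
      using nsh[of h] by (subst Bochner_Integration.integral_add) (auto intro!: sh iK simp: I1_def)
    also have "\<dots> \<le> (E * I + 2 * I1) * sqrt (norm h)"
      using I0 False by (intro mult_mono) auto
    finally show ?thesis .
  qed
  show ?thesis
  proof (intro exI[of _ "E * I + 2 * I1"] conjI allI impI)
    show "E * I + 2 * I1 \<ge> 0" using I0 by auto
    fix j :: int and g :: "'a \<Rightarrow> complex" and x x' :: 'a
    assume g[measurable]: "g \<in> borel_measurable borel" and "\<forall>y. norm (g y) \<le> 1"
    then have g1: "\<And>y. norm (g y) \<le> 1" by blast
    \<comment> \<open>Moving the point from x' to x is shifted onto the kernel as a translation by
      2^j (x - x'). Only the boundedness of \<open>g\<close> is then used.\<close>
    let ?c = "2 powi (-j) :: real" and ?h = "(2 powi j) *\<^sub>R (x - x')"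
    have cc: "?c * 2 powi j = 1" by (simp flip: power_int_add)
    have eq: "dconv K j g x = (LINT v|lborel. K (v + ?h) * g (x' - ?c *\<^sub>R v))"
      unfolding dconv_def
      by (subst lborel_integral_affine[where c=1 and t="?h"])
         (use cc in \<open>auto simp: algebra_simps\<close>)
    have "dconv K j g x - dconv K j g x' = (LINT v|lborel. (K (v + ?h) - K v) * g (x' - ?c *\<^sub>R v))"
      unfolding eq unfolding dconv_def
      by (subst Bochner_Integration.integral_diff[OF dconv_integrable[OF sh g g1] dconv_integrable[OF iK g g1], symmetric])
         (simp add: left_diff_distrib)
    also have "norm \<dots> \<le> (LINT v|lborel. norm ((K (v + ?h) - K v) * g (x' - ?c *\<^sub>R v)))"
      by (rule integral_norm_bound)
    also have "\<dots> \<le> (LINT v|lborel. norm (K (v + ?h) - K v))"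
      by (intro integral_mono integrable_norm dconv_integrable[OF _ g g1] Bochner_Integration.integrable_diff sh iK)
         (simp add: norm_mult mult_left_le g1)
    also have "\<dots> \<le> (E * I + 2 * I1) * sqrt (norm ?h)" by (rule main)
    finally show "norm (dconv K j g x - dconv K j g x') \<le> (E * I + 2 * I1) * sqrt (2 powi j * norm (x - x'))"
      by simp
  qed
qed

text \<open>If \<open>G\<close> were at most \<sigma> on the ball of radius \<rho>, then
  \<open>norm (G v)\<close> would be at most \<sigma> + (A / \<rho>) \<open>norm v\<close>
  everywhere, since the second term exceeds A outside the ball. Integration against
  \<open>\<mu>\<close> contradicts the assumed size.\<close>

lemma mean_value_detection:
  fixes \<mu> G :: "'a::euclidean_space \<Rightarrow> complex"
  assumes i: "integrable lborel \<mu>" "integrable lborel (\<lambda>v. norm v * norm (\<mu> v))"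
    and G: "\<And>y. norm (G y) \<le> A" and \<rho>: "\<rho> > 0" and \<sigma>: "\<sigma> \<ge> 0"
    and big: "norm (LINT v|lborel. \<mu> v * G v) > \<sigma> * (LINT v|lborel. norm (\<mu> v)) + A / \<rho> * (LINT v|lborel. norm v * norm (\<mu> v))"
  shows "\<exists>v. norm v \<le> \<rho> \<and> norm (G v) > \<sigma>"
proof (rule ccontr)
  assume neg: "\<not> ?thesis"
  have small: "norm (G v) \<le> \<sigma>" if "norm v \<le> \<rho>" for v using that neg by force
  have A: "A \<ge> 0" using G[of undefined] norm_ge_zero order_trans by blast
  have pt: "norm (G v) \<le> \<sigma> + A / \<rho> * norm v" for v
  proof (cases "norm v \<le> \<rho>")
    case True
    then show ?thesis using small[OF True] A \<rho> by (simp add: add_increasing2)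
  next
    case False
    then have "A * 1 \<le> A * (norm v / \<rho>)" using A \<rho> by (intro mult_left_mono) auto
    then show ?thesis using G[of v] \<sigma> by simp
  qed
  have ii: "integrable lborel (\<lambda>v. \<sigma> * norm (\<mu> v) + A / \<rho> * (norm v * norm (\<mu> v)))"
    using i by (intro Bochner_Integration.integrable_add integrable_mult_right integrable_norm)
  have "norm (LINT v|lborel. \<mu> v * G v) \<le> (LINT v|lborel. \<sigma> * norm (\<mu> v) + A / \<rho> * (norm v * norm (\<mu> v)))"
  proof (cases "integrable lborel (\<lambda>v. \<mu> v * G v)")
    case True
    show ?thesis
      by (rule Bochner_Integration.integral_norm_bound_integral[OF True ii])
         (use mult_left_mono[OF pt norm_ge_zero[of "\<mu> _"]] in \<open>simp add: norm_mult algebra_simps\<close>)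
  next
    case False
    \<comment> \<open>The integral of a non-integrable function is 0 by convention, so the bound is
      trivial here.\<close>
    then show ?thesis using \<sigma> A \<rho> by (simp add: not_integrable_integral_eq integral_nonneg)
  qed
  also have "\<dots> = \<sigma> * (LINT v|lborel. norm (\<mu> v)) + A / \<rho> * (LINT v|lborel. norm v * norm (\<mu> v))"
    using i by (subst Bochner_Integration.integral_add) auto
  finally show False using big by simp
qed

section \<open>Fourier transforms of finitely smooth functions\<close>

text \<open>Derivatives along a single direction suffice: the decay of a Fourier transform in the
  direction \<open>e\<close> is governed by pure derivatives in that direction.\<close>

primrec dir_smooth :: "'a::euclidean_space \<Rightarrow> nat \<Rightarrow> ('a \<Rightarrow> complex) \<Rightarrow> bool" where
  "dir_smooth e 0 f \<longleftrightarrow> continuous_on UNIV f"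
| "dir_smooth e (Suc n) f \<longleftrightarrow> dir_smooth e n f \<and>
     (\<exists>f'. dir_smooth e n f' \<and> (\<forall>x. ((\<lambda>t. f (x + t *\<^sub>R e)) has_vector_derivative f' x) (at 0)))"

lemma dir_smooth_continuous: "dir_smooth e n f \<Longrightarrow> continuous_on UNIV f"
  by (induction n arbitrary: f) auto

lemma dir_smooth_const: "dir_smooth e n (\<lambda>x. c)"
proof (induction n arbitrary: c)
  case (Suc n)
  show ?case by (auto intro!: Suc exI[of _ "\<lambda>x. 0"])
qed auto

lemma dir_smooth_add: "dir_smooth e n f \<Longrightarrow> dir_smooth e n g \<Longrightarrow> dir_smooth e n (\<lambda>x. f x + g x)"
proof (induction n arbitrary: f g)
  case 0
  then show ?case by (auto intro: continuous_intros)
next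
  case (Suc n)
  from Suc.prems obtain f' g' where
    "dir_smooth e n f'" "dir_smooth e n g'"
    "\<And>x. ((\<lambda>t. f (x + t *\<^sub>R e)) has_vector_derivative f' x) (at 0)"
    "\<And>x. ((\<lambda>t. g (x + t *\<^sub>R e)) has_vector_derivative g' x) (at 0)" by auto
  with Suc show ?case
    by (auto intro!: exI[of _ "\<lambda>x. f' x + g' x"] has_vector_derivative_add)
qed

lemma dir_smooth_mult: "dir_smooth e n f \<Longrightarrow> dir_smooth e n g \<Longrightarrow> dir_smooth e n (\<lambda>x. f x * g x)"
proof (induction n arbitrary: f g)
  case 0
  then show ?case by (auto intro: continuous_intros)
next
  case (Suc n)
  from Suc.prems obtain f' g' where
    *: "dir_smooth e n f'" "dir_smooth e n g'"
    "\<And>x. ((\<lambda>t. f (x + t *\<^sub>R e)) has_vector_derivative f' x) (at 0)"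
    "\<And>x. ((\<lambda>t. g (x + t *\<^sub>R e)) has_vector_derivative g' x) (at 0)" by auto
  have "((\<lambda>t. f (x + t *\<^sub>R e) * g (x + t *\<^sub>R e)) has_vector_derivative f x * g' x + f' x * g x) (at 0)" for x
    using has_vector_derivative_mult[OF *(3)[of x] *(4)[of x]] by simp
  then show ?case
    using Suc * by (auto intro!: exI[of _ "\<lambda>x. f x * g' x + f' x * g x"] dir_smooth_add)
qed

lemma dir_smooth_inverse:
  "dir_smooth e n f \<Longrightarrow> (\<And>x. f x \<noteq> 0) \<Longrightarrow> dir_smooth e n (\<lambda>x. inverse (f x))"
proof (induction n arbitrary: f)
  case 0
  then show ?case by (auto intro: continuous_intros)
next
  case (Suc n)
  from Suc.prems obtain f' where
    *: "dir_smooth e n f'" "\<And>x. ((\<lambda>t. f (x + t *\<^sub>R e)) has_vector_derivative f' x) (at 0)" by auto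
  have i: "dir_smooth e n (\<lambda>x. inverse (f x))" using Suc by auto
  have "((\<lambda>t. inverse (f (x + t *\<^sub>R e))) has_vector_derivative ((-1) * (f' x * (inverse (f x) * inverse (f x))))) (at 0)" for x
  proof -
    have "(inverse has_field_derivative - (inverse (f x) * inverse (f x))) (at (f (x + 0 *\<^sub>R e)))"
      using DERIV_inverse'[OF DERIV_ident, of "f x" UNIV] Suc.prems(2)[of x] by simp
    from field_vector_diff_chain_at[OF *(2)[of x] this] show ?thesis
      by (simp add: o_def)
  qed
  then show ?case
    using i * by (auto intro!: exI[of _ "\<lambda>x. (-1) * (f' x * (inverse (f x) * inverse (f x)))"] dir_smooth_mult dir_smooth_const)
qed

lemma dir_smooth_cnj: "dir_smooth e n f \<Longrightarrow> dir_smooth e n (\<lambda>x. cnj (f x))"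
proof (induction n arbitrary: f)
  case 0
  then show ?case by (auto intro: continuous_intros)
next
  case (Suc n)
  then obtain f' where f': "dir_smooth e n f'" "\<And>x. ((\<lambda>t. f (x + t *\<^sub>R e)) has_vector_derivative f' x) (at 0)"
    by auto
  then have "((\<lambda>t. cnj (f (x + t *\<^sub>R e))) has_vector_derivative cnj (f' x)) (at 0)" for x
    by (intro has_vector_derivative_cnj)
  then show ?case using Suc f'(1) by (auto intro!: exI[of _ "\<lambda>x. cnj (f' x)"])
qed

lemma dir_smooth_norm_square: "dir_smooth e n (\<lambda>x. of_real (x \<bullet> x))"
proof (induction n)
  case 0
  show ?case by (auto intro!: continuous_intros)
next
  case (Suc n)
  have inner: "dir_smooth e n (\<lambda>x. of_real (x \<bullet> b))" for b
  proof (induction n)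
    case 0
    show ?case by (auto intro!: continuous_intros)
  next
    case (Suc n)
    have "((\<lambda>t. of_real ((x + t *\<^sub>R e) \<bullet> b)) has_vector_derivative of_real (e \<bullet> b)) (at 0)" for x
      by (intro has_vector_derivative_of_real) (auto intro!: derivative_eq_intros simp: inner_add_left)
    with Suc show ?case by (auto intro!: exI[of _ "\<lambda>x. of_real (e \<bullet> b)"] dir_smooth_const)
  qed
  have "((\<lambda>t. of_real ((x + t *\<^sub>R e) \<bullet> (x + t *\<^sub>R e))) has_vector_derivative of_real (2 * (x \<bullet> e))) (at 0)" for x
  proof (rule has_vector_derivative_of_real)
    have "((\<lambda>t. x \<bullet> x + 2 * t * (x \<bullet> e) + t * t * (e \<bullet> e)) has_real_derivative 2 * (x \<bullet> e)) (at 0)"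
      by (auto intro!: derivative_eq_intros)
    moreover have "(\<lambda>t. (x + t *\<^sub>R e) \<bullet> (x + t *\<^sub>R e)) = (\<lambda>t. x \<bullet> x + 2 * t * (x \<bullet> e) + t * t * (e \<bullet> e))"
      by (simp add: fun_eq_iff algebra_simps inner_commute)
    ultimately show "((\<lambda>t. (x + t *\<^sub>R e) \<bullet> (x + t *\<^sub>R e)) has_real_derivative 2 * (x \<bullet> e)) (at 0)" by simp
  qed
  with Suc show ?case
    by (auto intro!: exI[of _ "\<lambda>x. of_real 2 * of_real (x \<bullet> e)"] dir_smooth_mult dir_smooth_const inner)
qed

text \<open>The exponent is at least 2, so at the kink the difference quotient is at most
  \<open>h ^ (k + 1)\<close> in absolute value and tends to 0.\<close>

lemma has_real_derivative_max_power:
  "((\<lambda>t::real. max 0 t ^ (k + 2)) has_real_derivative real (k + 2) * max 0 t ^ (k + 1)) (at t)"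
proof (cases t "0::real" rule: linorder_cases)
  case less
  have "((\<lambda>t::real. 0) has_real_derivative 0) (at t)" by simp
  then have "((\<lambda>t::real. max 0 t ^ (k + 2)) has_real_derivative 0) (at t)"
    by (rule has_field_derivative_transform_within_open[where S="{..<0}"]) (use less in auto)
  then show ?thesis using less by simp
next
  case greater
  have "((\<lambda>t::real. t ^ (k + 2)) has_real_derivative real (k + 2) * t ^ (k + 1)) (at t)"
    using DERIV_pow[of "k + 2" t UNIV] by simp
  then have "((\<lambda>t::real. max 0 t ^ (k + 2)) has_real_derivative real (k + 2) * t ^ (k + 1)) (at t)"
    by (rule has_field_derivative_transform_within_open[where S="{0<..}"]) (use greater in auto)
  then show ?thesis using greater by simp
next
  case equal
  have "((\<lambda>h::real. max 0 h ^ (k + 2) / h) \<longlongrightarrow> 0) (at 0)"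
  proof (rule tendsto_0_le[where K=1])
    show "((\<lambda>h::real. h ^ (k + 1)) \<longlongrightarrow> 0) (at 0)" by (auto intro!: tendsto_eq_intros)
    show "\<forall>\<^sub>F h in at (0::real). norm (max 0 h ^ (k + 2) / h) \<le> norm (h ^ (k + 1)) * 1"
    proof (intro always_eventually allI)
      fix h :: real
      show "norm (max 0 h ^ (k + 2) / h) \<le> norm (h ^ (k + 1)) * 1"
        by (cases "h > 0") (auto simp: max_def)
    qed
  qed
  then show ?thesis unfolding equal has_field_derivative_iff by simp
qed

text \<open>Every derivative lowers the power by one, and n + 1 powers leave a continuous function
  after n derivatives. The slack \<open>k\<close> lets the induction hypothesis serve both the
  function, with \<open>k + 1\<close>, and its derivative, with \<open>k\<close>.\<close>

lemma dir_smooth_max_power: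
  "dir_smooth e n (\<lambda>x. of_real (h x)) \<Longrightarrow> dir_smooth e n (\<lambda>x. of_real (max 0 (h x) ^ (n + 1 + k)))"
proof (induction n arbitrary: k)
  case 0
  then have "continuous_on UNIV (\<lambda>x. Re (of_real (h x) :: complex))"
    by (auto intro: continuous_intros)
  then show ?case by (auto intro!: continuous_intros)
next
  case (Suc n)
  from Suc.prems obtain f' where
    *: "dir_smooth e n f'" "\<And>x. ((\<lambda>t. of_real (h (x + t *\<^sub>R e))) has_vector_derivative f' x) (at 0)" by auto
  \<comment> \<open>Smoothness is stated for complex functions. The derivative \<open>f'\<close> of
    a real function is recovered as real because its imaginary part is the derivative of the zero
    function.\<close>
  have h: "((\<lambda>t. h (x + t *\<^sub>R e)) has_real_derivative Re (f' x)) (at 0)"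
   and f': "f' x = of_real (Re (f' x))" for x
  proof -
    have r: "((\<lambda>t. Re (of_real (h (x + t *\<^sub>R e)) :: complex)) has_vector_derivative Re (f' x)) (at 0)"
      by (rule bounded_linear.has_vector_derivative[OF bounded_linear_Re *(2)])
    then show "((\<lambda>t. h (x + t *\<^sub>R e)) has_real_derivative Re (f' x)) (at 0)"
      by (simp add: has_real_derivative_iff_has_vector_derivative)
    have "((\<lambda>t. Im (of_real (h (x + t *\<^sub>R e)) :: complex)) has_vector_derivative Im (f' x)) (at 0)"
      by (rule bounded_linear.has_vector_derivative[OF bounded_linear_Im *(2)])
    then have "Im (f' x) = 0"
      using vector_derivative_unique_at[of "\<lambda>t. 0::real" 0 0 "Im (f' x)"] by simp
    then show "f' x = of_real (Re (f' x))" by (simp add: complex_eq_iff)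
  qed
  let ?d = "\<lambda>x. of_real (real (n + k + 2)) * (of_real (max 0 (h x) ^ (n + 1 + k)) * f' x)"
  have "((\<lambda>t. of_real (max 0 (h (x + t *\<^sub>R e)) ^ (Suc n + 1 + k))) has_vector_derivative ?d x) (at 0)" for x
  proof -
    have "((\<lambda>t. max 0 (h (x + t *\<^sub>R e)) ^ (n + k + 2)) has_real_derivative (real (n + k + 2) * max 0 (h (x + 0 *\<^sub>R e)) ^ (n + k + 1)) * Re (f' x)) (at 0)"
      by (rule DERIV_chain2[OF has_real_derivative_max_power h])
    then have "((\<lambda>t. of_real (max 0 (h (x + t *\<^sub>R e)) ^ (n + k + 2)) :: complex) has_vector_derivative of_real ((real (n + k + 2) * max 0 (h x) ^ (n + k + 1)) * Re (f' x))) (at 0)"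
      by (intro has_vector_derivative_of_real) simp
    then show ?thesis by (subst f') (simp add: mult.assoc add_ac)
  qed
  moreover have "dir_smooth e n ?d"
    using Suc * by (intro dir_smooth_mult dir_smooth_const) auto
  moreover have "dir_smooth e n (\<lambda>x. of_real (max 0 (h x) ^ (Suc n + 1 + k)))"
    using Suc.IH[of "k + 1"] Suc.prems by (simp add: add_ac)
  ultimately show ?case unfolding dir_smooth.simps by blast
qed

lemma has_vector_derivative_iff_quotient:
  "(f has_vector_derivative D) (at 0) \<longleftrightarrow> ((\<lambda>t. (f t - f 0) /\<^sub>R t) \<longlongrightarrow> D) (at (0::real))"
proof -
  have "(f has_vector_derivative D) (at 0) \<longleftrightarrow> ((\<lambda>h. norm (f h - f 0 - h *\<^sub>R D) / norm h) \<longlongrightarrow> 0) (at (0::real))"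
    by (simp add: has_vector_derivative_def has_derivative_at bounded_linear_scaleR_left)
  also have "\<dots> \<longleftrightarrow> ((\<lambda>h. norm ((f h - f 0) /\<^sub>R h - D)) \<longlongrightarrow> 0) (at (0::real))"
  proof (rule filterlim_cong[OF refl refl])
    show "\<forall>\<^sub>F h in at (0::real). norm (f h - f 0 - h *\<^sub>R D) / norm h = norm ((f h - f 0) /\<^sub>R h - D)"
    proof (rule eventually_at_filter[THEN iffD2], intro always_eventually allI impI)
      fix h :: real assume "h \<noteq> 0"
      then have "(f h - f 0) /\<^sub>R h - D = (f h - f 0 - h *\<^sub>R D) /\<^sub>R h"
        by (simp add: scaleR_right_diff_distrib)
      then show "norm (f h - f 0 - h *\<^sub>R D) / norm h = norm ((f h - f 0) /\<^sub>R h - D)"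
        by (simp add: divide_inverse mult.commute)
    qed
  qed
  also have "\<dots> \<longleftrightarrow> ((\<lambda>t. (f t - f 0) /\<^sub>R t) \<longlongrightarrow> D) (at 0)"
    by (simp add: tendsto_norm_zero_iff LIM_zero_iff)
  finally show ?thesis .
qed

lemma norm_cis_diff_le: "norm (cis a - cis b) \<le> \<bar>a - b\<bar>"
proof -
  have "cis a - cis b = cis b * (cis (a - b) - 1)"
    by (simp add: cis_mult right_diff_distrib)
  then have "norm (cis a - cis b) = norm (iexp (a - b) - 1)"
    by (simp add: norm_mult cis_conv_exp)
  also have "\<dots> \<le> \<bar>a - b\<bar>" using iexp_approx1[of "a - b" 0] by simp
  finally show ?thesis .
qed

lemma has_vector_derivative_cis_inner:
  "((\<lambda>t. cis (- (x \<bullet> (\<xi> + t *\<^sub>R e)))) has_vector_derivative (- \<i>) * of_real (x \<bullet> e) * cis (- (x \<bullet> \<xi>))) (at 0)"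
proof -
  have "((\<lambda>t. exp (- (\<i> * of_real (x \<bullet> \<xi>)) + of_real t * (- (\<i> * of_real (x \<bullet> e))))) has_vector_derivative
      (- (\<i> * of_real (x \<bullet> e))) * exp (- (\<i> * of_real (x \<bullet> \<xi>)) + of_real 0 * (- (\<i> * of_real (x \<bullet> e))))) (at 0)"
    by (rule has_vector_derivative_real_field) (auto intro!: derivative_eq_intros)
  then show ?thesis by (simp add: cis_conv_exp inner_add_right algebra_simps)
qed

section \<open>Regularity of Fourier transforms\<close>

text \<open>The transform \<open>fourier\<close> taken over \<open>lborel\<close> rather than its
  completion, so that Fubini and affine substitution apply directly. The two agree on Borel
  functions.\<close>

definition FT :: "('a::euclidean_space \<Rightarrow> complex) \<Rightarrow> 'a \<Rightarrow> complex" where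
  "FT f \<xi> = (LINT x|lborel. cis (- (x \<bullet> \<xi>)) * f x)"

lemma borel_measurable_cis_inner[measurable]:
  "(\<lambda>x::'a::euclidean_space. cis (- (x \<bullet> \<xi>))) \<in> borel_measurable borel"
  by (intro borel_measurable_continuous_onI continuous_intros)

lemma FT_integrable:
  assumes "integrable lborel f"
  shows "integrable lborel (\<lambda>x. cis (- (x \<bullet> \<xi>)) * f x)"
  by (rule Bochner_Integration.integrable_bound[OF assms]) (use assms in \<open>auto simp: norm_mult\<close>)

lemma fourier_eq_FT:
  assumes [measurable]: "f \<in> borel_measurable borel"
  shows "fourier f = FT f"
  unfolding fourier_def FT_def fun_eq_iff
  by (intro allI integral_completion) measurable

lemma FT_bound:
  assumes "integrable lborel f"
  shows "norm (FT f \<xi>) \<le> (LINT x|lborel. norm (f x))"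
  unfolding FT_def
  by (rule order_trans[OF integral_norm_bound]) (simp add: norm_mult)

lemma FT_lipschitz:
  assumes f: "integrable lborel f" and m: "integrable lborel (\<lambda>x. norm x * norm (f x))"
  shows "norm (FT f \<xi> - FT f \<eta>) \<le> (LINT x|lborel. norm x * norm (f x)) * norm (\<xi> - \<eta>)"
proof -
  have [measurable]: "f \<in> borel_measurable borel" using f by auto
  have "FT f \<xi> - FT f \<eta> = (LINT x|lborel. (cis (- (x \<bullet> \<xi>)) - cis (- (x \<bullet> \<eta>))) * f x)"
    unfolding FT_def by (subst Bochner_Integration.integral_diff[OF FT_integrable[OF f] FT_integrable[OF f], symmetric])
      (simp add: left_diff_distrib)
  also have "norm \<dots> \<le> (LINT x|lborel. norm ((cis (- (x \<bullet> \<xi>)) - cis (- (x \<bullet> \<eta>))) * f x))"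
    by (rule integral_norm_bound)
  also have "\<dots> \<le> (LINT x|lborel. norm (\<xi> - \<eta>) * (norm x * norm (f x)))"
  proof (rule integral_mono)
    show "integrable lborel (\<lambda>x. norm ((cis (- (x \<bullet> \<xi>)) - cis (- (x \<bullet> \<eta>))) * f x))"
      unfolding left_diff_distrib by (intro integrable_norm Bochner_Integration.integrable_diff FT_integrable f)
    show "integrable lborel (\<lambda>x. norm (\<xi> - \<eta>) * (norm x * norm (f x)))" using m by simp
    fix x
    have "norm (cis (- (x \<bullet> \<xi>)) - cis (- (x \<bullet> \<eta>))) \<le> \<bar>x \<bullet> (\<eta> - \<xi>)\<bar>"
      using norm_cis_diff_le[of "- (x \<bullet> \<xi>)" "- (x \<bullet> \<eta>)"] by (simp add: inner_diff_right)
    also have "\<dots> \<le> norm x * norm (\<xi> - \<eta>)"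
      using Cauchy_Schwarz_ineq2[of x "\<eta> - \<xi>"] by (simp add: norm_minus_commute)
    finally show "norm ((cis (- (x \<bullet> \<xi>)) - cis (- (x \<bullet> \<eta>))) * f x) \<le> norm (\<xi> - \<eta>) * (norm x * norm (f x))"
      using mult_right_mono[of _ _ "norm (f x)"] by (fastforce simp: norm_mult mult_ac)
  qed
  finally show ?thesis by (simp add: mult.commute)
qed

lemma decay_moment:
  fixes f :: "'a::euclidean_space \<Rightarrow> complex"
  assumes "\<And>k. decay (real k) f"
  shows "decay (real k) (\<lambda>x. of_real (x \<bullet> e) * f x)"
proof -
  obtain B where B: "B \<ge> 0" "\<And>x. norm (f x) \<le> B * (1 + norm x) powr (-real (Suc k))"
    using decayE[OF assms[of "Suc k"]] by blast
  show ?thesis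
  proof (rule decayI)
    fix x :: 'a
    have p: "1 + norm x > 0" by (simp add: add_pos_nonneg)
    have "norm (of_real (x \<bullet> e) * f x) \<le> (norm e * (1 + norm x)) * (B * (1 + norm x) powr (-real (Suc k)))"
      unfolding norm_mult
    proof (intro mult_mono B)
      have "\<bar>x \<bullet> e\<bar> \<le> norm x * norm e" by (rule Cauchy_Schwarz_ineq2)
      also have "\<dots> \<le> norm e * (1 + norm x)" by (simp add: algebra_simps)
      finally show "norm (complex_of_real (x \<bullet> e)) \<le> norm e * (1 + norm x)" by simp
    qed (use B in auto)
    also have "\<dots> = norm e * B * ((1 + norm x) powr 1 * (1 + norm x) powr (-real (Suc k)))"
      using p by simp
    also have "(1 + norm x) powr 1 * (1 + norm x) powr (-real (Suc k)) = (1 + norm x) powr (-real k)"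
      by (subst powr_add[symmetric]) simp
    finally show "norm (of_real (x \<bullet> e) * f x) \<le> norm e * B * (1 + norm x) powr (-real k)" .
  qed
qed

text \<open>Differentiation under the integral sign: \<open>cis\<close> is 1-Lipschitz, so the
  difference quotients of the integrand are dominated by
  \<open>norm (of_real (x \<bullet> e) * f x)\<close>.\<close>

lemma FT_has_dir_derivative:
  fixes f :: "'a::euclidean_space \<Rightarrow> complex"
  assumes f: "integrable lborel f" and m: "integrable lborel (\<lambda>x. of_real (x \<bullet> e) * f x)"
  shows "((\<lambda>t. FT f (\<xi> + t *\<^sub>R e)) has_vector_derivative (- \<i>) * FT (\<lambda>x. of_real (x \<bullet> e) * f x) \<xi>) (at 0)"
proof -
  have [measurable]: "f \<in> borel_measurable borel" using f by auto
  let ?D = "(- \<i>) * FT (\<lambda>x. of_real (x \<bullet> e) * f x) \<xi>"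
  let ?q = "\<lambda>t x. (cis (- (x \<bullet> (\<xi> + t *\<^sub>R e))) - cis (- (x \<bullet> \<xi>))) /\<^sub>R t"
  note cisd = has_vector_derivative_cis_inner[of _ \<xi> e]
  have "((\<lambda>t. (FT f (\<xi> + t *\<^sub>R e) - FT f \<xi>) /\<^sub>R t) \<longlongrightarrow> ?D) (at 0)"
  proof (subst tendsto_at_iff_sequentially, intro allI impI)
    fix X :: "nat \<Rightarrow> real" assume X: "\<forall>i. X i \<in> UNIV - {0}" and X0: "X \<longlonglongrightarrow> 0"
    have eq: "(FT f (\<xi> + t *\<^sub>R e) - FT f \<xi>) /\<^sub>R t = (LINT x|lborel. ?q t x * f x)" for t
      unfolding FT_def
      by (subst Bochner_Integration.integral_diff[OF FT_integrable[OF f] FT_integrable[OF f], symmetric],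
          subst integral_scaleR_right[symmetric]) (simp add: left_diff_distrib scaleR_right_diff_distrib)
    have "(\<lambda>i. LINT x|lborel. ?q (X i) x * f x) \<longlonglongrightarrow> (LINT x|lborel. (- \<i>) * (cis (- (x \<bullet> \<xi>)) * (of_real (x \<bullet> e) * f x)))"
    proof (rule integral_dominated_convergence)
      show "integrable lborel (\<lambda>x. norm (of_real (x \<bullet> e) * f x))" using m by (rule integrable_norm)
      show "AE x in lborel. (\<lambda>i. ?q (X i) x * f x) \<longlonglongrightarrow> (- \<i>) * (cis (- (x \<bullet> \<xi>)) * (of_real (x \<bullet> e) * f x))"
      proof (rule AE_I2)
        fix x
        have "((\<lambda>t. ?q t x) \<longlongrightarrow> (- \<i>) * of_real (x \<bullet> e) * cis (- (x \<bullet> \<xi>))) (at 0)"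
          using cisd[of x] by (simp add: has_vector_derivative_iff_quotient)
        then have "(\<lambda>i. ?q (X i) x) \<longlonglongrightarrow> (- \<i>) * of_real (x \<bullet> e) * cis (- (x \<bullet> \<xi>))"
          using X X0 by (auto simp: tendsto_at_iff_sequentially o_def)
        from tendsto_mult[OF this tendsto_const[of "f x"]]
        show "(\<lambda>i. ?q (X i) x * f x) \<longlonglongrightarrow> (- \<i>) * (cis (- (x \<bullet> \<xi>)) * (of_real (x \<bullet> e) * f x))"
          by (simp add: mult_ac)
      qed
      fix i
      show "AE x in lborel. norm (?q (X i) x * f x) \<le> norm (of_real (x \<bullet> e) * f x)"
      proof (rule AE_I2)
        fix x
        have "norm (cis (- (x \<bullet> (\<xi> + X i *\<^sub>R e))) - cis (- (x \<bullet> \<xi>))) \<le> \<bar>X i * (x \<bullet> e)\<bar>"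
          using norm_cis_diff_le[of "- (x \<bullet> (\<xi> + X i *\<^sub>R e))" "- (x \<bullet> \<xi>)"] by (simp add: inner_add_right)
        then have "norm (?q (X i) x) \<le> \<bar>x \<bullet> e\<bar>"
          using X[rule_format, of i] by (simp add: divide_simps abs_mult mult_ac)
        then show "norm (?q (X i) x * f x) \<le> norm (of_real (x \<bullet> e) * f x)"
          unfolding norm_mult by (intro mult_right_mono) auto
      qed
    qed measurable
    also have "(LINT x|lborel. (- \<i>) * (cis (- (x \<bullet> \<xi>)) * (of_real (x \<bullet> e) * f x))) = ?D"
      unfolding FT_def by (rule integral_mult_right_zero)
    finally show "((\<lambda>t. (FT f (\<xi> + t *\<^sub>R e) - FT f \<xi>) /\<^sub>R t) \<circ> X) \<longlonglongrightarrow> ?D"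
      unfolding o_def eq .
  qed
  then show ?thesis
    by (simp add: has_vector_derivative_iff_quotient)
qed

lemma FT_continuous:
  fixes f :: "'a::euclidean_space \<Rightarrow> complex"
  assumes "\<And>k. decay (real k) f" and [measurable]: "f \<in> borel_measurable borel"
  shows "continuous_on UNIV (FT f)"
proof -
  have i: "integrable lborel f"
    by (rule decay_integrable[OF assms(1)[of "DIM('a) + 1"]]) auto
  have "integrable lborel (\<lambda>x. (1 + norm x) ^ 1 * norm (f x))"
    by (rule decay_moment_integrable[of "real (DIM('a) + 1)"]) (use assms(1)[of "DIM('a) + 2"] in \<open>auto simp: add_ac\<close>)
  then have m: "integrable lborel (\<lambda>x. norm x * norm (f x))"
    by (rule Bochner_Integration.integrable_bound) (auto simp: abs_mult intro!: mult_right_mono)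
  let ?L = "LINT x|lborel. norm x * norm (f x)"
  show ?thesis
    by (rule continuous_on_norm_lipschitz[OF _ FT_lipschitz[OF i m]]) simp
qed

lemma dir_smooth_FT:
  fixes f :: "'a::euclidean_space \<Rightarrow> complex"
  assumes "\<And>k. decay (real k) f" and "f \<in> borel_measurable borel"
  shows "dir_smooth e n (FT f)"
  using assms
proof (induction n arbitrary: f)
  case 0
  then show ?case by (simp add: FT_continuous)
next
  case (Suc n)
  note [measurable] = Suc.prems(2)
  let ?f = "\<lambda>x. of_real (x \<bullet> e) * f x"
  have d: "\<And>k. decay (real k) ?f" by (rule decay_moment[OF Suc.prems(1)])
  have m: "?f \<in> borel_measurable borel" by measurable
  have i: "integrable lborel f" "integrable lborel ?f"
    using decay_integrable[OF Suc.prems(1)[of "DIM('a) + 1"] _ Suc.prems(2)]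
      decay_integrable[OF d[of "DIM('a) + 1"] _ m] by simp_all
  from FT_has_dir_derivative[OF i] Suc.IH[OF d m] Suc.IH[OF Suc.prems]
  show ?case by (auto intro!: exI[of _ "\<lambda>\<xi>. (- \<i>) * FT ?f \<xi>"] dir_smooth_mult[OF dir_smooth_const, of _ _ _ "- \<i>", simplified])
qed

section \<open>Decay of Fourier transforms of compactly supported functions\<close>

lemma integrable_continuous_bounded_support:
  fixes F :: "'a::euclidean_space \<Rightarrow> complex"
  assumes "continuous_on UNIV F" "\<And>x. norm x > R \<Longrightarrow> F x = 0"
  shows "integrable lborel F"
proof -
  have "integrable lborel (\<lambda>x. indicator (cball 0 R) x *\<^sub>R F x)"
    by (intro borel_integrable_compact continuous_on_subset[OF assms(1)]) auto
  also have "(\<lambda>x. indicator (cball 0 R) x *\<^sub>R F x) = F"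
    using assms(2) by (auto simp: fun_eq_iff indicator_def)
  finally show ?thesis .
qed

lemma continuous_bounded_support_bounded:
  fixes F :: "'a::euclidean_space \<Rightarrow> complex"
  assumes "continuous_on UNIV F" "\<And>x. norm x > R \<Longrightarrow> F x = 0"
  obtains B where "B \<ge> 0" "\<And>x. norm (F x) \<le> B"
proof -
  have "compact (F ` cball 0 R)"
    by (intro compact_continuous_image continuous_on_subset[OF assms(1)]) auto
  then obtain B where B: "B > 0" "\<And>x. x \<in> cball 0 R \<Longrightarrow> norm (F x) \<le> B"
    using compact_imp_bounded bounded_pos by (metis imageI)
  show ?thesis
  proof (rule that[of B])
    fix x show "norm (F x) \<le> B"
      using B assms(2)[of x] by (cases "norm x > R") auto
  qed (use B in auto)
qed

text \<open>A form of integration by parts that needs no slicing of space: by translation invariance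
  every difference quotient of \<open>F\<close> along \<open>e\<close> has integral 0, and the
  quotients converge to \<open>D\<close> under a common bound of bounded support.\<close>

lemma integral_dir_derivative_zero:
  fixes F :: "'a::euclidean_space \<Rightarrow> complex"
  assumes F: "continuous_on UNIV F" "\<And>x. norm x > R \<Longrightarrow> F x = 0"
    and D: "continuous_on UNIV D" "\<And>x. norm x > R \<Longrightarrow> D x = 0"
    and der: "\<And>x. ((\<lambda>t. F (x + t *\<^sub>R e)) has_vector_derivative D x) (at 0)"
  shows "(LINT x|lborel. D x) = 0"
proof -
  obtain B where B: "B \<ge> 0" "\<And>x. norm (D x) \<le> B"
    using continuous_bounded_support_bounded[OF D] by blast
  have iF: "integrable lborel F" by (rule integrable_continuous_bounded_support[OF F])
  have [measurable]: "F \<in> borel_measurable borel" "D \<in> borel_measurable borel"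
    using F D by (auto intro: borel_measurable_continuous_onI)
  have dert: "((\<lambda>t. F (x + t *\<^sub>R e)) has_vector_derivative D (x + t *\<^sub>R e)) (at t)" for x t
  proof -
    have "((\<lambda>s. s - t) has_vector_derivative 1) (at t)" by (auto intro!: derivative_eq_intros)
    moreover have "((\<lambda>s. F ((x + t *\<^sub>R e) + s *\<^sub>R e)) has_vector_derivative D (x + t *\<^sub>R e)) (at (t - t))"
      using der[of "x + t *\<^sub>R e"] by simp
    ultimately show ?thesis
      by (auto dest: vector_diff_chain_at simp: o_def algebra_simps)
  qed
  have lip: "norm (F (x + h *\<^sub>R e) - F x) \<le> B * \<bar>h\<bar>" for x h
  proof -
    have "norm (F (x + h *\<^sub>R e) - F (x + 0 *\<^sub>R e)) \<le> B * norm (h - 0)"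
    proof (rule differentiable_bound[of UNIV _ "\<lambda>t s. s *\<^sub>R D (x + t *\<^sub>R e)"])
      show "((\<lambda>t. F (x + t *\<^sub>R e)) has_derivative (\<lambda>s. s *\<^sub>R D (x + t *\<^sub>R e))) (at t within UNIV)" for t
        using dert[of x t] by (simp add: has_vector_derivative_def)
      show "onorm (\<lambda>s. s *\<^sub>R D (x + t *\<^sub>R e)) \<le> B" for t
      proof (rule onorm_le)
        fix s :: real
        show "norm (s *\<^sub>R D (x + t *\<^sub>R e)) \<le> B * norm s"
          using mult_left_mono[OF B(2)[of "x + t *\<^sub>R e"], of "\<bar>s\<bar>"] by (simp add: mult.commute)
      qed
    qed auto
    then show ?thesis by simp
  qed
  define h where "h n = 1 / real (Suc n)" for n
  have h: "h n > 0" "h n \<le> 1" "h \<longlonglongrightarrow> 0" for n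
    unfolding h_def using LIMSEQ_inverse_real_of_nat by (auto simp: inverse_eq_divide)
  have sh: "integrable lborel (\<lambda>x. F (x + c *\<^sub>R e))" for c
    using lborel_integrable_affine[OF iF, of 1 "c *\<^sub>R e"] by (simp add: add.commute)
  have lim: "(\<lambda>n. LINT x|lborel. (F (x + h n *\<^sub>R e) - F x) /\<^sub>R h n) \<longlonglongrightarrow> (LINT x|lborel. D x)"
  proof (rule integral_dominated_convergence)
    \<comment> \<open>All steps satisfy \<open>h n \<le> 1\<close>, so the translated functions are
      supported within \<open>norm e\<close> of the ball of radius \<open>R\<close>.\<close>
    let ?R = "R + norm e"
    show "integrable lborel (\<lambda>x. indicator (cball 0 ?R) x *\<^sub>R B)"
      by (intro borel_integrable_compact) auto
    show "AE x in lborel. (\<lambda>n. (F (x + h n *\<^sub>R e) - F x) /\<^sub>R h n) \<longlonglongrightarrow> D x"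
    proof (rule AE_I2)
      fix x
      have "((\<lambda>t. (F (x + t *\<^sub>R e) - F x) /\<^sub>R t) \<longlongrightarrow> D x) (at 0)"
        using der[of x] by (simp add: has_vector_derivative_iff_quotient)
      moreover have "\<forall>n. h n \<in> UNIV - {0}" using h(1) by (metis DiffI UNIV_I less_irrefl singletonD)
      ultimately show "(\<lambda>n. (F (x + h n *\<^sub>R e) - F x) /\<^sub>R h n) \<longlonglongrightarrow> D x"
        using h(3) by (simp add: tendsto_at_iff_sequentially o_def)
    qed
    fix n
    show "AE x in lborel. norm ((F (x + h n *\<^sub>R e) - F x) /\<^sub>R h n) \<le> indicator (cball 0 ?R) x *\<^sub>R B"
    proof (rule AE_I2)
      fix x
      show "norm ((F (x + h n *\<^sub>R e) - F x) /\<^sub>R h n) \<le> indicator (cball 0 ?R) x *\<^sub>R B"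
      proof (cases "norm x \<le> ?R")
        case True
        then show ?thesis using lip[of x "h n"] h(1)[of n] by (simp add: divide_simps mult.commute)
      next
        case False
        have "norm x - norm (h n *\<^sub>R e) \<le> norm (x + h n *\<^sub>R e)"
          using norm_diff_ineq[of x "h n *\<^sub>R e"] by simp
        moreover have "norm (h n *\<^sub>R e) \<le> norm e"
          using h(1,2)[of n] mult_right_mono[of "h n" 1 "norm e"] by simp
        ultimately have "norm (x + h n *\<^sub>R e) > R" using False by argo
        moreover have "norm x > R" using False norm_ge_zero[of e] by argo
        ultimately show ?thesis using F(2) False by simp
      qed
    qed
  qed measurable
  have zero: "(LINT x|lborel. (F (x + h n *\<^sub>R e) - F x) /\<^sub>R h n) = 0" for n
  proof -
    have "(LINT x|lborel. F (x + h n *\<^sub>R e)) = (LINT x|lborel. F x)"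
      using lborel_integral_affine[of F 1 "h n *\<^sub>R e"] by (simp add: add.commute)
    then have "(LINT x|lborel. F (x + h n *\<^sub>R e) - F x) = 0"
      by (subst Bochner_Integration.integral_diff[OF sh iF]) simp
    then show ?thesis by (simp only: integral_scaleR_right) simp
  qed
  show ?thesis using lim unfolding zero by (simp add: LIMSEQ_const_iff)
qed

lemma dir_derivative_bounded_support:
  fixes F :: "'a::euclidean_space \<Rightarrow> complex"
  assumes F: "\<And>x. norm x > R \<Longrightarrow> F x = 0"
    and der: "((\<lambda>t. F (x + t *\<^sub>R e)) has_vector_derivative D) (at 0)" and x: "norm x > R"
  shows "D = 0"
proof -
  have "open {t. norm (x + t *\<^sub>R e) > R}"
    by (intro open_Collect_less continuous_intros)
  from has_vector_derivative_transform_within_open[OF der this, of "\<lambda>_. 0"]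
  have "((\<lambda>_::real. 0) has_vector_derivative D) (at 0)" using x F by auto
  then show ?thesis using vector_derivative_unique_at[of "\<lambda>_. 0" D 0 0] by simp
qed

text \<open>Applying \<open>integral_dir_derivative_zero\<close> to
  \<open>cis (- (\<xi> \<bullet> x)) * m \<xi>\<close> gives i (x \<bullet> e) FT m = FT m'. Each
  derivative in direction \<open>e\<close> thus buys one power of
  \<open>x \<bullet> e\<close>.\<close>

lemma FT_dir_decay:
  fixes m :: "'a::euclidean_space \<Rightarrow> complex"
  assumes "dir_smooth e n m" "\<And>x. norm x > R \<Longrightarrow> m x = 0"
  shows "\<exists>C. \<forall>x. \<bar>x \<bullet> e\<bar> ^ n * norm (FT m x) \<le> C"
  using assms
proof (induction n arbitrary: m)
  case 0
  then have "integrable lborel m" by (intro integrable_continuous_bounded_support[of m R]) auto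
  from FT_bound[OF this] show ?case by auto
next
  case (Suc n)
  then obtain m' where m': "dir_smooth e n m'" 
      "\<And>x. ((\<lambda>t. m (x + t *\<^sub>R e)) has_vector_derivative m' x) (at 0)" by auto
  have s': "m' x = 0" if "norm x > R" for x
    using dir_derivative_bounded_support[of R m x e, OF Suc.prems(2) m'(2) that] by blast
  obtain C where C: "\<And>x. \<bar>x \<bullet> e\<bar> ^ n * norm (FT m' x) \<le> C"
    using Suc.IH[OF m'(1) s'] by blast
  have cm: "continuous_on UNIV m" "continuous_on UNIV m'"
    using Suc.prems(1) m'(1) dir_smooth_continuous by auto
  have im: "integrable lborel m" "integrable lborel m'"
    using integrable_continuous_bounded_support[OF cm(1) Suc.prems(2)] integrable_continuous_bounded_support[OF cm(2) s'] by auto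
  have id: "\<i> * of_real (x \<bullet> e) * FT m x = FT m' x" for x
  proof -
    let ?F = "\<lambda>\<xi>. cis (- (\<xi> \<bullet> x)) * m \<xi>"
    let ?D = "\<lambda>\<xi>. cis (- (\<xi> \<bullet> x)) * m' \<xi> + (- \<i>) * of_real (x \<bullet> e) * (cis (- (\<xi> \<bullet> x)) * m \<xi>)"
    have "(LINT \<xi>|lborel. ?D \<xi>) = 0"
    proof (rule integral_dir_derivative_zero[of ?F R _ e])
      fix \<xi>
      have c: "((\<lambda>t. cis (- ((\<xi> + t *\<^sub>R e) \<bullet> x))) has_vector_derivative (- \<i>) * of_real (x \<bullet> e) * cis (- (\<xi> \<bullet> x))) (at 0)"
        using has_vector_derivative_cis_inner[of x \<xi> e] by (simp add: inner_commute)
      show "((\<lambda>t. ?F (\<xi> + t *\<^sub>R e)) has_vector_derivative ?D \<xi>) (at 0)"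
        using has_vector_derivative_mult[OF c m'(2)[of \<xi>]] by (simp add: mult_ac)
    qed (use Suc.prems(2) s' cm in \<open>auto intro!: continuous_intros\<close>)
    also have "(LINT \<xi>|lborel. ?D \<xi>) = FT m' x + (- \<i>) * of_real (x \<bullet> e) * FT m x"
      unfolding FT_def
      by (subst Bochner_Integration.integral_add) (auto intro!: FT_integrable im integrable_mult_right)
    finally show ?thesis by (simp add: algebra_simps)
  qed
  show ?case
  proof (intro exI allI)
    fix x
    have "norm (FT m' x) = \<bar>x \<bullet> e\<bar> * norm (FT m x)"
      by (subst id[symmetric]) (simp add: norm_mult)
    then show "\<bar>x \<bullet> e\<bar> ^ Suc n * norm (FT m x) \<le> C"
      using C[of x] by (simp add: mult_ac)
  qed
qed

text \<open>Some coordinate of x has absolute value at least \<open>norm x\<close> divided by the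
  dimension. Pure derivatives in that one direction already give the full decay; near the origin the
  L^1 bound is enough.\<close>

lemma FT_decay:
  fixes m :: "'a::euclidean_space \<Rightarrow> complex"
  assumes m: "\<And>e. e \<in> Basis \<Longrightarrow> dir_smooth e n m" "\<And>x. norm x > R \<Longrightarrow> m x = 0"
  shows "decay (real n) (FT m)"
proof -
  obtain e0 :: 'a where e0: "e0 \<in> Basis" using nonempty_Basis by blast
  have im: "integrable lborel m"
    by (rule integrable_continuous_bounded_support[OF dir_smooth_continuous[OF m(1)[OF e0]] m(2)])
  have "\<forall>e\<in>Basis. \<exists>C. \<forall>x. \<bar>x \<bullet> e\<bar> ^ n * norm (FT m x) \<le> C"
    using FT_dir_decay[OF m(1,2)] by blast
  then obtain C where C: "\<And>e x. e \<in> Basis \<Longrightarrow> \<bar>x \<bullet> e\<bar> ^ n * norm (FT m x) \<le> C e" by metis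
  define A where "A = (LINT x|lborel. norm (m x))"
  define S where "S = (\<Sum>e\<in>Basis. \<bar>C e\<bar>)"
  let ?d = "real DIM('a)"
  have S0: "S \<ge> 0" by (simp add: S_def sum_nonneg)
  have A0: "A \<ge> 0" by (simp add: A_def)
  have main: "(1 + norm x) ^ n * norm (FT m x) \<le> 2 ^ n * A + (2 * ?d) ^ n * S" for x
  proof (cases "norm x \<le> 1")
    case True
    have "(1 + norm x) ^ n * norm (FT m x) \<le> 2 ^ n * A"
      using True by (intro mult_mono power_mono) (auto simp: A_def FT_bound[OF im])
    then show ?thesis using S0 by (smt (verit) mult_nonneg_nonneg of_nat_0_le_iff zero_le_power)
  next
    case False
    have "\<exists>e\<in>Basis. norm x \<le> ?d * \<bar>x \<bullet> e\<bar>"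
    proof (rule ccontr)
      assume neg: "\<not> ?thesis"
      have "\<bar>x \<bullet> e\<bar> < norm x / ?d" if "e \<in> Basis" for e
        using neg that by (force simp: field_simps)
      then have "(\<Sum>e\<in>(Basis::'a set). \<bar>x \<bullet> e\<bar>) < (\<Sum>e\<in>(Basis::'a set). norm x / ?d)" by (intro sum_strict_mono) auto
      then show False using norm_le_l1[of x] by simp
    qed
    then obtain e where e: "e \<in> Basis" "norm x \<le> ?d * \<bar>x \<bullet> e\<bar>" by blast
    have "(1 + norm x) ^ n * norm (FT m x) \<le> (2 * (?d * \<bar>x \<bullet> e\<bar>)) ^ n * norm (FT m x)"
      using False e by (intro mult_right_mono power_mono) auto
    also have "\<dots> = (2 * ?d) ^ n * (\<bar>x \<bullet> e\<bar> ^ n * norm (FT m x))" by (simp add: power_mult_distrib)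
    also have "\<dots> \<le> (2 * ?d) ^ n * S"
    proof (rule mult_left_mono)
      have "\<bar>C e\<bar> \<le> S" unfolding S_def using e by (intro member_le_sum) auto
      then show "\<bar>x \<bullet> e\<bar> ^ n * norm (FT m x) \<le> S" using C[OF e(1), of x] by linarith
    qed simp
    finally show ?thesis using A0 by (smt (verit) mult_nonneg_nonneg zero_le_power)
  qed
  show ?thesis
  proof (rule decayI)
    fix x :: 'a
    have "1 + norm x > 0" by (simp add: add_pos_nonneg)
    then show "norm (FT m x) \<le> (2 ^ n * A + (2 * ?d) ^ n * S) * (1 + norm x) powr (- real n)"
      using main[of x] by (simp add: powr_minus powr_realpow field_simps)
  qed
qed

section \<open>Fourier inversion at the origin and convolution\<close>

lemma FT_duality:
  fixes f g :: "'a::euclidean_space \<Rightarrow> complex"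
  assumes f: "integrable lborel f" and g: "integrable lborel g"
  shows "(LINT x|lborel. FT f x * g x) = (LINT x|lborel. f x * FT g x)"
proof -
  have [measurable]: "f \<in> borel_measurable borel" "g \<in> borel_measurable borel" using f g by auto
  let ?F = "\<lambda>(x, y). cis (- (y \<bullet> x)) * f y * g x"
  have [measurable]: "(\<lambda>(x, y). cis (- (y \<bullet> x))) \<in> borel_measurable (borel \<Otimes>\<^sub>M (borel :: 'a measure))"
    unfolding borel_prod case_prod_unfold by (intro borel_measurable_continuous_onI continuous_intros)
  have int: "integrable (lborel \<Otimes>\<^sub>M lborel) ?F"
  proof (rule lborel_pair.Fubini_integrable)
    show "?F \<in> borel_measurable (lborel \<Otimes>\<^sub>M lborel)" by measurable
    show "AE x in lborel. integrable lborel (\<lambda>y. ?F (x, y))"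
      using FT_integrable[OF f] by (auto intro!: AE_I2 integrable_mult_left)
    have "(LINT y|lborel. norm (?F (x, y))) = norm (g x) * (LINT y|lborel. norm (f y))" for x
      by (simp add: norm_mult mult.commute)
    then show "integrable lborel (\<lambda>x. LINT y|lborel. norm (?F (x, y)))"
      using g by simp
  qed
  have "(LINT x|lborel. FT f x * g x) = (LINT x|lborel. (LINT y|lborel. ?F (x, y)))"
    unfolding FT_def by simp
  also have "\<dots> = (LINT y|lborel. (LINT x|lborel. ?F (x, y)))"
    using lborel_pair.Fubini_integral[OF int] by simp
  also have "\<dots> = (LINT y|lborel. f y * FT g y)"
    unfolding FT_def
    by (intro Bochner_Integration.integral_cong refl)
       (simp add: inner_commute mult_ac flip: integral_mult_right_zero)
  finally show ?thesis .
qed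

lemma lborel_integral_prod:
  fixes f :: "'a::euclidean_space \<Rightarrow> real \<Rightarrow> complex"
  assumes f: "\<And>b. b \<in> Basis \<Longrightarrow> integrable lborel (f b)"
  shows "(LINT x|lborel. (\<Prod>b\<in>Basis. f b (x \<bullet> b))) = (\<Prod>b\<in>Basis. LINT t|lborel. f b t)"
    and "integrable lborel (\<lambda>x. \<Prod>b\<in>Basis. f b (x \<bullet> b))"
proof -
  interpret product_sigma_finite "\<lambda>_::'a. lborel :: real measure" ..
  have [measurable]: "f b \<in> borel_measurable borel" if "b \<in> Basis" for b
    using f[OF that] by auto
  have m: "(\<lambda>x. \<Prod>b\<in>Basis. f b (x \<bullet> b)) \<in> borel_measurable borel" by measurable
  have t: "(\<lambda>g. \<Sum>b\<in>Basis. g b *\<^sub>R b) \<in> measurable (\<Pi>\<^sub>M b\<in>(Basis::'a set). lborel) borel"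
    by measurable
  have eq: "(\<Prod>b\<in>Basis. f b ((\<Sum>b\<in>Basis. g b *\<^sub>R b) \<bullet> b)) = (\<Prod>b\<in>Basis. f b (g b))" for g
    by (intro prod.cong refl) simp
  show "(LINT x|lborel. (\<Prod>b\<in>Basis. f b (x \<bullet> b))) = (\<Prod>b\<in>Basis. LINT t|lborel. f b t)"
    by (subst lborel_eq, subst integral_distr[OF t m]) (simp only: eq product_integral_prod[OF finite_Basis f])
  show "integrable lborel (\<lambda>x. \<Prod>b\<in>Basis. f b (x \<bullet> b))"
    by (subst lborel_eq, subst integrable_distr_eq[OF t m]) (simp only: eq product_integrable_prod[OF finite_Basis f])
qed

definition gauss :: "'a::euclidean_space \<Rightarrow> complex" where
  "gauss x = (\<Prod>b\<in>Basis. of_real (exp (- ((x \<bullet> b)\<^sup>2) / 2)))"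

text \<open>This is the characteristic function of the standard normal distribution with its
  normalising factor removed.\<close>

lemma integrable_cis_gauss_1d:
  "integrable lborel (\<lambda>t. cis (a * t) * of_real (exp (- (t\<^sup>2) / 2)))" (is "integrable _ ?f")
  and integral_cis_gauss_1d:
  "(LINT t|lborel. cis (a * t) * of_real (exp (- (t\<^sup>2) / 2))) = of_real (sqrt (2 * pi) * exp (- (a\<^sup>2) / 2))"
proof -
  have eq: "std_normal_density t *\<^sub>R iexp (a * t) = of_real (1 / sqrt (2 * pi)) * ?f t" for t
    by (simp add: std_normal_density_def scaleR_conv_of_real cis_conv_exp mult_ac)
  have eq': "?f t = of_real (sqrt (2 * pi)) * (std_normal_density t *\<^sub>R iexp (a * t))" for t
    unfolding eq by simp
  have [measurable]: "(\<lambda>t. iexp (a * t)) \<in> borel_measurable borel"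
    by (intro borel_measurable_continuous_onI continuous_intros)
  have i0: "integrable lborel std_normal_density" by simp
  have "integrable lborel (\<lambda>t. std_normal_density t *\<^sub>R iexp (a * t))"
    by (rule Bochner_Integration.integrable_bound[OF i0]) auto
  then show "integrable lborel ?f" unfolding eq' by (rule integrable_mult_right)
  have "(LINT t|lborel. std_normal_density t *\<^sub>R iexp (a * t)) = of_real (exp (- (a\<^sup>2) / 2))"
    using fun_cong[OF char_std_normal_distribution, of a]
    by (simp add: char_def integral_density normal_density_nonneg)
  then show "(LINT t|lborel. ?f t) = of_real (sqrt (2 * pi) * exp (- (a\<^sup>2) / 2))"
    unfolding eq' by (subst integral_mult_right_zero) simp
qed

lemma gauss_integrable: "integrable lborel gauss"
  using lborel_integral_prod(2)[of "\<lambda>_ t. of_real (exp (- (t\<^sup>2) / 2))"] integrable_cis_gauss_1d[of 0]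
  by (simp add: gauss_def[abs_def])

lemma cis_sum: "finite A \<Longrightarrow> cis (\<Sum>a\<in>A. f a) = (\<Prod>a\<in>A. cis (f a))"
  by (induction A rule: finite_induct) (auto simp flip: cis_mult)

lemma FT_gauss: "FT gauss (\<xi>::'a::euclidean_space) = of_real (sqrt (2 * pi) ^ DIM('a)) * gauss \<xi>"
proof -
  have "cis (- (x \<bullet> \<xi>)) * gauss x = (\<Prod>b\<in>Basis. cis (- (\<xi> \<bullet> b) * (x \<bullet> b)) * of_real (exp (- ((x \<bullet> b)\<^sup>2) / 2)))" for x
    unfolding gauss_def prod.distrib
    by (subst cis_sum[symmetric]) (simp_all add: euclidean_inner[of x \<xi>] sum_negf mult.commute)
  then have "FT gauss \<xi> = (\<Prod>b\<in>(Basis::'a set). of_real (sqrt (2 * pi) * exp (- ((- (\<xi> \<bullet> b))\<^sup>2) / 2)))"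
    unfolding FT_def
    by (simp only:) (subst lborel_integral_prod(1), simp_all only: integrable_cis_gauss_1d integral_cis_gauss_1d)
  then show ?thesis by (simp add: gauss_def prod.distrib)
qed

lemma gauss_continuous: "continuous_on UNIV gauss"
  unfolding gauss_def[abs_def] by (intro continuous_intros) auto

lemma gauss_measurable[measurable]: "gauss \<in> borel_measurable borel"
  by (intro borel_measurable_continuous_onI gauss_continuous)

lemma norm_gauss_le: "norm (gauss x) \<le> 1"
  unfolding gauss_def prod_norm[symmetric] by (intro prod_le_1) auto

lemma gauss_0: "gauss 0 = 1" by (simp add: gauss_def)

text \<open>Inversion at the point 0, used to see that the kernel \<open>\<theta>\<close> has
  nonzero integral. The integrand is damped by \<open>gauss (h n *\<^sub>R x)\<close>; duality and a
  rescaling turn the damped integral into that of \<open>f (h n *\<^sub>R x) * FT gauss x\<close>.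
  Both sides converge, and the right one tends to f 0 times the integral of \<open>FT gauss\<close>,
  which is (2 \<pi>)^n.\<close>

lemma integral_FT:
  fixes f :: "'a::euclidean_space \<Rightarrow> complex"
  assumes f: "continuous_on UNIV f" "\<And>x. norm x > R \<Longrightarrow> f x = 0" and i: "integrable lborel (FT f)"
  shows "(LINT x|lborel. FT f x) = of_real ((2 * pi) ^ DIM('a)) * f 0"
proof -
  have fi: "integrable lborel f" by (rule integrable_continuous_bounded_support[OF f])
  have [measurable]: "f \<in> borel_measurable borel" "FT f \<in> borel_measurable borel" using fi i by auto
  obtain B where B: "B \<ge> 0" "\<And>x. norm (f x) \<le> B"
    using continuous_bounded_support_bounded[OF f] by blast
  define h where "h n = 1 / real (Suc n)" for n
  have h: "h n > 0" "h \<longlonglongrightarrow> 0" for n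
    unfolding h_def using LIMSEQ_inverse_real_of_nat by (auto simp: inverse_eq_divide)
  have hx: "(\<lambda>n. F (h n *\<^sub>R x)) \<longlonglongrightarrow> F 0" if "continuous_on UNIV F" for F :: "'a \<Rightarrow> complex" and x
  proof -
    have "(\<lambda>n. h n *\<^sub>R x) \<longlonglongrightarrow> 0 *\<^sub>R x" by (intro tendsto_intros h)
    then show ?thesis
      using that by (intro isCont_tendsto_compose[of 0 F]) (auto simp: continuous_on_eq_continuous_at)
  qed
  have gi: "integrable lborel (\<lambda>x::'a. gauss (h n *\<^sub>R x))" for n
    using lborel_integrable_affine[OF gauss_integrable, of "h n" 0] h(1)[of n] by simp
  have "(\<lambda>n. LINT x|lborel. FT f x * gauss (h n *\<^sub>R x)) \<longlonglongrightarrow> (LINT x|lborel. FT f x * gauss (0::'a))"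
  proof (rule integral_dominated_convergence)
    show "integrable lborel (\<lambda>x. norm (FT f x))" using i by simp
    show "AE x in lborel. (\<lambda>n. FT f x * gauss (h n *\<^sub>R x)) \<longlonglongrightarrow> FT f x * gauss (0::'a)"
      by (intro AE_I2 tendsto_mult tendsto_const hx[OF gauss_continuous])
    show "\<And>n. AE x in lborel. norm (FT f x * gauss (h n *\<^sub>R x)) \<le> norm (FT f x)"
      by (intro AE_I2) (simp add: norm_mult norm_gauss_le mult_left_le)
  qed measurable
  then have 1: "(\<lambda>n. LINT x|lborel. FT f x * gauss (h n *\<^sub>R x)) \<longlonglongrightarrow> (LINT x|lborel. FT f x)"
    by (simp add: gauss_0)
  have eq: "(LINT x|lborel. FT f x * gauss (h n *\<^sub>R x)) = (LINT x|lborel. f (h n *\<^sub>R x) * FT gauss x)" for n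
  proof -
    have 0: "h n \<noteq> 0" using h(1)[of n] by simp
    have sc: "h n ^ DIM('a) *\<^sub>R FT (\<lambda>x. gauss (h n *\<^sub>R x)) (h n *\<^sub>R x) = FT gauss x" for x :: 'a
    proof -
      have "FT gauss x = \<bar>h n\<bar> ^ DIM('a) *\<^sub>R (LINT y|lborel. cis (- ((0 + h n *\<^sub>R y) \<bullet> x)) * gauss (0 + h n *\<^sub>R y))"
        unfolding FT_def by (intro lborel_integral_affine 0) measurable
      then show ?thesis using h(1)[of n] by (simp add: FT_def)
    qed
    have [measurable]: "FT (\<lambda>x::'a. gauss (h n *\<^sub>R x)) \<in> borel_measurable borel"
    proof -
      have "FT (\<lambda>x::'a. gauss (h n *\<^sub>R x)) = (\<lambda>x. (1 / h n ^ DIM('a)) *\<^sub>R FT gauss ((1 / h n) *\<^sub>R x))"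
        using 0 by (simp add: fun_eq_iff sc[symmetric])
      then show ?thesis unfolding FT_gauss[abs_def] by simp
    qed
    have "(LINT x|lborel. FT f x * gauss (h n *\<^sub>R x)) = (LINT x|lborel. f x * FT (\<lambda>x. gauss (h n *\<^sub>R x)) x)"
      by (rule FT_duality[OF fi gi])
    also have "\<dots> = \<bar>h n\<bar> ^ DIM('a) *\<^sub>R (LINT x|lborel. f (0 + h n *\<^sub>R x) * FT (\<lambda>x. gauss (h n *\<^sub>R x)) (0 + h n *\<^sub>R x))"
      by (intro lborel_integral_affine 0) measurable
    also have "\<dots> = (LINT x|lborel. f (h n *\<^sub>R x) * FT gauss x)"
      unfolding sc[symmetric] using h(1)[of n]
      by (subst integral_scaleR_right[symmetric]) (simp add: scaleR_conv_of_real mult_ac)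
    finally show ?thesis .
  qed
  have Fg: "integrable lborel (FT gauss :: 'a \<Rightarrow> complex)"
    unfolding FT_gauss[abs_def] by (intro integrable_mult_right gauss_integrable)
  then have [measurable]: "(FT gauss :: 'a \<Rightarrow> complex) \<in> borel_measurable borel" by auto
  have 2: "(\<lambda>n. LINT x|lborel. f (h n *\<^sub>R x) * FT gauss x) \<longlonglongrightarrow> (LINT x::'a|lborel. f 0 * FT gauss x)"
  proof (rule integral_dominated_convergence)
    show "integrable lborel (\<lambda>x::'a. B * norm (FT gauss x))"
      by (intro integrable_mult_right integrable_norm Fg)
    show "AE x in lborel. (\<lambda>n. f (h n *\<^sub>R x) * FT gauss x) \<longlonglongrightarrow> f 0 * FT gauss x"
      by (intro AE_I2 tendsto_mult tendsto_const hx[OF f(1)])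
    show "\<And>n. AE x in lborel. norm (f (h n *\<^sub>R x) * FT gauss x) \<le> B * norm (FT gauss x)"
      by (intro AE_I2) (simp add: norm_mult mult_right_mono B)
  qed measurable
  have "(LINT x::'a|lborel. gauss x) = FT gauss (0::'a)" by (simp add: FT_def)
  then have gg: "(LINT x::'a|lborel. gauss x) = of_real (sqrt (2 * pi) ^ DIM('a))" by (simp add: FT_gauss gauss_0)
  have "(LINT x::'a|lborel. f 0 * FT gauss x) = f 0 * of_real (sqrt (2 * pi) ^ DIM('a)) * of_real (sqrt (2 * pi) ^ DIM('a))"
    unfolding FT_gauss by (simp add: gg)
  also have "\<dots> = of_real ((2 * pi) ^ DIM('a)) * f 0"
  proof -
    have "complex_of_real (sqrt (2 * pi) ^ DIM('a)) * of_real (sqrt (2 * pi) ^ DIM('a)) = of_real ((2 * pi) ^ DIM('a))"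
      unfolding of_real_mult[symmetric] by (subst power_mult_distrib[symmetric]) simp
    then show ?thesis using mult.assoc mult.commute by metis
  qed
  finally show ?thesis using LIMSEQ_unique[OF 1[unfolded eq] 2] by simp
qed

text \<open>Duality between \<open>m\<close> and the translates of \<open>\<psi>\<close>. No
  inversion is performed, hence no power of 2 \<pi> appears; the reflections are there because
  \<open>FT\<close> is used in the role of its inverse.\<close>

lemma FT_convolution:
  fixes m \<psi> :: "'a::euclidean_space \<Rightarrow> complex"
  assumes m: "integrable lborel m" and \<psi>: "integrable lborel \<psi>" and im: "FT m \<in> borel_measurable borel"
  shows "(LINT v|lborel. FT m (- v) * \<psi> (w - v)) = FT (\<lambda>\<xi>. m \<xi> * FT \<psi> \<xi>) (- w)"
proof -
  have [measurable]: "\<psi> \<in> borel_measurable borel" using \<psi> by auto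
  note [measurable] = im
  have sh: "FT (\<lambda>v. \<psi> (w + v)) \<xi> = cis (w \<bullet> \<xi>) * FT \<psi> \<xi>" for \<xi>
  proof -
    have "FT \<psi> \<xi> = (LINT x|lborel. cis (- ((w + x) \<bullet> \<xi>)) * \<psi> (w + x))"
      unfolding FT_def by (subst lborel_integral_affine[where c=1 and t=w]) auto
    also have "cis (w \<bullet> \<xi>) * \<dots> = (LINT x|lborel. cis (- (x \<bullet> \<xi>)) * \<psi> (w + x))"
      by (subst integral_mult_right_zero[symmetric]) (simp add: inner_add_left mult.assoc[symmetric] cis_mult)
    finally show ?thesis by (simp add: FT_def)
  qed
  have "(LINT v|lborel. FT m (- v) * \<psi> (w - v)) = (LINT v|lborel. FT m v * \<psi> (w + v))"
    by (subst lborel_integral_affine[where c="-1" and t=0]) auto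
  also have "\<dots> = (LINT \<xi>|lborel. m \<xi> * FT (\<lambda>v. \<psi> (w + v)) \<xi>)"
    using lborel_integrable_affine[OF \<psi>, of 1 w] by (intro FT_duality m) simp
  also have "\<dots> = FT (\<lambda>\<xi>. m \<xi> * FT \<psi> \<xi>) (- w)"
    unfolding FT_def[of _ "- w"] sh by (simp add: inner_commute mult_ac)
  finally show ?thesis .
qed

lemma FT_dilate:
  fixes b :: "'a::euclidean_space \<Rightarrow> complex"
  assumes [measurable]: "b \<in> borel_measurable borel"
  shows "FT (\<lambda>\<xi>. b ((1/2) *\<^sub>R \<xi>)) w = of_real (2 ^ DIM('a)) * FT b (2 *\<^sub>R w)"
  unfolding FT_def
  by (subst lborel_integral_affine[where c=2 and t=0]) (auto simp: scaleR_conv_of_real)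

section \<open>A band-limited resolution of the identity\<close>

text \<open>Only finitely many derivatives are needed below, so truncated powers replace the usual
  smooth bump functions.\<close>

definition cutoff :: "nat \<Rightarrow> real \<Rightarrow> real \<Rightarrow> real \<Rightarrow> real" where
  "cutoff N \<alpha> \<beta> t = max 0 (\<beta> - t) ^ (N + 1) * inverse (max 0 (\<beta> - t) ^ (N + 1) + max 0 (t - \<alpha>) ^ (N + 1))"

lemma cutoff_denominator_pos:
  assumes "\<alpha> < \<beta>"
  shows "max 0 (\<beta> - t) ^ (N + 1) + max 0 (t - \<alpha>) ^ (N + 1) > (0::real)"
proof (cases "t < \<beta>")
  case True
  then show ?thesis by (intro add_pos_nonneg zero_less_power) auto
next
  case False
  then show ?thesis using assms by (intro add_nonneg_pos zero_less_power) auto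
qed

lemma cutoff_eq_1:
  assumes "\<alpha> < \<beta>" "t \<le> \<alpha>" shows "cutoff N \<alpha> \<beta> t = 1"
proof -
  have "max 0 (t - \<alpha>) ^ (N + 1) = 0" "max 0 (\<beta> - t) ^ (N + 1) \<noteq> 0" using assms by auto
  then show ?thesis unfolding cutoff_def by (simp only: add_0_right right_inverse not_False_eq_True)
qed

lemma cutoff_eq_0: "t \<ge> \<beta> \<Longrightarrow> cutoff N \<alpha> \<beta> t = 0"
  by (simp add: cutoff_def max_def)

lemma dir_smooth_diff:
  assumes "dir_smooth e n f" "dir_smooth e n g" shows "dir_smooth e n (\<lambda>x. f x - g x)"
  using dir_smooth_add[OF assms(1) dir_smooth_mult[OF dir_smooth_const[of e n "-1"] assms(2)]] by simp

lemma dir_smooth_cutoff: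
  assumes "\<alpha> < \<beta>" and h: "dir_smooth e N (\<lambda>x. of_real (h x))"
  shows "dir_smooth e N (\<lambda>x. of_real (cutoff N \<alpha> \<beta> (h x)))"
proof -
  have 1: "dir_smooth e N (\<lambda>x. of_real (max 0 (\<beta> - h x) ^ (N + 1)))"
    using dir_smooth_max_power[of e N "\<lambda>x. \<beta> - h x" 0] dir_smooth_diff[OF dir_smooth_const h, of "of_real \<beta>"] by simp
  have 2: "dir_smooth e N (\<lambda>x. of_real (max 0 (h x - \<alpha>) ^ (N + 1)))"
    using dir_smooth_max_power[of e N "\<lambda>x. h x - \<alpha>" 0] dir_smooth_diff[OF h dir_smooth_const, of "of_real \<alpha>"] by simp
  have "dir_smooth e N (\<lambda>x. inverse (of_real (max 0 (\<beta> - h x) ^ (N + 1)) + of_real (max 0 (h x - \<alpha>) ^ (N + 1))))"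
  proof (rule dir_smooth_inverse[OF dir_smooth_add[OF 1 2]])
    fix x
    have "complex_of_real (max 0 (\<beta> - h x) ^ (N + 1) + max 0 (h x - \<alpha>) ^ (N + 1)) \<noteq> 0"
      using cutoff_denominator_pos[OF assms(1), of "h x" N] by (metis less_irrefl of_real_eq_0_iff)
    then show "of_real (max 0 (\<beta> - h x) ^ (N + 1)) + of_real (max 0 (h x - \<alpha>) ^ (N + 1)) \<noteq> (0::complex)"
      by simp
  qed
  from dir_smooth_mult[OF 1 this] show ?thesis by (simp add: cutoff_def)
qed

text \<open>Since \<open>5/3 > 2 * 3/5\<close>, a single annulus on which \<open>fourier \<psi>\<close> is bounded below contains the
  support of \<open>b(\<xi>/2) - b(\<xi>)\<close> for a suitable bump \<open>b\<close>, so one division by \<open>fourier \<psi>\<close> suffices.\<close>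

lemma TL_generator_kernels:
  fixes \<psi> :: "'a::euclidean_space \<Rightarrow> complex"
  assumes gen: "TL_generator \<psi>"
  obtains \<theta> \<mu> :: "'a \<Rightarrow> complex" and L where
    "decay (2 * real DIM('a) + 2) \<theta>" "L \<ge> 0" "\<And>x y. norm (\<theta> x - \<theta> y) \<le> L * norm (x - y)"
    "(LINT x|lborel. \<theta> x) \<noteq> 0"
    "decay (2 * real DIM('a) + 2) \<mu>" "\<mu> \<in> borel_measurable borel"
    "\<And>w. of_real (2 ^ DIM('a)) * \<theta> (2 *\<^sub>R w) - \<theta> w = (LINT v|lborel. \<mu> v * \<psi> (w - v))"
proof -
  \<comment> \<open>The order of smoothness of the multipliers equals the order of decay of the
    kernels, and \<open>dconv_hoelder\<close> asks for 2n + 2.\<close>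
  define N where "N = 2 * DIM('a) + 2"
  have s: "\<psi> \<in> schwartz" using gen by (simp add: TL_generator_def)
  have [measurable]: "\<psi> \<in> borel_measurable borel" by (rule schwartz_measurable[OF s])
  have i\<psi>: "integrable lborel \<psi>"
    by (rule schwartz_integrable[OF s])
  obtain c where c: "c > 0" "\<And>\<xi>. 3/5 \<le> norm \<xi> \<Longrightarrow> norm \<xi> \<le> 5/3 \<Longrightarrow> c \<le> norm (FT \<psi> \<xi>)"
    using gen unfolding TL_generator_def by (auto simp: fourier_eq_FT)
  \<comment> \<open>The thresholds are squares of radii: \<open>b\<close> is 1 up to radius 13/20
    and 0 from 3/4 on, so \<open>k\<close> lives between 13/20 and 3/2, strictly inside the annulus
    from 3/5 to 5/3.\<close>
  define b :: "'a \<Rightarrow> complex" where "b \<xi> = of_real (cutoff N (169/400) (9/16) (\<xi> \<bullet> \<xi>))" for \<xi>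
  define k :: "'a \<Rightarrow> complex" where "k \<xi> = b ((1/2) *\<^sub>R \<xi>) - b \<xi>" for \<xi>
  \<comment> \<open>\<open>X\<close> vanishes on the annulus that carries \<open>k\<close> and is
    positive off it. Added to the squared modulus of \<open>FT \<psi>\<close>, it makes the
    denominator \<open>D\<close> nonzero everywhere without changing it where \<open>k\<close>
    lives. So \<open>m\<close> is \<open>k / FT \<psi>\<close>, written as a globally smooth
    quotient.\<close>
  define X :: "'a \<Rightarrow> real" where "X \<xi> = max 0 (169/400 - \<xi> \<bullet> \<xi>) ^ (N + 1) + max 0 (\<xi> \<bullet> \<xi> - 9/4) ^ (N + 1)" for \<xi>
  define D :: "'a \<Rightarrow> complex" where "D \<xi> = FT \<psi> \<xi> * cnj (FT \<psi> \<xi>) + of_real (X \<xi>)" for \<xi>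
  define m :: "'a \<Rightarrow> complex" where "m \<xi> = k \<xi> * (cnj (FT \<psi> \<xi>) * inverse (D \<xi>))" for \<xi>
  have half: "((1/2) *\<^sub>R \<xi>) \<bullet> ((1/2) *\<^sub>R \<xi>) = \<xi> \<bullet> \<xi> / 4" for \<xi> :: 'a by simp
  have b0: "b \<xi> = 0" if "\<xi> \<bullet> \<xi> \<ge> 9/16" for \<xi>
    using that by (simp add: b_def cutoff_eq_0)
  have k0: "k \<xi> = 0" if "\<xi> \<bullet> \<xi> \<le> 169/400 \<or> \<xi> \<bullet> \<xi> \<ge> 9/4" for \<xi>
  proof (cases "\<xi> \<bullet> \<xi> \<le> 169/400")
    case True
    then have "\<xi> \<bullet> \<xi> / 4 \<le> 169/400" using inner_ge_zero[of \<xi>] by linarith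
    with True show ?thesis unfolding k_def b_def half by (simp add: cutoff_eq_1)
  next
    case False
    with that have "\<xi> \<bullet> \<xi> \<ge> 9/4" by simp
    then show ?thesis unfolding k_def b_def half by (simp add: cutoff_eq_0)
  qed
  have Dnz: "D \<xi> \<noteq> 0" for \<xi>
  proof -
    have D: "D \<xi> = of_real ((norm (FT \<psi> \<xi>))\<^sup>2 + X \<xi>)"
      unfolding D_def by (simp only: of_real_add complex_norm_square)
    have X0: "X \<xi> \<ge> 0" by (simp add: X_def)
    have "(norm (FT \<psi> \<xi>))\<^sup>2 + X \<xi> > 0"
    proof (cases "169/400 \<le> \<xi> \<bullet> \<xi> \<and> \<xi> \<bullet> \<xi> \<le> 9/4")
      case True
      have "(3/5)\<^sup>2 \<le> (norm \<xi>)\<^sup>2" "(norm \<xi>)\<^sup>2 \<le> (5/3)\<^sup>2"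
        using True unfolding power2_norm_eq_inner[of \<xi>] by (auto simp: power2_eq_square)
      then have "3/5 \<le> norm \<xi>" "norm \<xi> \<le> 5/3"
        using power2_le_imp_le by fastforce+
      then have "norm (FT \<psi> \<xi>) > 0" using c by (meson less_le_trans)
      then show ?thesis using X0 by (intro add_pos_nonneg) auto
    next
      case False
      then have "X \<xi> > 0" unfolding X_def
        by (cases "\<xi> \<bullet> \<xi> < 169/400") (auto intro!: add_pos_nonneg add_nonneg_pos simp del: power_Suc)
      then show ?thesis by (intro add_nonneg_pos) auto
    qed
    then show ?thesis unfolding D by (metis less_irrefl of_real_eq_0_iff)
  qed
  have mk: "m \<xi> * FT \<psi> \<xi> = k \<xi>" for \<xi>
  proof (cases "k \<xi> = 0")
    case False
    then have "\<xi> \<bullet> \<xi> \<ge> 169/400" "\<xi> \<bullet> \<xi> \<le> 9/4" using k0[of \<xi>] by linarith+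
    then have "X \<xi> = 0" by (simp add: X_def max_def)
    then have "D \<xi> = FT \<psi> \<xi> * cnj (FT \<psi> \<xi>)" by (simp add: D_def)
    then show ?thesis using Dnz[of \<xi>] by (simp add: m_def field_simps)
  qed (simp add: m_def)
  have sq: "dir_smooth e N (\<lambda>\<xi>. of_real (\<xi> \<bullet> \<xi>))" for e :: 'a by (rule dir_smooth_norm_square)
  have sb: "dir_smooth e N b" for e
    unfolding b_def[abs_def] by (rule dir_smooth_cutoff[OF _ sq]) simp
  have sb2: "dir_smooth e N (\<lambda>\<xi>. b ((1/2) *\<^sub>R \<xi>))" for e
    unfolding b_def half using dir_smooth_mult[OF dir_smooth_const[of e N "1/4"] sq]
    by (intro dir_smooth_cutoff) (auto simp: mult.commute)
  have sk: "dir_smooth e N k" for e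
    unfolding k_def[abs_def] by (rule dir_smooth_diff[OF sb2 sb])
  have sF: "dir_smooth e N (FT \<psi>)" for e
    by (rule dir_smooth_FT[OF schwartz_decay[OF s]]) simp
  have sX: "dir_smooth e N (\<lambda>\<xi>. of_real (X \<xi>))" for e
    using dir_smooth_add[OF dir_smooth_max_power[of e N "\<lambda>\<xi>. 169/400 - \<xi> \<bullet> \<xi>" 0] dir_smooth_max_power[of e N "\<lambda>\<xi>. \<xi> \<bullet> \<xi> - 9/4" 0]]
      dir_smooth_diff[OF dir_smooth_const[of e N "169/400"] sq] dir_smooth_diff[OF sq dir_smooth_const[of e N "9/4"]]
    by (simp add: X_def)
  have sm: "dir_smooth e N m" for e
    unfolding m_def[abs_def] D_def[abs_def]
    by (intro dir_smooth_mult dir_smooth_inverse dir_smooth_add sk sX sF dir_smooth_cnj) (use Dnz in \<open>simp add: D_def\<close>)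
  have big: "\<xi> \<bullet> \<xi> \<ge> 9/4" if "norm \<xi> > 2" for \<xi> :: 'a
    using power_strict_mono[OF that, of 2] by (simp add: power2_norm_eq_inner)
  have bs: "b \<xi> = 0" if "norm \<xi> > 2" for \<xi> using b0[of \<xi>] big[OF that] by simp
  have ms: "m \<xi> = 0" if "norm \<xi> > 2" for \<xi> using k0[of \<xi>] big[OF that] by (simp add: m_def)
  have cb: "continuous_on UNIV b" and cm: "continuous_on UNIV m"
    using sb sm dir_smooth_continuous by blast+
  have [measurable]: "b \<in> borel_measurable borel" using cb by (rule borel_measurable_continuous_onI)
  have ib: "integrable lborel b" and im: "integrable lborel m"
    using integrable_continuous_bounded_support[OF cb bs] integrable_continuous_bounded_support[OF cm ms] by auto
  have lip: "\<exists>L\<ge>0. \<forall>x y. norm (FT f x - FT f y) \<le> L * norm (x - y)"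
    if "continuous_on UNIV f" "\<And>\<xi>. norm \<xi> > 2 \<Longrightarrow> f \<xi> = 0" for f :: "'a \<Rightarrow> complex"
  proof (intro exI conjI allI)
    have "integrable lborel (\<lambda>x. of_real (norm x) * f x)"
      by (rule integrable_continuous_bounded_support[of _ 2]) (use that in \<open>auto intro!: continuous_intros\<close>)
    then have "integrable lborel (\<lambda>x. norm x * norm (f x))"
      by (auto dest: integrable_norm simp: norm_mult)
    then show "norm (FT f x - FT f y) \<le> (LINT x|lborel. norm x * norm (f x)) * norm (x - y)" for x y
      by (intro FT_lipschitz integrable_continuous_bounded_support[OF that])
  qed (simp add: integral_nonneg)
  have meas: "FT f \<in> borel_measurable borel"
    if f: "continuous_on UNIV f" "\<And>\<xi>. norm \<xi> > 2 \<Longrightarrow> f \<xi> = 0" for f :: "'a \<Rightarrow> complex"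
  proof -
    obtain L where "L \<ge> 0" "\<And>x y. norm (FT f x - FT f y) \<le> L * norm (x - y)" using lip[OF f] by blast
    then have "continuous_on UNIV (FT f)"
      by (rule continuous_on_norm_lipschitz)
    then show ?thesis by (rule borel_measurable_continuous_onI)
  qed
  have dec: "decay (2 * real DIM('a) + 2) (\<lambda>x. FT f (- x))"
    if f: "\<And>e. dir_smooth e N f" "\<And>\<xi>. norm \<xi> > 2 \<Longrightarrow> f \<xi> = 0" for f :: "'a \<Rightarrow> complex"
  proof -
    have "decay (real N) (FT f)" by (rule FT_decay[OF f])
    then obtain B where "B \<ge> 0" "\<And>x. norm (FT f x) \<le> B * (1 + norm x) powr (-real N)" using decayE by blast
    then have "norm (FT f (- x)) \<le> B * (1 + norm x) powr (-real N)" for x by (metis norm_minus_cancel)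
    then have "decay (real N) (\<lambda>x. FT f (- x))" by (rule decayI)
    moreover have "real N = 2 * real DIM('a) + 2" by (simp add: N_def)
    ultimately show ?thesis by (simp only:)
  qed
  obtain L where L: "L \<ge> 0" "\<And>x y. norm (FT b x - FT b y) \<le> L * norm (x - y)" using lip[OF cb bs] by blast
  note [measurable] = meas[OF cb bs] meas[OF cm ms]
  have "integrable lborel (\<lambda>x. FT b (- x))"
    by (rule decay_integrable[OF dec[OF sb bs]]) auto
  from lborel_integrable_affine[OF this, of "-1" 0] have iFb: "integrable lborel (FT b)" by simp
  show ?thesis
  \<comment> \<open>Up to a constant factor these are the inverse transforms of \<open>b\<close> and
    \<open>m\<close>. Hence \<open>2^n \<theta>(2w) - \<theta>(w)\<close> has multiplier
    \<open>k = m * FT \<psi>\<close>.\<close>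
  proof (rule that[of "\<lambda>x. FT b (- x)" L "\<lambda>x. FT m (- x)"])
    show "decay (2 * real DIM('a) + 2) (\<lambda>x. FT b (- x))" "decay (2 * real DIM('a) + 2) (\<lambda>x. FT m (- x))"
      using dec[OF sb bs] dec[OF sm ms] by auto
    show "L \<ge> 0" by fact
    show "norm (FT b (- x) - FT b (- y)) \<le> L * norm (x - y)" for x y
      using L(2)[of "- x" "- y"] by (simp add: norm_minus_commute)
    have "(LINT x|lborel. FT b (- x)) = (LINT x|lborel. FT b x)"
      by (subst (2) lborel_integral_affine[where c="-1" and t=0]) auto
    also have "\<dots> = of_real ((2 * pi) ^ DIM('a)) * b 0" by (rule integral_FT[OF cb bs iFb])
    also have "b 0 = 1" by (simp add: b_def cutoff_eq_1)
    finally show "(LINT x|lborel. FT b (- x)) \<noteq> 0" by simp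
    show "(\<lambda>x. FT m (- x)) \<in> borel_measurable borel" by measurable
    fix w
    have "FT k (- w) = FT (\<lambda>\<xi>. b ((1/2) *\<^sub>R \<xi>)) (- w) - FT b (- w)"
      unfolding FT_def k_def right_diff_distrib
      using lborel_integrable_affine[OF ib, of "1/2" 0]
      by (intro Bochner_Integration.integral_diff FT_integrable ib) simp
    also have "FT (\<lambda>\<xi>. b ((1/2) *\<^sub>R \<xi>)) (- w) = of_real (2 ^ DIM('a)) * FT b (- (2 *\<^sub>R w))"
      by (subst FT_dilate) auto
    finally show "of_real (2 ^ DIM('a)) * FT b (- (2 *\<^sub>R w)) - FT b (- w) = (LINT v|lborel. FT m (- v) * \<psi> (w - v))"
      by (subst FT_convolution[OF im i\<psi>]) (auto simp: mk)
  qed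
qed

section \<open>The lower bound\<close>

lemma epowr_mono:
  assumes "a \<le> b" "r > 0" shows "epowr a r \<le> epowr b r"
proof (cases "b = \<infinity>")
  case False
  then have "a \<noteq> \<infinity>" using assms(1) by (auto simp: top_unique)
  then show ?thesis
    using assms False unfolding epowr_def
    by (auto intro!: ennreal_leI powr_mono2 enn2real_mono simp: less_top)
qed (auto simp: epowr_def)

lemma epowr_ennreal: "x \<ge> 0 \<Longrightarrow> epowr (ennreal x) r = ennreal (x powr r)"
  by (simp add: epowr_def)

lemma epowr_epowr_inverse: "r > 0 \<Longrightarrow> epowr (epowr a r) (1 / r) = a"
  by (cases a) (auto simp: epowr_def powr_powr)

lemma lq_norm_ge:
  assumes "q > 0"
  shows "a j \<le> lq_norm q a"
proof (cases "q = \<infinity>")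
  case True
  then show ?thesis by (auto simp: lq_norm_def intro: SUP_upper)
next
  case False
  define r where "r = enn2real q"
  have r: "r > 0" using assms False by (simp add: r_def enn2real_positive_iff less_top)
  have "epowr (a j) r = sum (\<lambda>j. epowr (a j) r) {j}" by simp
  also have "\<dots> \<le> (\<Sum>\<^sub>\<infinity>j\<in>UNIV. epowr (a j) r)"
    by (subst nonneg_infsum_complete) (auto intro!: SUP_upper2[of "{j}"])
  finally have "epowr (epowr (a j) r) (1 / r) \<le> epowr (\<Sum>\<^sub>\<infinity>j\<in>UNIV. epowr (a j) r) (1 / r)"
    using r by (intro epowr_mono) auto
  then show ?thesis using r False by (simp add: epowr_epowr_inverse lq_norm_def r_def)
qed

text \<open>Mass proportional to the radius, not to the volume, is the density that suits a
  one-dimensional family of centres. \<open>u\<close> is a Borel minorant supported in the ball; it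
  allows integrals to be added without appeal to the measurability of \<open>W\<close>.\<close>

definition captures :: "('a::euclidean_space \<Rightarrow> ennreal) \<Rightarrow> 'a \<Rightarrow> real \<Rightarrow> bool" where
  "captures W e c \<longleftrightarrow> (\<exists>R u. 0 < R \<and> u \<in> borel_measurable borel \<and> (\<forall>x. u x \<le> W x) \<and>
     (\<forall>x. x \<notin> ball e R \<longrightarrow> u x = 0) \<and> ennreal (c * R) \<le> (\<integral>\<^sup>+x. u x \<partial>lborel))"

text \<open>Disjoint balls are selected through the distances of their centres from \<open>x0\<close>, which
  reduces the covering argument to intervals.\<close>

lemma annular_covering:
  fixes x0 :: "'a::euclidean_space" and W :: "'a \<Rightarrow> ennreal"
  assumes c: "c > 0"
    and cov: "\<And>t. \<alpha> \<le> t \<Longrightarrow> t \<le> \<beta> \<Longrightarrow> \<exists>e. dist e x0 = t \<and> captures W e c"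
  shows "ennreal (c * (\<beta> - \<alpha>) / 10) \<le> (\<integral>\<^sup>+x. W x \<partial>lebesgue)"
proof (cases "\<alpha> \<le> \<beta>")
  case False
  then have "c * (\<beta> - \<alpha>) / 10 \<le> 0" using c by (simp add: mult_nonneg_nonpos)
  then show ?thesis by (simp add: ennreal_neg)
next
  case True
  obtain e R u where e: "\<And>t. \<alpha> \<le> t \<Longrightarrow> t \<le> \<beta> \<Longrightarrow> dist (e t) x0 = t"
    and R: "\<And>t. \<alpha> \<le> t \<Longrightarrow> t \<le> \<beta> \<Longrightarrow> 0 < R t"
    and u: "\<And>t. \<alpha> \<le> t \<Longrightarrow> t \<le> \<beta> \<Longrightarrow> u t \<in> borel_measurable borel"
      "\<And>t x. \<alpha> \<le> t \<Longrightarrow> t \<le> \<beta> \<Longrightarrow> u t x \<le> W x"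
      "\<And>t x. \<alpha> \<le> t \<Longrightarrow> t \<le> \<beta> \<Longrightarrow> x \<notin> ball (e t) (R t) \<Longrightarrow> u t x = 0"
      "\<And>t. \<alpha> \<le> t \<Longrightarrow> t \<le> \<beta> \<Longrightarrow> ennreal (c * R t) \<le> (\<integral>\<^sup>+x. u t x \<partial>lborel)"
  proof -
    define P where "P t e R u \<longleftrightarrow> dist e x0 = t \<and> 0 < R \<and> u \<in> borel_measurable borel \<and>
       (\<forall>x. u x \<le> W x) \<and> (\<forall>x. x \<notin> ball e R \<longrightarrow> u x = 0) \<and> ennreal (c * R) \<le> (\<integral>\<^sup>+x. u x \<partial>lborel)"
      for t e R and u :: "'a \<Rightarrow> ennreal"
    have "\<forall>t\<in>{\<alpha>..\<beta>}. \<exists>e R u. P t e R u" using cov unfolding P_def captures_def by auto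
    from bchoice[OF this] obtain e where "\<forall>t\<in>{\<alpha>..\<beta>}. \<exists>R u. P t (e t) R u" by blast
    from bchoice[OF this] obtain R where "\<forall>t\<in>{\<alpha>..\<beta>}. \<exists>u. P t (e t) (R t) u" by blast
    from bchoice[OF this] obtain u where "\<forall>t\<in>{\<alpha>..\<beta>}. P t (e t) (R t) (u t)" by blast
    then show ?thesis unfolding P_def by (intro that[of e R u]) auto
  qed
  have "compact {\<alpha>..\<beta>}" by simp
  then obtain F where F: "F \<subseteq> {\<alpha>..\<beta>}" "finite F" "{\<alpha>..\<beta>} \<subseteq> (\<Union>t\<in>F. ball t (R t))"
    by (rule compactE_image[of _ "{\<alpha>..\<beta>}" "\<lambda>t. ball t (R t)"]) (use R in force)+
  \<comment> \<open>The Vitali lemma asks for a common bound on the radii, which passing to a finite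
    subcover provides.\<close>
  define B where "B = Max (insert 1 (R ` F))"
  have RB: "0 < R t \<and> R t \<le> B" if "t \<in> F" for t
    using that F R unfolding B_def by (auto intro!: Max_ge)
  obtain C where C: "C \<subseteq> F" "pairwise (\<lambda>i j. disjnt (ball i (R i)) (ball j (R j))) C"
     "{\<alpha>..\<beta>} \<subseteq> (\<Union>i\<in>C. ball i (5 * R i))"
    by (rule Vitali_covering_lemma_balls[OF F(3) RB]) (blast intro: that)+
  have finC: "finite C" using C(1) F(2) finite_subset by blast
  have Cab: "\<alpha> \<le> t" "t \<le> \<beta>" if "t \<in> C" for t using that C(1) F(1) by auto
  have "\<beta> - \<alpha> = measure lborel {\<alpha>..\<beta>}" using True by simp
  also have "\<dots> \<le> measure lborel (\<Union>i\<in>C. ball i (5 * R i))"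
  proof (rule measure_mono_fmeasurable[OF C(3)])
    show "(\<Union>i\<in>C. ball i (5 * R i)) \<in> fmeasurable lborel"
      by (rule fmeasurable.finite_UN[OF finC], rule fmeasurableI[OF _ emeasure_lborel_ball_finite]) simp
  qed simp
  also have "\<dots> \<le> (\<Sum>i\<in>C. measure lborel (ball i (5 * R i)))"
    by (intro measure_UNION_le finC) auto
  \<comment> \<open>An interval of radius 5 R has length 10 R; this is the 10 in the
    conclusion.\<close>
  also have "\<dots> = (\<Sum>i\<in>C. 10 * R i)"
  proof (intro sum.cong refl)
    fix i assume "i \<in> C"
    then have "0 < R i" using R Cab by blast
    then show "measure lborel (ball i (5 * R i)) = 10 * R i"
      by (simp add: ball_eq_greaterThanLessThan)
  qed
  finally have len: "\<beta> - \<alpha> \<le> 10 * (\<Sum>i\<in>C. R i)" by (simp add: sum_distrib_left)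
  \<comment> \<open>The distance to \<open>x0\<close> is 1-Lipschitz, so a point common to two of
    the balls would put its distance into two of the disjoint intervals. At each x at most one of
    the minorants is nonzero.\<close>
  have le: "(\<Sum>t\<in>C. u t x) \<le> W x" for x
  proof (cases "\<exists>t\<in>C. x \<in> ball (e t) (R t)")
    case True
    then obtain t where t: "t \<in> C" "x \<in> ball (e t) (R t)" by blast
    have z: "u i x = 0" if "i \<in> C - {t}" for i
    proof (rule u(3))
      show "\<alpha> \<le> i" "i \<le> \<beta>" using that Cab by auto
      show "x \<notin> ball (e i) (R i)"
      proof
        assume x: "x \<in> ball (e i) (R i)"
        have "\<bar>dist x x0 - i\<bar> < R i"
          using e[of i] Cab[of i] that x dist_triangle[of x x0 "e i"] dist_triangle[of "e i" x0 x]
          by (auto simp: dist_commute)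
        moreover have "\<bar>dist x x0 - t\<bar> < R t"
          using e[of t] Cab[of t] t dist_triangle[of x x0 "e t"] dist_triangle[of "e t" x0 x]
          by (auto simp: dist_commute)
        ultimately have "dist x x0 \<in> ball i (R i) \<inter> ball t (R t)" by (auto simp: dist_real_def)
        moreover have "disjnt (ball i (R i)) (ball t (R t))"
          using C(2) that t by (auto simp: pairwise_def)
        ultimately show False by (auto simp: disjnt_def)
      qed
    qed
    have "(\<Sum>i\<in>C. u i x) = u t x + (\<Sum>i\<in>C - {t}. u i x)" using finC t(1) by (rule sum.remove)
    also have "\<dots> = u t x" using z by simp
    finally show ?thesis using u(2)[of t x] Cab[OF t(1)] by simp
  next
    case False
    then have "(\<Sum>i\<in>C. u i x) = 0" using u(3) Cab by (intro sum.neutral) auto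
    then show ?thesis by simp
  qed
  have "ennreal (c * (\<beta> - \<alpha>) / 10) \<le> ennreal (\<Sum>t\<in>C. c * R t)"
    using mult_left_mono[OF len, of c] c by (intro ennreal_leI) (simp add: sum_distrib_left[symmetric])
  also have "\<dots> = (\<Sum>t\<in>C. ennreal (c * R t))"
    using R Cab c by (intro sum_ennreal[symmetric]) (auto intro!: mult_nonneg_nonneg less_imp_le)
  also have "\<dots> \<le> (\<Sum>t\<in>C. \<integral>\<^sup>+x. u t x \<partial>lborel)"
    using u(4) Cab by (intro sum_mono) auto
  also have "\<dots> = (\<integral>\<^sup>+x. (\<Sum>t\<in>C. u t x) \<partial>lborel)"
    using u(1) Cab by (intro nn_integral_sum[symmetric]) auto
  also have "\<dots> \<le> (\<integral>\<^sup>+x. W x \<partial>lborel)" by (intro nn_integral_mono le)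
  finally show ?thesis by (simp add: nn_integral_completion)
qed

text \<open>An average at scale 2^(-j0) that misjudges \<open>g e\<close> is turned into mass near
  \<open>e\<close>. \<open>W\<close> is any majorant of the p-th powers of the single weighted
  terms, later the p-th power of their l^q norm; this keeps \<open>q\<close> out of the
  argument.\<close>

lemma TL_pointwise_detection:
  fixes \<psi> :: "'a::euclidean_space \<Rightarrow> complex"
  assumes gen: "TL_generator \<psi>" and s: "s > 0" and p: "p > 0" and sp: "s * p = real DIM('a)"
  obtains \<theta> :: "'a \<Rightarrow> complex" and L c where
    "decay (2 * real DIM('a) + 2) \<theta>" "L \<ge> 0" "\<And>x y. norm (\<theta> x - \<theta> y) \<le> L * norm (x - y)"
    "(LINT x|lborel. \<theta> x) \<noteq> 0" "c > 0"
    "\<forall>g e j0 W. continuous_on UNIV g \<longrightarrow> (\<forall>y. norm (g y) \<le> 1) \<longrightarrow>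
       (\<forall>j x. ennreal ((2 powr (of_int j * s) * norm (dconv \<psi> j g x)) powr p) \<le> W x) \<longrightarrow>
       norm (LINT x|lborel. \<theta> x) / 6 \<le> norm (dconv \<theta> j0 g e - (LINT x|lborel. \<theta> x) * g e) \<longrightarrow>
       captures W e (c * 2 powi j0)"
proof -
  let ?n = "real DIM('a)"
  obtain \<theta> \<mu> :: "'a \<Rightarrow> complex" and L where
    \<theta>: "decay (2 * ?n + 2) \<theta>" "L \<ge> 0" "\<And>x y. norm (\<theta> x - \<theta> y) \<le> L * norm (x - y)"
    "(LINT x|lborel. \<theta> x) \<noteq> 0"
    and \<mu>: "decay (2 * ?n + 2) \<mu>" "\<mu> \<in> borel_measurable borel"
    and \<kappa>: "\<And>w. of_real (2 ^ DIM('a)) * \<theta> (2 *\<^sub>R w) - \<theta> w = (LINT v|lborel. \<mu> v * \<psi> (w - v))"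
    by (rule TL_generator_kernels[OF gen]) (rule that; (assumption | simp only:))
  define \<Theta> where "\<Theta> = (LINT x|lborel. \<theta> x)"
  have \<Theta>: "norm \<Theta> > 0" using \<theta>(4) by (simp add: \<Theta>_def)
  have sch: "\<psi> \<in> schwartz" using gen by (simp add: TL_generator_def)
  have [measurable]: "\<psi> \<in> borel_measurable borel" by (rule schwartz_measurable[OF sch])
  note [measurable] = \<mu>(2)
  have "continuous_on UNIV \<theta>"
    by (rule continuous_on_norm_lipschitz[OF \<theta>(2,3)])
  then have [measurable]: "\<theta> \<in> borel_measurable borel" by (rule borel_measurable_continuous_onI)
  have i\<theta>: "integrable lborel \<theta>" by (rule decay_integrable[OF \<theta>(1)]) auto
  have i\<mu>: "integrable lborel \<mu>" by (rule decay_integrable[OF \<mu>(1)]) auto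
  have i\<psi>: "integrable lborel \<psi>"
    by (rule schwartz_integrable[OF sch])
  have "integrable lborel (\<lambda>x. (1 + norm x) ^ 1 * norm (\<mu> x))"
    by (rule decay_moment_integrable[of "?n + 1"]) (use decay_mono[OF \<mu>(1), of "?n + 1 + real 1"] in auto)
  then have i\<mu>1: "integrable lborel (\<lambda>x. norm x * norm (\<mu> x))"
    by (rule Bochner_Integration.integrable_bound) (auto simp: abs_mult intro!: mult_right_mono)
  obtain L\<psi> where L\<psi>: "L\<psi> \<ge> 0" "\<And>x y. norm (\<psi> x - \<psi> y) \<le> L\<psi> * norm (x - y)"
    using schwartz_lipschitz[OF sch] by blast
  have d\<psi>: "decay (2 * ?n + 2) \<psi>" using schwartz_decay[OF sch, of "2 * DIM('a) + 2"] by (rule decay_mono) simp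
  obtain Ch where Ch: "Ch \<ge> 0" "\<And>j g x x'. g \<in> borel_measurable borel \<Longrightarrow> (\<And>y. norm (g y) \<le> 1) \<Longrightarrow>
     norm (dconv \<psi> j g x - dconv \<psi> j g x') \<le> Ch * sqrt (2 powi j * norm (x - x'))"
    using dconv_hoelder[OF d\<psi> L\<psi>] by auto
  define A where "A = (LINT v|lborel. norm (\<psi> v)) + 1"
  define M0 where "M0 = (LINT v|lborel. norm (\<mu> v))"
  define M1 where "M1 = (LINT v|lborel. norm v * norm (\<mu> v))"
  have pos: "A > 0" "M0 \<ge> 0" "M1 \<ge> 0" by (auto simp: A_def M0_def M1_def add_nonneg_pos integral_nonneg)
  define \<eta> where "\<eta> = 1 / (p + 2 * ?n + 1)"
  have \<eta>: "0 < \<eta>" "\<eta> * (p + 2 * ?n) = 1 - \<eta>"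
    using p by (auto simp: \<eta>_def field_simps add_pos_nonneg)
  define z where "z = 2 powr (- \<eta>)"
  have z: "0 < z" "z < 1" using \<eta>(1) powr_less_mono[of "-\<eta>" 0 2] by (auto simp: z_def)
  \<comment> \<open>The series of all \<open>t0 * z ^ i\<close> sums to
    \<open>norm \<Theta> / 12\<close>, half of the assumed error. The increments over the scales
    therefore cannot all stay below these terms.\<close>
  define t0 where "t0 = norm \<Theta> * (1 - z) / 12"
  have t0: "t0 > 0" using \<Theta> z by (simp add: t0_def)
  \<comment> \<open>With \<sigma> = a \<tau> and \<rho> = b / \<tau>, each of the two terms in
    \<open>mean_value_detection\<close> is at most \<tau> / 4. Adding 1 to \<open>M0\<close>,
    \<open>M1\<close> and \<open>Ch\<close> keeps the quotients and constants positive.\<close>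
  define a where "a = 1 / (4 * (M0 + 1))"
  define b where "b = 4 * A * (M1 + 1)"
  \<comment> \<open>On a ball of radius r = 2^(-j) d \<tau>^2 the Hoelder bound
    \<open>Ch * sqrt (2^j r)\<close> is at most \<sigma> / 2, so half of the detected size survives
    there.\<close>
  define d where "d = (a / (2 * (Ch + 1)))\<^sup>2"
  \<comment> \<open>As \<tau> \<le> \<open>t0\<close>, the quantity b / \<tau> + d \<tau>^2 = (b + d
    \<tau>^3) / \<tau> is at most K / \<tau>. A ball of radius 2^(-j) K / \<tau> about
    \<open>e\<close> therefore contains the small ball on which the level is kept.\<close>
  define K where "K = b + d * t0 ^ 3"
  have abd: "a > 0" "b > 0" "d > 0" using pos Ch(1) by (auto simp: a_def b_def d_def)
  then have K: "K > 0" using t0 by (simp add: K_def add_pos_pos)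
  define w where "w = measure lborel (ball (0::'a) 1)"
  have w: "w > 0" unfolding w_def using content_ball_pos[of 1 "0::'a"] by simp
  define Q where "Q = (a / 2) powr p * w * d ^ DIM('a)"
  have Q: "Q > 0" using abd w by (simp add: Q_def)
  define c where "c = Q * t0 powr (p + 2 * ?n + 1) / K"
  show ?thesis
  proof (rule that[OF \<theta>, of c], goal_cases)
    case 1
    show ?case using Q t0 K by (simp add: c_def)
  next
    case 2
    show ?case
  proof (intro allI impI)
    fix g :: "'a \<Rightarrow> complex" and e j0 and W :: "'a \<Rightarrow> ennreal"
    assume g: "continuous_on UNIV g" and g1': "\<forall>y. norm (g y) \<le> 1"
      and W: "\<forall>j x. ennreal ((2 powr (of_int j * s) * norm (dconv \<psi> j g x)) powr p) \<le> W x"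
      and far: "norm (LINT x|lborel. \<theta> x) / 6 \<le> norm (dconv \<theta> j0 g e - (LINT x|lborel. \<theta> x) * g e)"
    note g1 = g1'[rule_format]
    have gm[measurable]: "g \<in> borel_measurable borel" by (rule borel_measurable_continuous_onI[OF g])
    let ?\<kappa> = "\<lambda>w. of_real (2 ^ DIM('a)) * \<theta> (2 *\<^sub>R w) - \<theta> w"
    have "\<exists>m. norm (dconv ?\<kappa> (j0 + int m) g e) > t0 * z ^ m"
    proof (rule ccontr)
      assume neg: "\<not> ?thesis"
      have step: "norm (dconv \<theta> (j0 + int m) g e - dconv \<theta> j0 g e) \<le> (\<Sum>i<m. t0 * z ^ i)" for m
      proof (induction m)
        case (Suc m)
        have "dconv \<theta> (j0 + int (Suc m)) g e - dconv \<theta> (j0 + int m) g e = dconv ?\<kappa> (j0 + int m) g e"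
          using dconv_telescope[OF i\<theta> gm g1, of ?\<kappa> "j0 + int m" e] by (simp add: add_ac)
        then have "norm (dconv \<theta> (j0 + int (Suc m)) g e - dconv \<theta> (j0 + int m) g e) \<le> t0 * z ^ m"
          using neg by (simp add: not_less)
        with Suc have "norm ((dconv \<theta> (j0 + int (Suc m)) g e - dconv \<theta> (j0 + int m) g e)
            + (dconv \<theta> (j0 + int m) g e - dconv \<theta> j0 g e)) \<le> t0 * z ^ m + (\<Sum>i<m. t0 * z ^ i)"
          by (intro norm_triangle_mono)
        then show ?case by (simp add: add_ac)
      qed simp
      have "(\<Sum>i<m. t0 * z ^ i) \<le> norm \<Theta> / 12" for m
      proof -
        have "(\<Sum>i<m. z ^ i) \<le> (\<Sum>i. z ^ i)" using z by (intro sum_le_suminf summable_geometric) auto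
        also have "\<dots> = 1 / (1 - z)" using z by (intro suminf_geometric) auto
        finally have "t0 * (\<Sum>i<m. z ^ i) \<le> t0 * (1 / (1 - z))" using t0 by (intro mult_left_mono) auto
        also have "t0 * (1 / (1 - z)) = norm \<Theta> / 12"
        proof -
          have "1 - z \<noteq> 0" using z by simp
          then have "(1 - z) * (1 / (1 - z)) = 1" by simp
          then show ?thesis unfolding t0_def by (simp only: times_divide_eq_left mult.assoc mult_1_right)
        qed
        finally show ?thesis by (simp add: sum_distrib_left)
      qed
      then have bd: "norm (dconv \<theta> (j0 + int m) g e - dconv \<theta> j0 g e) \<le> norm \<Theta> / 12" for m
        using step order_trans by blast
      have "(\<lambda>m. norm (dconv \<theta> (j0 + int m) g e - dconv \<theta> j0 g e)) \<longlonglongrightarrow> norm (\<Theta> * g e - dconv \<theta> j0 g e)"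
        unfolding \<Theta>_def by (intro tendsto_norm tendsto_diff tendsto_const dconv_tendsto[OF i\<theta> g g1])
      then have "norm (\<Theta> * g e - dconv \<theta> j0 g e) \<le> norm \<Theta> / 12"
        by (rule LIMSEQ_le_const2) (use bd in auto)
      moreover have "norm \<Theta> / 6 \<le> norm (\<Theta> * g e - dconv \<theta> j0 g e)"
        using far by (simp add: \<Theta>_def norm_minus_commute)
      ultimately show False using \<Theta> by linarith
    qed
    then obtain m where m: "norm (dconv ?\<kappa> (j0 + int m) g e) > t0 * z ^ m" by blast
    define j where "j = j0 + int m"
    define \<tau> where "\<tau> = t0 * z ^ m"
    have \<tau>: "\<tau> > 0" "\<tau> \<le> t0" using t0 z by (auto simp: \<tau>_def mult_left_le power_le_one)
    define \<sigma> where "\<sigma> = a * \<tau>"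
    define \<rho> where "\<rho> = b / \<tau>"
    have \<sigma>\<rho>: "\<sigma> > 0" "\<rho> > 0" using \<tau> abd by (auto simp: \<sigma>_def \<rho>_def)
    let ?i = "2 powi (-j) :: real"
    let ?G = "\<lambda>v. dconv \<psi> j g (e - ?i *\<^sub>R v)"
    have "\<exists>v. norm v \<le> \<rho> \<and> norm (?G v) > \<sigma>"
    proof (rule mean_value_detection[OF i\<mu> i\<mu>1])
      show "norm (?G y) \<le> A" for y
      proof -
        have "norm (?G y) \<le> 1 * (LINT v|lborel. norm (\<psi> v))" by (rule dconv_bound[OF i\<psi> gm g1])
        then show ?thesis by (simp add: A_def)
      qed
      have "a * M0 \<le> 1 / 4" using pos by (simp add: a_def divide_simps)
      then have "\<tau> * (a * M0) \<le> \<tau> * (1 / 4)" using \<tau> by (intro mult_left_mono) auto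
      then have "\<sigma> * M0 \<le> \<tau> / 4" by (simp add: \<sigma>_def mult_ac)
      moreover have "A / \<rho> * M1 \<le> \<tau> / 4"
      proof -
        have "A / \<rho> * M1 = \<tau> * (M1 / (4 * (M1 + 1)))"
          using pos \<tau> by (simp add: \<rho>_def b_def)
        moreover have "M1 / (4 * (M1 + 1)) \<le> 1 / 4" using pos by (simp add: divide_simps)
        then have "\<tau> * (M1 / (4 * (M1 + 1))) \<le> \<tau> * (1 / 4)" using \<tau> by (intro mult_left_mono) auto
        ultimately show ?thesis by simp
      qed
      moreover have "norm (LINT v|lborel. \<mu> v * ?G v) > \<tau>"
      proof -
        have eq: "dconv ?\<kappa> j g e = (LINT v|lborel. \<mu> v * ?G v)"
          by (rule dconv_assoc[OF i\<mu> i\<psi> gm g1 \<kappa>])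
        show ?thesis unfolding eq[symmetric] \<tau>_def by (rule m[folded j_def])
      qed
      ultimately show "\<sigma> * (LINT v|lborel. norm (\<mu> v)) + A / \<rho> * (LINT v|lborel. norm v * norm (\<mu> v)) < norm (LINT v|lborel. \<mu> v * ?G v)"
        using \<tau> unfolding M0_def[symmetric] M1_def[symmetric] by linarith
    qed (use \<sigma>\<rho> in auto)
    then obtain v where v: "norm v \<le> \<rho>" "norm (?G v) > \<sigma>" by blast
    define y where "y = e - ?i *\<^sub>R v"
    define r where "r = ?i * (d * \<tau>\<^sup>2)"
    define R where "R = ?i * (K / \<tau>)"
    have i: "?i > 0" "?i * 2 powi j = 1" by (auto simp flip: power_int_add)
    have rR: "r > 0" "R > 0" using i abd \<tau> K by (auto simp: r_def R_def)
    have sub: "ball y r \<subseteq> ball e R"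
    proof
      fix x assume "x \<in> ball y r"
      have "dist e y = ?i * norm v" using i(1) by (simp add: y_def dist_norm)
      then have "dist e y \<le> ?i * \<rho>" using mult_left_mono[OF v(1), of ?i] i(1) by linarith
      moreover have "dist y x < r" using \<open>x \<in> ball y r\<close> by simp
      ultimately have "dist e x < ?i * \<rho> + r" using dist_triangle[of e x y] by linarith
      also have "\<dots> = ?i * (b / \<tau> + d * \<tau>\<^sup>2)" by (simp add: r_def \<rho>_def algebra_simps)
      also have "\<dots> \<le> R"
      proof -
        have "\<tau> ^ 3 \<le> t0 ^ 3" using \<tau> by (intro power_mono) auto
        then have "b + d * \<tau> ^ 3 \<le> K" using abd by (simp add: K_def mult_left_mono)
        then have "(b + d * \<tau> ^ 3) / \<tau> \<le> K / \<tau>" using \<tau> by (intro divide_right_mono) auto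
        moreover have "(b + d * \<tau> ^ 3) / \<tau> = b / \<tau> + d * \<tau>\<^sup>2"
          using \<tau>(1) by (simp add: field_simps power3_eq_cube power2_eq_square)
        ultimately have "b / \<tau> + d * \<tau>\<^sup>2 \<le> K / \<tau>" by linarith
        then show ?thesis unfolding R_def using i(1) by (intro mult_left_mono) auto
      qed
      finally show "x \<in> ball e R" by simp
    qed
    define l where "l = 2 powr (of_int j * s) * (\<sigma> / 2)"
    define u :: "'a \<Rightarrow> ennreal" where "u x = ennreal (l powr p) * indicator (ball y r) x" for x
    have "u x \<le> W x" for x
    proof (cases "x \<in> ball y r")
      case True
      have "norm (dconv \<psi> j g y - dconv \<psi> j g x) \<le> Ch * sqrt (2 powi j * norm (y - x))"
        by (rule Ch(2)[OF gm g1])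
      also have "\<dots> \<le> (Ch + 1) * (a / (2 * (Ch + 1)) * \<tau>)"
      proof (intro mult_mono real_le_lsqrt)
        have "2 powi j * norm (y - x) \<le> 2 powi j * r"
          using True by (intro mult_left_mono) (auto simp: dist_norm)
        also have "2 powi j * r = (?i * 2 powi j) * (d * \<tau>\<^sup>2)" by (simp only: r_def mult_ac)
        also have "\<dots> = (a / (2 * (Ch + 1)) * \<tau>)\<^sup>2"
          unfolding i(2) d_def power_mult_distrib by (rule mult_1)
        finally show "2 powi j * norm (y - x) \<le> (a / (2 * (Ch + 1)) * \<tau>)\<^sup>2" .
      qed (use Ch(1) abd \<tau> in auto)
      also have "\<dots> = \<sigma> / 2"
      proof -
        have "X * (a / (2 * X) * \<tau>) = a * \<tau> / 2" if "X \<noteq> 0" for X using that by simp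
        from this[of "Ch + 1"] have "Ch + 1 \<noteq> 0 \<Longrightarrow> (Ch + 1) * (a / (2 * (Ch + 1)) * \<tau>) = a * \<tau> / 2" .
        then show ?thesis using Ch(1) unfolding \<sigma>_def by linarith
      qed
      finally have "norm (dconv \<psi> j g x) \<ge> \<sigma> / 2"
        using v(2) norm_triangle_ineq2[of "dconv \<psi> j g y" "dconv \<psi> j g x"] unfolding y_def[symmetric] by linarith
      then have "l powr p \<le> (2 powr (of_int j * s) * norm (dconv \<psi> j g x)) powr p"
        unfolding l_def using p \<sigma>\<rho> by (intro powr_mono2 mult_left_mono mult_nonneg_nonneg) auto
      then have "ennreal (l powr p) \<le> W x" using W[rule_format, of j x] by (meson ennreal_leI order_trans)
      then show ?thesis using True by (simp add: u_def)
    qed (simp add: u_def)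
    moreover have "u \<in> borel_measurable borel"       unfolding u_def[abs_def]
      by (intro borel_measurable_times_ennreal borel_measurable_const borel_measurable_indicator) auto
    moreover have "u x = 0" if "x \<notin> ball e R" for x
    proof -
      have "x \<notin> ball y r" using that sub by blast
      then show ?thesis by (simp add: u_def indicator_def)
    qed
    moreover have "ennreal (c * 2 powi j0 * R) \<le> (\<integral>\<^sup>+x. u x \<partial>lborel)"
    proof -
      \<comment> \<open>Since \<open>s * p = n\<close>, the weight becomes 2^(jn) and cancels the
        factor 2^(-jn) in the volume of the ball.\<close>
      have lp: "l powr p = 2 powr (of_int j * ?n) * ((a / 2) powr p * \<tau> powr p)"
      proof -
        have l: "l = 2 powr (of_int j * s) * ((a / 2) * \<tau>)" by (simp add: l_def \<sigma>_def)
        have "of_int j * s * p = of_int j * ?n" unfolding sp[symmetric] by (rule mult.assoc)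
        then have "(2 powr (of_int j * s)) powr p = (2::real) powr (of_int j * ?n)" by (simp only: powr_powr)
        moreover have "l powr p = (2 powr (of_int j * s)) powr p * ((a / 2) powr p * \<tau> powr p)"
          unfolding l using abd \<tau> by (subst powr_mult; (subst powr_mult)?) auto
        ultimately show ?thesis by simp
      qed
      have "measure lborel (ball y r) = r ^ DIM('a) * w"
        unfolding w_def by (rule content_ball_conv_unit_ball) (use rR in simp)
      also have "r ^ DIM('a) = 2 powr (- (of_int j * ?n)) * d ^ DIM('a) * \<tau> powr (2 * ?n)"
      proof -
        have "?i ^ DIM('a) = 2 powr (- (of_int j * ?n))"
        proof -
          show ?thesis by (simp add: two_powi_eq_powr powr_power mult.commute)
        qed
        moreover have "(\<tau>\<^sup>2) ^ DIM('a) = \<tau> powr (2 * ?n)"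
        proof -
          have "\<tau> powr (2 * ?n) = \<tau> powr real (2 * DIM('a))" by simp
          also have "\<dots> = \<tau> ^ (2 * DIM('a))" using \<tau>(1) by (intro powr_realpow)
          also have "\<dots> = (\<tau>\<^sup>2) ^ DIM('a)" by (rule power_mult)
          finally show ?thesis ..
        qed
        ultimately show ?thesis by (simp add: r_def power_mult_distrib)
      qed
      finally have vol: "measure lborel (ball y r) = 2 powr (- (of_int j * ?n)) * d ^ DIM('a) * \<tau> powr (2 * ?n) * w" .
      have "l powr p * measure lborel (ball y r) = Q * (2 powr (of_int j * ?n) * 2 powr (- (of_int j * ?n))) * (\<tau> powr p * \<tau> powr (2 * ?n))"
        unfolding lp vol Q_def by (simp only: mult_ac)
      also have "2 powr (of_int j * ?n) * 2 powr (- (of_int j * ?n)) = (1::real)" by (simp flip: powr_add)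
      also have "\<tau> powr p * \<tau> powr (2 * ?n) = \<tau> powr (p + 2 * ?n)" by (simp add: powr_add)
      finally have cost: "l powr p * measure lborel (ball y r) = Q * \<tau> powr (p + 2 * ?n)" by simp
      have zm: "z ^ m = 2 powr (- (\<eta> * real m))" by (simp add: z_def powr_power mult.commute)
      have tp: "\<tau> powr (p + 2 * ?n) = t0 powr (p + 2 * ?n) * 2 powr (- (real m * (1 - \<eta>)))"
      proof -
        have ex: "(\<eta> * real m) * (p + 2 * ?n) = real m * (1 - \<eta>)"
          unfolding \<eta>(2)[symmetric] by (simp only: mult_ac)
        have "\<tau> powr (p + 2 * ?n) = t0 powr (p + 2 * ?n) * (2 powr (- (\<eta> * real m))) powr (p + 2 * ?n)"
          unfolding \<tau>_def zm using t0 by (subst powr_mult) auto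
        then show ?thesis by (simp only: powr_powr ex mult_minus_left)
      qed
      \<comment> \<open>Relative to 2^(-j0), the radius is a constant times 2^(-m (1 - \<eta>)). By
        the choice of \<eta> the captured mass carries the same power, and \<open>c\<close> is the
        quotient of the two constants.\<close>
      have "2 powi j0 * R = (2 powi j0 * ?i) * (K / \<tau>)" by (simp add: R_def)
      also have "2 powi j0 * ?i = 2 powr (- real m)"
      proof -
        have "2 powi j0 * ?i = 2 powi (- int m)" by (simp add: j_def flip: power_int_add)
        then show ?thesis by (simp add: power_int_minus powr_minus powr_realpow)
      qed
      also have "K / \<tau> = K / t0 * 2 powr (\<eta> * real m)"
        unfolding \<tau>_def zm by (simp add: powr_minus field_simps)
      also have "2 powr (- real m) * (K / t0 * 2 powr (\<eta> * real m)) = K / t0 * 2 powr (- (real m * (1 - \<eta>)))"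
      proof -
        have "2 powr (- real m) * 2 powr (\<eta> * real m) = (2::real) powr (- (real m * (1 - \<eta>)))"
          by (subst powr_add[symmetric]) (simp add: algebra_simps)
        then show ?thesis by (simp add: mult.left_commute)
      qed
      finally have "c * (2 powi j0 * R) = c * (K / t0) * 2 powr (- (real m * (1 - \<eta>)))" by simp
      also have "c * (K / t0) = Q * t0 powr (p + 2 * ?n)"
        using K t0 by (simp add: c_def powr_add)
      finally have "c * 2 powi j0 * R = l powr p * measure lborel (ball y r)"
        unfolding cost tp by simp
      moreover have "(\<integral>\<^sup>+x. u x \<partial>lborel) = ennreal (l powr p) * emeasure lborel (ball y r)"
        unfolding u_def by (simp add: nn_integral_cmult_indicator)
      moreover have "emeasure lborel (ball y r) = ennreal (measure lborel (ball y r))"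
        using emeasure_lborel_ball_finite[of y r] by (simp add: emeasure_eq_ennreal_measure)
      ultimately show ?thesis
        using ennreal_mult[of "l powr p" "measure lborel (ball y r)"] by simp
    qed
    ultimately show "captures W e (c * 2 powi j0)"
      unfolding captures_def using rR(2) by blast
  qed
  qed
qed

lemma regular_TL_norm:
  fixes \<psi> g :: "'a::euclidean_space \<Rightarrow> complex"
  assumes "\<psi> \<in> borel_measurable borel" "g \<in> borel_measurable borel"
  shows "TL_norm \<psi> s p q (regular_distribution g) =
    Lp_norm p (\<lambda>x. lq_norm q (\<lambda>j. ennreal (2 powr (of_int j * s) * norm (dconv \<psi> j g x))))"
  using assms by (simp add: TL_norm_def distr_convolution_eq_dconv)

text \<open>\<open>E\<close> realises every distance from \<open>x0\<close> in [0, r], and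
  \<open>F\<close>, which reaches out to 2r, every distance in [r, 2r]. Whichever set is misjudged
  thus offers a range of distances of length r, and the factor r cancels against 2^j0 in the density
  of captured mass.\<close>

lemma TL_norm_lower_bound:
  fixes \<psi> :: "'a::euclidean_space \<Rightarrow> complex"
  assumes gen: "TL_generator \<psi>" and s: "s > 0" and q: "q > 0"
  obtains c where "c > 0"
    "\<forall>g x0 r E F y y'. continuous_on UNIV g \<longrightarrow> (\<forall>x. norm (g x) \<le> 1) \<longrightarrow> r > 0 \<longrightarrow>
       connected E \<longrightarrow> x0 \<in> E \<longrightarrow> y \<in> E \<longrightarrow> dist y x0 = r \<longrightarrow> (\<forall>x. x \<in> E \<longrightarrow> g x = 1) \<longrightarrow>
       connected F \<longrightarrow> y' \<in> F \<longrightarrow> dist y' x0 = r \<longrightarrow> (\<exists>y''\<in>F. dist y'' x0 \<ge> 2 * r) \<longrightarrow> (\<forall>x. x \<in> F \<longrightarrow> g x = 0) \<longrightarrow>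
       ennreal c \<le> TL_norm \<psi> s (real DIM('a) / s) q (regular_distribution g)"
proof -
  define p where "p = real DIM('a) / s"
  have p: "p > 0" using s by (simp add: p_def)
  have sp: "s * p = real DIM('a)" using s by (simp add: p_def)
  obtain \<theta> :: "'a \<Rightarrow> complex" and L c where
    \<theta>: "decay (2 * real DIM('a) + 2) \<theta>" and L: "L \<ge> 0" "\<And>x y. norm (\<theta> x - \<theta> y) \<le> L * norm (x - y)"
    and nz: "(LINT x|lborel. \<theta> x) \<noteq> 0" and c: "c > 0"
    and det: "\<forall>g e j0 W. continuous_on UNIV g \<longrightarrow> (\<forall>y. norm (g y) \<le> 1) \<longrightarrow>
       (\<forall>j x. ennreal ((2 powr (of_int j * s) * norm (dconv \<psi> j g x)) powr p) \<le> W x) \<longrightarrow>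
       norm (LINT x|lborel. \<theta> x) / 6 \<le> norm (dconv \<theta> j0 g e - (LINT x|lborel. \<theta> x) * g e) \<longrightarrow>
       captures W e (c * 2 powi j0)"
    by (rule TL_pointwise_detection[OF gen s p sp]) (rule that; (assumption | simp only:))
  obtain Ch where Ch: "Ch \<ge> 0" "\<And>j g x x'. g \<in> borel_measurable borel \<Longrightarrow> (\<And>y. norm (g y) \<le> 1) \<Longrightarrow>
     norm (dconv \<theta> j g x - dconv \<theta> j g x') \<le> Ch * sqrt (2 powi j * norm (x - x'))"
    using dconv_hoelder[OF \<theta> L] by auto
  define \<Theta> where "\<Theta> = (LINT x|lborel. \<theta> x)"
  have \<Theta>: "norm \<Theta> > 0" using nz by (simp add: \<Theta>_def)
  \<comment> \<open>If 2^j0 times a distance is at most \<open>k\<close>, the Hoelder bound for the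
    averages is at most \<open>norm \<Theta> / 6\<close>.\<close>
  define k where "k = (norm \<Theta> / (6 * (Ch + 1)))\<^sup>2"
  have k: "k > 0" using \<Theta> Ch(1) by (simp add: k_def)
  have sch: "\<psi> \<in> schwartz" using gen by (simp add: TL_generator_def)
  have \<psi>m: "\<psi> \<in> borel_measurable borel" by (rule schwartz_measurable[OF sch])
  \<comment> \<open>The covering gives c 2^j0 r / 10, and 2^j0 r \<ge> k / 4.\<close>
  define c0 where "c0 = c * k / 40"
  have c0: "c0 > 0" using c k by (simp add: c0_def)
  show ?thesis
  proof (rule that[of "c0 powr (1 / p)"], goal_cases)
    case 1
    show ?case using c0 by simp
  next
    case 2
    show ?case
  proof (intro allI impI)
    fix g :: "'a \<Rightarrow> complex" and x0 r E F y y'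
    assume g: "continuous_on UNIV g" and g1': "\<forall>x. norm (g x) \<le> 1" and r: "r > (0::real)"
      and E: "connected E" "x0 \<in> E" "y \<in> E" "dist y x0 = r" "\<forall>x. x \<in> E \<longrightarrow> g x = 1"
      and F: "connected F" "y' \<in> F" "dist y' x0 = r" "\<exists>y''\<in>F. dist y'' x0 \<ge> 2 * r" "\<forall>x. x \<in> F \<longrightarrow> g x = 0"
    note g1 = g1'[rule_format]
    have gm: "g \<in> borel_measurable borel" by (rule borel_measurable_continuous_onI[OF g])
    define a where "a j x = ennreal (2 powr (of_int j * s) * norm (dconv \<psi> j g x))" for j x
    define W where "W x = epowr (lq_norm q (\<lambda>j. a j x)) p" for x
    have W: "ennreal ((2 powr (of_int j * s) * norm (dconv \<psi> j g x)) powr p) \<le> W x" for j x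
    proof -
      have "epowr (a j x) p \<le> W x" unfolding W_def by (rule epowr_mono[OF lq_norm_ge[OF q] p])
      then show ?thesis by (simp add: a_def epowr_ennreal)
    qed
    \<comment> \<open>The finest scale at which the averages are still nearly constant on the ball
      of radius 2r about \<open>x0\<close>.\<close>
    define j0 where "j0 = \<lfloor>log 2 (k / (2 * r))\<rfloor>"
    have j0: "2 powi j0 * (2 * r) \<le> k" "k \<le> 2 powi j0 * (4 * r)"
    proof -
      note pj = two_powi_eq_powr[of j0]
      have kr: "k / (2 * r) > 0" using k r by simp
      then have eq: "2 powr (log 2 (k / (2 * r))) = k / (2 * r)" by simp
      have "2 powr (of_int j0) \<le> 2 powr (log 2 (k / (2 * r)))"
        unfolding j0_def by (intro powr_mono) auto
      then show "2 powi j0 * (2 * r) \<le> k" unfolding eq pj using r by (simp add: field_simps)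
      have "2 powr (log 2 (k / (2 * r))) \<le> 2 powr (of_int j0 + 1)"
        unfolding j0_def by (intro powr_mono) linarith+
      then have "k / (2 * r) \<le> 2 * 2 powr (of_int j0)" unfolding eq by (simp add: powr_add)
      then show "k \<le> 2 powi j0 * (4 * r)" unfolding pj using r by (simp add: field_simps)
    qed
    have near: "norm (dconv \<theta> j0 g x - dconv \<theta> j0 g x0) \<le> norm \<Theta> / 6" if "dist x x0 \<le> 2 * r" for x
    proof -
      have "norm (dconv \<theta> j0 g x - dconv \<theta> j0 g x0) \<le> Ch * sqrt (2 powi j0 * norm (x - x0))"
        by (rule Ch(2)[OF gm g1])
      also have "\<dots> \<le> (Ch + 1) * (norm \<Theta> / (6 * (Ch + 1)))"
      proof (intro mult_mono real_le_lsqrt)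
        have "2 powi j0 * norm (x - x0) \<le> 2 powi j0 * (2 * r)"
          using that by (intro mult_left_mono) (auto simp: dist_norm)
        then show "2 powi j0 * norm (x - x0) \<le> (norm \<Theta> / (6 * (Ch + 1)))\<^sup>2"
          using j0(1) unfolding k_def[symmetric] by linarith
      qed (use Ch(1) in auto)
      also have "\<dots> = norm \<Theta> / 6"
      proof -
        have "X * (norm \<Theta> / (6 * X)) = norm \<Theta> / 6" if "X \<noteq> 0" for X using that by simp
        then show ?thesis using Ch(1) by (metis add_nonneg_pos less_irrefl zero_less_one)
      qed
      finally show ?thesis .
    qed
    have hit: "\<exists>e\<in>S. dist e x0 = t"
      if "connected S" "a \<in> S" "b \<in> S" "dist a x0 \<le> t" "t \<le> dist b x0" for S a b t
    proof -
      have "connected ((\<lambda>x. dist x x0) ` S)"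
        by (intro connected_continuous_image continuous_intros that(1))
      then have "t \<in> (\<lambda>x. dist x x0) ` S"
        by (rule connectedD_interval[of _ "dist a x0" "dist b x0"]) (use that in auto)
      then show ?thesis by blast
    qed
    \<comment> \<open>The correct averages on \<open>E\<close> and \<open>F\<close> would be
      \<Theta> and 0, so the one at \<open>x0\<close> is off by at least
      \<open>norm \<Theta> / 2\<close> from one of them. \<open>S\<close> is the continuum
      concerned, \<open>v\<close> the value of \<open>g\<close> on it, and [\<alpha>, \<alpha> + r]
      the distances it realises. Moving from \<open>x0\<close> to a point of \<open>S\<close> loses
      at most \<open>norm \<Theta> / 6\<close> of this error.\<close>
    have "\<exists>\<alpha> S v. (\<forall>t. \<alpha> \<le> t \<and> t \<le> \<alpha> + r \<longrightarrow> t \<le> 2 * r \<and> (\<exists>e\<in>S. dist e x0 = t)) \<and> (\<forall>x\<in>S. g x = v) \<and>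
       norm \<Theta> / 2 \<le> norm (dconv \<theta> j0 g x0 - \<Theta> * v)"
    proof (cases "norm \<Theta> / 2 \<le> norm (dconv \<theta> j0 g x0 - \<Theta> * 1)")
      case True
      have "\<exists>e\<in>E. dist e x0 = t" if "0 \<le> t" "t \<le> r" for t
        by (rule hit[OF E(1,2,3)]) (use that E in auto)
      then show ?thesis using True E(5) r by (intro exI[of _ 0] exI[of _ E] exI[of _ 1]) auto
    next
      case False
      have "norm \<Theta> \<le> norm (dconv \<theta> j0 g x0 - \<Theta> * 1) + norm (dconv \<theta> j0 g x0)"
        using norm_triangle_ineq4[of "dconv \<theta> j0 g x0" "dconv \<theta> j0 g x0 - \<Theta> * 1"] by simp
      then have *: "norm \<Theta> / 2 \<le> norm (dconv \<theta> j0 g x0 - \<Theta> * 0)" using False by simp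
      obtain y'' where y'': "y'' \<in> F" "dist y'' x0 \<ge> 2 * r" using F(4) by blast
      have "\<exists>e\<in>F. dist e x0 = t" if "r \<le> t" "t \<le> 2 * r" for t
        by (rule hit[OF F(1,2) y''(1)]) (use that F y'' in auto)
      then show ?thesis using * F(5) by (intro exI[of _ r] exI[of _ F] exI[of _ 0]) auto
    qed
    then obtain \<alpha> S v where S: "\<And>t. \<alpha> \<le> t \<Longrightarrow> t \<le> \<alpha> + r \<Longrightarrow> t \<le> 2 * r \<and> (\<exists>e\<in>S. dist e x0 = t)"
      "\<And>x. x \<in> S \<Longrightarrow> g x = v" "norm \<Theta> / 2 \<le> norm (dconv \<theta> j0 g x0 - \<Theta> * v)" by blast
    have "ennreal (c * 2 powi j0 * (\<alpha> + r - \<alpha>) / 10) \<le> (\<integral>\<^sup>+x. W x \<partial>lebesgue)"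
    proof (rule annular_covering[of _ _ _ x0])
      show "c * 2 powi j0 > 0" using c by simp
      fix t assume t: "\<alpha> \<le> t" "t \<le> \<alpha> + r"
      obtain e where e: "e \<in> S" "dist e x0 = t" "t \<le> 2 * r" using S(1)[OF t] by blast
      have tri: "norm (dconv \<theta> j0 g x0 - \<Theta> * v) \<le> norm (dconv \<theta> j0 g e - \<Theta> * v) + norm (dconv \<theta> j0 g e - dconv \<theta> j0 g x0)"
        using norm_triangle_ineq4[of "dconv \<theta> j0 g e - \<Theta> * v" "dconv \<theta> j0 g e - dconv \<theta> j0 g x0"] by simp
      have "norm \<Theta> / 6 \<le> norm (dconv \<theta> j0 g e - \<Theta> * g e)"
      proof -
        have "norm (dconv \<theta> j0 g e - dconv \<theta> j0 g x0) \<le> norm \<Theta> / 6" using near[of e] e(2,3) by simp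
        moreover have "norm \<Theta> / 6 \<le> B" if "A \<le> B + D" "D \<le> norm \<Theta> / 6" "norm \<Theta> / 2 \<le> A" for A B D
          using that \<Theta> by linarith
        ultimately show ?thesis
          using tri S(3) unfolding S(2)[OF e(1)] by blast
      qed
      then have "captures W e (c * 2 powi j0)"
        unfolding \<Theta>_def using W by (intro det[rule_format, OF g g1]) auto
      then show "\<exists>e. dist e x0 = t \<and> captures W e (c * 2 powi j0)"
        using e(2) by blast
    qed
    moreover have "c0 \<le> c * 2 powi j0 * (\<alpha> + r - \<alpha>) / 10"
      using mult_left_mono[OF j0(2), of c] c by (simp add: c0_def mult_ac)
    ultimately have "ennreal c0 \<le> (\<integral>\<^sup>+x. W x \<partial>lebesgue)" by (meson ennreal_leI order_trans)
    then have "epowr (ennreal c0) (1 / p) \<le> Lp_norm p (\<lambda>x. lq_norm q (\<lambda>j. a j x))"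
      unfolding Lp_norm_def W_def using p by (intro epowr_mono) auto
    then show "ennreal (c0 powr (1 / p)) \<le> TL_norm \<psi> s (real DIM('a) / s) q (regular_distribution g)"
      unfolding p_def[symmetric] regular_TL_norm[OF \<psi>m gm] a_def using c0 by (simp add: epowr_ennreal)
  qed
  qed
qed

section \<open>The upper bound\<close>

text \<open>A Lipschitz bump is smooth enough: because s < 1, the factor 2^(-m) gained from one
  order of smoothness beats the weight 2^(ms).\<close>

definition hat :: "'a::euclidean_space \<Rightarrow> complex" where
  "hat x = of_real (max 0 (min 1 (2 - norm x)))"

lemma norm_hat_le: "norm (hat x) \<le> 1" and hat_eq_1: "norm x \<le> 1 \<Longrightarrow> hat x = 1"
  and hat_eq_0: "norm x \<ge> 2 \<Longrightarrow> hat x = 0"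
  by (auto simp: hat_def)

lemma hat_continuous: "continuous_on A hat"
  unfolding hat_def by (intro continuous_intros)

lemma hat_measurable[measurable]: "hat \<in> borel_measurable borel"
  by (intro borel_measurable_continuous_onI hat_continuous)

lemma hat_diff_le: "norm (hat x - hat y) \<le> norm (x - y)"
proof -
  have "\<bar>max 0 (min 1 (2 - norm x)) - max 0 (min 1 (2 - norm y))\<bar> \<le> \<bar>norm x - norm y\<bar>" by auto
  also have "\<dots> \<le> norm (x - y)" by (rule norm_triangle_ineq3)
  finally show ?thesis by (simp add: hat_def flip: of_real_diff)
qed

text \<open>The difference vanishes once \<open>norm y\<close> exceeds 2 + \<open>norm z\<close>, so
  the weight costs at most the factor 3 (1 + \<open>norm z\<close>) over the Lipschitz
  bound.\<close>

lemma hat_diff_decay: "(1 + norm y) * norm (hat (y - z) - hat y) \<le> 3 * norm z * (1 + norm z)"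
proof (cases "norm y \<le> 2 + norm z")
  case True
  have "(1 + norm y) * norm (hat (y - z) - hat y) \<le> (3 * (1 + norm z)) * norm z"
  proof (rule mult_mono)
    show "1 + norm y \<le> 3 * (1 + norm z)" using True norm_ge_zero[of z] by argo
    show "norm (hat (y - z) - hat y) \<le> norm z" using hat_diff_le[of "y - z" y] by simp
  qed auto
  then show ?thesis by (simp add: mult_ac)
next
  case False
  have "norm y \<ge> 2" using False norm_ge_zero[of z] by linarith
  moreover have "norm (y - z) \<ge> 2" using False norm_triangle_ineq2[of y z] by linarith
  ultimately show ?thesis by (simp add: hat_eq_0)
qed

lemma TL_generator_integral_zero:
  assumes "TL_generator \<psi>" shows "(LINT x|lborel. \<psi> x) = 0"
proof -
  have m: "\<psi> \<in> borel_measurable borel" using assms by (auto simp: TL_generator_def intro: schwartz_measurable)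
  have "0 \<notin> {\<xi>. fourier \<psi> \<xi> \<noteq> 0}"
    using assms closure_subset[of "{\<xi>. fourier \<psi> \<xi> \<noteq> 0}"] unfolding TL_generator_def by force
  then show ?thesis by (simp add: fourier_eq_FT[OF m] FT_def)
qed

text \<open>For m \<ge> 0 the mean value zero of \<open>\<psi>\<close> allows \<open>hat y\<close>
  to be subtracted, and the Lipschitz bound yields 2^(-m). For m < 0 the integrand lives on a ball
  of radius about 2^m, where the weight 1 + \<open>norm y\<close> is at most 3 * 2^(-m) (1 +
  \<open>norm v\<close>). The decay of \<open>\<psi>\<close> absorbs the last factor and the volume
  2^(mn) the power 2^(-m).\<close>

lemma hat_estimate:
  fixes \<psi> :: "'a::euclidean_space \<Rightarrow> complex"
  assumes gen: "TL_generator \<psi>" and dim: "DIM('a) \<ge> 2"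
  obtains C where "C \<ge> 0"
    "\<And>m y. (1 + norm y) * norm (dconv \<psi> m hat y) \<le> C * min 1 (2 powi (-m))"
proof -
  have sch: "\<psi> \<in> schwartz" using gen by (simp add: TL_generator_def)
  have [measurable]: "\<psi> \<in> borel_measurable borel" by (rule schwartz_measurable[OF sch])
  have i\<psi>: "integrable lborel \<psi>"
    by (rule schwartz_integrable[OF sch])
  have i2: "integrable lborel (\<lambda>x. (1 + norm x) ^ 2 * norm (\<psi> x))"
    by (rule decay_moment_integrable[OF decay_mono[OF schwartz_decay[OF sch, of "DIM('a) + 3"]], of "real DIM('a) + 1"]) auto
  obtain B where B: "B \<ge> 0" "\<And>x. norm (\<psi> x) \<le> B * (1 + norm x) powr (- real 1)"
    using decayE[OF schwartz_decay[OF sch]] by metis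
  have B1: "(1 + norm v) * norm (\<psi> v) \<le> B" for v
  proof -
    have "1 + norm v > 0" by (simp add: add_pos_nonneg)
    then show ?thesis using B(2)[of v] by (simp add: powr_minus field_simps)
  qed
  define I where "I = (LINT v|lborel. (1 + norm v) ^ 2 * norm (\<psi> v))"
  define w where "w = measure lborel (ball (0::'a) 1)"
  have I0: "I \<ge> 0" "w \<ge> 0" unfolding I_def w_def by (auto intro!: integral_nonneg)
  define C where "C = 3 * I + 3 * B * (w * 3 ^ DIM('a))"
  have hi: "integrable lborel (\<lambda>v. \<psi> v * hat (y - c *\<^sub>R v))" for y c
    by (rule dconv_integrable[OF i\<psi> hat_measurable norm_hat_le])
  show ?thesis
  proof (rule that[of C])
    show "C \<ge> 0" using I0 B by (simp add: C_def)
    fix m :: int and y :: 'a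
    let ?c = "2 powi (-m) :: real"
    have c: "?c > 0" by simp
    have y0: "1 + norm y \<ge> 0" by simp
    show "(1 + norm y) * norm (dconv \<psi> m hat y) \<le> C * min 1 ?c"
    proof (cases "m \<ge> 0")
      case True
      then obtain n where "m = int n" using nonneg_int_cases by blast
      then have c1: "?c \<le> 1" by (simp add: power_int_minus inverse_le_1_iff)
      have "dconv \<psi> m hat y = dconv \<psi> m hat y - (LINT v|lborel. \<psi> v * hat y)"
        by (simp add: TL_generator_integral_zero[OF gen])
      also have "\<dots> = (LINT v|lborel. \<psi> v * (hat (y - ?c *\<^sub>R v) - hat y))"
        unfolding dconv_def
        by (subst Bochner_Integration.integral_diff[symmetric]) (auto intro!: hi i\<psi> simp: right_diff_distrib)
      finally have eq: "dconv \<psi> m hat y = (LINT v|lborel. \<psi> v * (hat (y - ?c *\<^sub>R v) - hat y))" .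
      have "norm (of_real (1 + norm y) * dconv \<psi> m hat y) = norm (LINT v|lborel. of_real (1 + norm y) * (\<psi> v * (hat (y - ?c *\<^sub>R v) - hat y)))"
        unfolding eq by (subst integral_mult_right_zero) (rule refl)
      also have "\<dots> \<le> (LINT v|lborel. 3 * ?c * ((1 + norm v) ^ 2 * norm (\<psi> v)))"
      proof (rule Bochner_Integration.integral_norm_bound_integral)
        show "integrable lborel (\<lambda>v. of_real (1 + norm y) * (\<psi> v * (hat (y - ?c *\<^sub>R v) - hat y)))"
          unfolding right_diff_distrib[of "\<psi> _"] by (intro integrable_mult_right Bochner_Integration.integrable_diff hi integrable_mult_left i\<psi>)
        show "integrable lborel (\<lambda>v. 3 * ?c * ((1 + norm v) ^ 2 * norm (\<psi> v)))"
          by (intro integrable_mult_right i2)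
        fix v
        have "(1 + norm y) * norm (hat (y - ?c *\<^sub>R v) - hat y) \<le> 3 * norm (?c *\<^sub>R v) * (1 + norm (?c *\<^sub>R v))"
          by (rule hat_diff_decay)
        also have "\<dots> \<le> 3 * (?c * (1 + norm v)) * (1 + norm v)"
        proof (intro mult_mono)
          show "norm (?c *\<^sub>R v) \<le> ?c * (1 + norm v)" using c by (simp add: mult_left_mono)
          show "1 + norm (?c *\<^sub>R v) \<le> 1 + norm v" using c c1 mult_right_mono[OF c1, of "norm v"] by simp
        qed (use c in auto)
        finally have "((1 + norm y) * norm (hat (y - ?c *\<^sub>R v) - hat y)) * norm (\<psi> v) \<le> 3 * (?c * (1 + norm v)) * (1 + norm v) * norm (\<psi> v)"
          by (rule mult_right_mono) simp
        moreover have "norm (complex_of_real (1 + norm y)) = 1 + norm y" using y0 by (simp only: norm_of_real abs_of_nonneg)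
        ultimately show "norm (of_real (1 + norm y) * (\<psi> v * (hat (y - ?c *\<^sub>R v) - hat y))) \<le> 3 * ?c * ((1 + norm v) ^ 2 * norm (\<psi> v))"
          unfolding norm_mult power2_eq_square by (simp only: mult_ac)
      qed
      also have "\<dots> = 3 * I * ?c" by (simp add: I_def)
      also have "\<dots> \<le> C * ?c" using B I0 c by (intro mult_right_mono) (auto simp: C_def)
      finally show ?thesis using c1 y0 by (simp only: norm_mult norm_of_real abs_of_nonneg min_absorb2)
    next
      case False
      then have c1: "?c \<ge> 1" by (simp add: power_int_def)
      let ?S = "ball ((2 powi m) *\<^sub>R y) (3 * 2 powi m)"
      have cc: "2 powi m * ?c = 1" by (simp flip: power_int_add)
      have vol: "measure lborel ?S = (3 * 2 powi m) ^ DIM('a) * w"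
        unfolding w_def by (rule content_ball_conv_unit_ball) simp
      have "norm (of_real (1 + norm y) * dconv \<psi> m hat y) = norm (LINT v|lborel. of_real (1 + norm y) * (\<psi> v * hat (y - ?c *\<^sub>R v)))"
        unfolding dconv_def by (subst integral_mult_right_zero) (rule refl)
      also have "\<dots> \<le> (LINT v|lborel. 3 * ?c * B * indicator ?S v)"
      proof (rule Bochner_Integration.integral_norm_bound_integral)
        show "integrable lborel (\<lambda>v. of_real (1 + norm y) * (\<psi> v * hat (y - ?c *\<^sub>R v)))"
          by (intro integrable_mult_right hi)
        show "integrable lborel (\<lambda>v. 3 * ?c * B * indicator ?S v :: real)"
          by (intro integrable_mult_right integrable_real_indicator emeasure_lborel_ball_finite) simp
        fix v
        show "norm (of_real (1 + norm y) * (\<psi> v * hat (y - ?c *\<^sub>R v))) \<le> 3 * ?c * B * indicator ?S v"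
        proof (cases "norm (y - ?c *\<^sub>R v) < 2")
          case True
          have "dist ((2 powi m) *\<^sub>R y) v = 2 powi m * norm (y - ?c *\<^sub>R v)"
          proof -
            have "(2 powi m) *\<^sub>R y - v = (2 powi m) *\<^sub>R (y - ?c *\<^sub>R v)"
              by (simp add: scaleR_right_diff_distrib cc)
            then show ?thesis by (simp add: dist_norm)
          qed
          also have "\<dots> < 3 * 2 powi m" using True by simp
          finally have S: "v \<in> ?S" by simp
          have "norm y \<le> norm (y - ?c *\<^sub>R v) + norm (?c *\<^sub>R v)" using norm_triangle_ineq[of "y - ?c *\<^sub>R v" "?c *\<^sub>R v"] by simp
          also have "norm (?c *\<^sub>R v) = ?c * norm v" using c by simp
          finally have "norm y \<le> norm (y - ?c *\<^sub>R v) + ?c * norm v" .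
          moreover have "0 \<le> ?c * norm v" using c by (intro mult_nonneg_nonneg) auto
          moreover have "3 * ?c * (1 + norm v) = 3 * ?c + 3 * (?c * norm v)" by (simp add: distrib_left)
          ultimately have "1 + norm y \<le> 3 * ?c * (1 + norm v)" using True c1 by linarith
          then have "(1 + norm y) * (norm (\<psi> v) * norm (hat (y - ?c *\<^sub>R v))) \<le> (3 * ?c * (1 + norm v)) * (norm (\<psi> v) * 1)"
            using c by (intro mult_mono norm_hat_le) auto
          also have "\<dots> = 3 * ?c * ((1 + norm v) * norm (\<psi> v))" by simp
          also have "\<dots> \<le> 3 * ?c * B" using c by (intro mult_left_mono B1) auto
          finally show ?thesis using S y0 by (simp only: norm_mult norm_of_real abs_of_nonneg indicator_simps mult_1_right)
        next
          case False
          then have "hat (y - ?c *\<^sub>R v) = 0" by (simp add: hat_eq_0)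
          then show ?thesis using B c by simp
        qed
      qed
      also have "\<dots> = 3 * ?c * B * ((3 * 2 powi m) ^ DIM('a) * w)"
        by (simp add: vol)
      also have "\<dots> = 3 * B * (w * 3 ^ DIM('a)) * (?c * (2 powi m) ^ DIM('a))"
        by (simp only: power_mult_distrib mult_ac)
      also have "\<dots> \<le> 3 * B * (w * 3 ^ DIM('a)) * 1"
      proof (rule mult_left_mono)
        have "(2 powi m) ^ DIM('a) \<le> (2 powi m :: real) ^ 1"
          using False dim by (intro power_decreasing) (auto simp: power_int_def power_inverse[symmetric] power_le_one)
        then have "?c * (2 powi m) ^ DIM('a) \<le> ?c * (2 powi m)" using c by (intro mult_left_mono) auto
        then show "?c * (2 powi m) ^ DIM('a) \<le> 1" using cc by (simp only: mult.commute)
      qed (use B I0 in auto)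
      also have "\<dots> \<le> C * 1" using I0 by (simp add: C_def)
      finally show ?thesis using c1 y0 by (simp only: norm_mult norm_of_real abs_of_nonneg min_absorb1)
    qed
  qed
qed

section \<open>Inequalities for sums over scales\<close>

lemma sum_int_geometric_le:
  fixes z :: real
  assumes z: "0 \<le> z" "z < 1" and J: "finite J"
  shows "(\<Sum>j\<in>J. z ^ nat \<bar>j + l\<bar>) \<le> 2 / (1 - z)"
proof -
  have half: "(\<Sum>j\<in>K. z ^ h j) \<le> 1 / (1 - z)" if "finite K" "inj_on h K" for K and h :: "int \<Rightarrow> nat"
  proof -
    have "(\<Sum>j\<in>K. z ^ h j) = (\<Sum>n\<in>h ` K. z ^ n)" using that by (simp add: sum.reindex)
    also have "\<dots> \<le> (\<Sum>n. z ^ n)" using z that by (intro sum_le_suminf summable_geometric) auto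
    also have "\<dots> = 1 / (1 - z)" using z by (intro suminf_geometric) auto
    finally show ?thesis .
  qed
  let ?h = "\<lambda>j. nat \<bar>j + l\<bar>"
  have "(\<Sum>j\<in>J. z ^ ?h j) = (\<Sum>j\<in>{j\<in>J. j + l \<ge> 0}. z ^ ?h j) + (\<Sum>j\<in>{j\<in>J. \<not> j + l \<ge> 0}. z ^ ?h j)"
    using J by (subst sum.union_disjoint[symmetric]) (auto intro!: sum.cong)
  also have "\<dots> \<le> 1 / (1 - z) + 1 / (1 - z)"
    using J by (intro add_mono half) (auto intro!: inj_onI)
  finally show ?thesis by simp
qed

lemma powr_sum_le_sum_powr:
  assumes "0 < r" "r \<le> 1" "finite A" "\<And>i. i \<in> A \<Longrightarrow> f i \<ge> (0::real)"
  shows "(\<Sum>i\<in>A. f i) powr r \<le> (\<Sum>i\<in>A. f i powr r)"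
  using assms(3,4)
proof (induction A rule: finite_induct)
  case (insert a A)
  have add: "(x + y) powr r \<le> x powr r + y powr r" if "x \<ge> 0" "y \<ge> 0" for x y :: real
  proof (cases "x + y = 0")
    case True
    then show ?thesis using that by simp
  next
    case False
    then have xy: "x + y > 0" using that by simp
    have le: "u \<le> u powr r" if "0 \<le> u" "u \<le> 1" for u :: real
      using powr_mono'[of r 1 u] that assms by (cases "u = 0") auto
    have "1 = x / (x + y) + y / (x + y)" using xy by (simp add: add_divide_distrib[symmetric])
    also have "\<dots> \<le> (x / (x + y)) powr r + (y / (x + y)) powr r"
      using that xy by (intro add_mono le) auto
    also have "\<dots> = (x powr r + y powr r) / (x + y) powr r"
      using that xy by (simp add: powr_divide add_divide_distrib)
    finally show ?thesis using xy by (simp add: pos_le_divide_eq)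
  qed
  have "(\<Sum>i\<in>insert a A. f i) powr r \<le> f a powr r + (\<Sum>i\<in>A. f i) powr r"
    using insert by (simp add: add sum_nonneg)
  also have "\<dots> \<le> f a powr r + (\<Sum>i\<in>A. f i powr r)" using insert by simp
  finally show ?case using insert by simp
qed simp

text \<open>The embedding of l^r into l^q for r \<le> q: every term is at most S^(1/r), so of its
  q-th power only the r-th power has to be summed. All values of q are thereby reduced to one
  exponent r, which may be taken at most 1.\<close>

lemma lq_norm_le:
  assumes q: "q > 0" and r: "0 < r" "ennreal r \<le> q" and a: "\<And>j. a j \<ge> 0"
    and S: "S \<ge> 0" "\<And>J. finite J \<Longrightarrow> (\<Sum>j\<in>J. a j powr r) \<le> S"
  shows "lq_norm q (\<lambda>j. ennreal (a j)) \<le> ennreal (S powr (1 / r))"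
proof -
  have le: "a j \<le> S powr (1 / r)" for j
  proof -
    have "a j powr r \<le> S" using S(2)[of "{j}"] by simp
    then have "(a j powr r) powr (1 / r) \<le> S powr (1 / r)" using r by (intro powr_mono2) auto
    then show ?thesis using r a by (simp add: powr_powr)
  qed
  show ?thesis
  proof (cases "q = \<infinity>")
    case True
    then show ?thesis by (auto simp: lq_norm_def intro!: SUP_least ennreal_leI le)
  next
    case False
    define t where "t = enn2real q"
    have qt: "q = ennreal t" using False by (simp add: t_def less_top)
    have t: "t > 0" "r \<le> t" using q r unfolding qt by (auto simp: ennreal_le_iff2)
    have bnd: "a j powr t \<le> a j powr r * S powr ((t - r) / r)" for j
    proof -
      have "a j powr t = a j powr r * a j powr (t - r)" by (simp flip: powr_add)
      also have "\<dots> \<le> a j powr r * (S powr (1 / r)) powr (t - r)"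
        using t a le by (intro mult_left_mono powr_mono2) auto
      finally show ?thesis by (simp add: powr_powr)
    qed
    have fin: "(\<Sum>j\<in>J. a j powr t) \<le> S powr (t / r)" if "finite J" for J
    proof -
      have "(\<Sum>j\<in>J. a j powr t) \<le> (\<Sum>j\<in>J. a j powr r * S powr ((t - r) / r))" by (intro sum_mono bnd)
      also have "\<dots> \<le> S * S powr ((t - r) / r)"
        unfolding sum_distrib_right[symmetric] by (intro mult_right_mono S(2) that) auto
      also have "\<dots> = S powr 1 * S powr ((t - r) / r)" using S(1) by simp
      also have "\<dots> = S powr (t / r)" using r by (subst powr_add[symmetric]) (simp add: field_simps)
      finally show ?thesis .
    qed
    have "(\<Sum>\<^sub>\<infinity>j\<in>UNIV. epowr (ennreal (a j)) t) \<le> ennreal (S powr (t / r))"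
    proof (subst nonneg_infsum_complete)
      show "(SUP F\<in>{F. finite F \<and> F \<subseteq> UNIV}. \<Sum>j\<in>F. epowr (ennreal (a j)) t) \<le> ennreal (S powr (t / r))"
        using fin by (intro SUP_least) (auto simp: epowr_ennreal a intro!: ennreal_leI)
    qed simp
    then have "epowr (\<Sum>\<^sub>\<infinity>j\<in>UNIV. epowr (ennreal (a j)) t) (1 / t) \<le> epowr (ennreal (S powr (t / r))) (1 / t)"
      using t by (intro epowr_mono) auto
    also have "\<dots> = ennreal (S powr (1 / r))" using t r by (simp add: epowr_ennreal powr_powr)
    finally show ?thesis using False by (simp add: lq_norm_def t_def)
  qed
qed

section \<open>The truncated logarithm\<close>

text \<open>The i-th summand is 1 within distance 2^(k + i) of \<open>a\<close> and 0 beyond twice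
  that distance. The sum therefore counts, up to one transitional term, the scales that exceed
  \<open>norm (x - a)\<close>, which is a logarithm of the distance. For \<open>M = 0\<close> the
  division by zero makes it the zero function.\<close>

definition lbump :: "nat \<Rightarrow> int \<Rightarrow> 'a::euclidean_space \<Rightarrow> 'a \<Rightarrow> complex" where
  "lbump M k a x = (\<Sum>i<M. hat ((2 powi (-(k + int i))) *\<^sub>R (x - a))) / of_nat M"

lemma lbump_continuous: "continuous_on UNIV (lbump M k a)"
  unfolding lbump_def[abs_def]
  by (cases "M = 0") (auto intro!: continuous_intros continuous_on_compose2[OF hat_continuous[of UNIV]])

lemma norm_lbump_le: "norm (lbump M k a x) \<le> 1"
proof -
  have "norm (\<Sum>i<M. hat ((2 powi (-(k + int i))) *\<^sub>R (x - a))) \<le> (\<Sum>i<M. 1)"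
    by (intro order_trans[OF norm_sum] sum_mono norm_hat_le)
  then show ?thesis by (cases "M = 0") (simp_all add: lbump_def norm_divide divide_le_eq_1)
qed

lemma lbump_eq_1:
  assumes "M > 0" "norm (x - a) \<le> 2 powi k"
  shows "lbump M k a x = 1"
proof -
  have "hat ((2 powi (-(k + int i))) *\<^sub>R (x - a)) = 1" for i
  proof (rule hat_eq_1)
    have "norm ((2 powi (-(k + int i))) *\<^sub>R (x - a)) \<le> 2 powi (-(k + int i)) * 2 powi k"
      using assms(2) by simp
    also have "\<dots> = 2 powi (- int i)" by (simp flip: power_int_add)
    also have "\<dots> \<le> 1" by (simp add: power_int_minus inverse_le_1_iff)
    finally show "norm ((2 powi (-(k + int i))) *\<^sub>R (x - a)) \<le> 1" .
  qed
  then show ?thesis using assms(1) by (simp add: lbump_def)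
qed

text \<open>The widest bump has index M - 1 and vanishes from radius 2 * 2^(k + M - 1) = 2^(k + M)
  on.\<close>

lemma lbump_eq_0:
  assumes "norm (x - a) \<ge> 2 powi (k + int M)"
  shows "lbump M k a x = 0"
proof -
  have "hat ((2 powi (-(k + int i))) *\<^sub>R (x - a)) = 0" if "i < M" for i
  proof (rule hat_eq_0)
    have "(2::real) = 2 powi 1" by simp
    also have "\<dots> \<le> 2 powi (int M - int i)" using that by (intro power_int_increasing) auto
    also have "\<dots> = 2 powi (-(k + int i)) * 2 powi (k + int M)" by (simp flip: power_int_add)
    also have "\<dots> \<le> norm ((2 powi (-(k + int i))) *\<^sub>R (x - a))" using assms by simp
    finally show "2 \<le> norm ((2 powi (-(k + int i))) *\<^sub>R (x - a))" .
  qed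
  then show ?thesis by (simp add: lbump_def)
qed

section \<open>Bounded continuous functions in the space\<close>

text \<open>The seminorm is a real supremum and says something only for a bounded family.
  Boundedness holds because there are finitely many lists of basis vectors of length at most
  \<open>N\<close>.\<close>

lemma schwartz_seminorm_ge:
  fixes f :: "'a::euclidean_space \<Rightarrow> complex"
  assumes "f \<in> schwartz"
  shows "(1 + norm x) ^ N * norm (f x) \<le> schwartz_seminorm N f"
proof -
  let ?V = "{vs \<in> lists (Basis :: 'a set). length vs \<le> N}"
  have finV: "finite ?V"
    using finite_lists_length_le[of "Basis :: 'a set" N] by (simp add: lists_eq_set)
  have "\<forall>vs\<in>?V. \<exists>B. \<forall>x. (1 + norm x) ^ N * norm (iter_deriv vs f x) \<le> B"
    using assms unfolding schwartz_def by blast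
  from bchoice[OF this] obtain B where B: "\<forall>vs\<in>?V. \<forall>x. (1 + norm x) ^ N * norm (iter_deriv vs f x) \<le> B vs" by blast
  have "bdd_above ((\<lambda>(vs, x). (1 + norm x) ^ N * norm (iter_deriv vs f x)) ` (?V \<times> UNIV))"
  proof (rule bdd_aboveI2)
    fix z assume "z \<in> ?V \<times> (UNIV :: 'a set)"
    then obtain vs x where z: "z = (vs, x)" "vs \<in> ?V" by auto
    have "(1 + norm x) ^ N * norm (iter_deriv vs f x) \<le> B vs" using B z(2) by blast
    also have "\<dots> \<le> Max (B ` ?V)" using finV z(2) by (intro Max_ge) auto
    finally show "(case z of (vs, x) \<Rightarrow> (1 + norm x) ^ N * norm (iter_deriv vs f x)) \<le> Max (B ` ?V)" by (simp add: z(1))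
  qed
  from cSUP_upper[OF _ this, of "([], x)"] show ?thesis by (simp add: schwartz_seminorm_def)
qed

lemma tempered_regular_distribution:
  fixes f :: "'a::euclidean_space \<Rightarrow> complex"
  assumes [measurable]: "f \<in> borel_measurable borel" and f1: "\<And>x. norm (f x) \<le> 1"
  shows "tempered_distribution (regular_distribution f)"
proof -
  have eq: "regular_distribution f g = (LINT x|lborel. f x * g x)" if [measurable]: "g \<in> borel_measurable borel" for g
    unfolding regular_distribution_def by (intro integral_completion) measurable
  have int: "integrable lborel (\<lambda>x. f x * g x)" if g: "g \<in> schwartz" for g
  proof -
    have [measurable]: "g \<in> borel_measurable borel" by (rule schwartz_measurable[OF g])
    show ?thesis
      by (rule Bochner_Integration.integrable_bound[OF schwartz_integrable[OF g]]) (auto simp: norm_mult mult_left_le_one_le f1)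
  qed
  define p where "p = real DIM('a) + 1"
  have ip: "integrable lborel (\<lambda>x::'a. (1 + norm x) powr (- p))"
    by (rule integrable_radial_powr) (simp add: p_def)
  show ?thesis
    unfolding tempered_distribution_def
  proof (intro conjI ballI allI exI)
    fix g h :: "'a \<Rightarrow> complex" assume gh: "g \<in> schwartz" "h \<in> schwartz"
    note [measurable] = gh[THEN schwartz_measurable]
    show "regular_distribution f (\<lambda>x. g x + h x) = regular_distribution f g + regular_distribution f h"
      using int[OF gh(1)] int[OF gh(2)] by (subst (1 2 3) eq) (auto simp: distrib_left)
  next
    fix c and g :: "'a \<Rightarrow> complex" assume g: "g \<in> schwartz"
    note [measurable] = schwartz_measurable[OF g]
    have "(\<lambda>x. f x * (c * g x)) = (\<lambda>x. c * (f x * g x))" by (simp add: mult_ac)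
    then show "regular_distribution f (\<lambda>x. c * g x) = c * regular_distribution f g"
      by (subst (1 2) eq) auto
  next
    fix g :: "'a \<Rightarrow> complex" assume g: "g \<in> schwartz"
    note [measurable] = schwartz_measurable[OF g]
    let ?S = "schwartz_seminorm (DIM('a) + 1) g"
    have "norm (regular_distribution f g) \<le> (LINT x::'a|lborel. ?S * (1 + norm x) powr (- p))"
      unfolding eq[OF schwartz_measurable[OF g]]
    proof (rule Bochner_Integration.integral_norm_bound_integral)
      show "integrable lborel (\<lambda>x. f x * g x)" by (rule int[OF g])
      show "integrable lborel (\<lambda>x. ?S * (1 + norm (x::'a)) powr (- p))" by (intro integrable_mult_right ip)
      fix x :: 'a
      have x: "1 + norm x > 0" by (simp add: add_pos_nonneg)
      have "(1 + norm x) powr p = (1 + norm x) ^ (DIM('a) + 1)"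
        using x powr_realpow[of "1 + norm x" "DIM('a) + 1"] by (simp add: p_def add.commute)
      have "norm (g x) \<le> ?S * (1 + norm x) powr (- p)"
      proof -
        let ?P = "(1 + norm x) ^ (DIM('a) + 1)"
        have "?P > 0" using x by (rule zero_less_power)
        then have "norm (g x) \<le> ?S / ?P"
          using schwartz_seminorm_ge[OF g, of x "DIM('a) + 1"] by (simp only: pos_le_divide_eq mult.commute)
        also have "\<dots> = ?S * (1 + norm x) powr (- p)"
          unfolding powr_minus_divide \<open>(1 + norm x) powr p = ?P\<close> by (simp only: times_divide_eq_right mult_1_right)
        finally show ?thesis .
      qed
      moreover have "norm (f x * g x) \<le> norm (g x)"
        by (simp add: norm_mult mult_left_le_one_le f1)
      ultimately show "norm (f x * g x) \<le> ?S * (1 + norm x) powr (- p)" by linarith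
    qed
    then show "norm (regular_distribution f g) \<le> (LINT x|lborel. (1 + norm (x::'a)) powr (- p)) * ?S"
      by (simp add: mult.commute)
  qed
qed

lemma bounded_continuous_BMO:
  fixes f :: "'a::euclidean_space \<Rightarrow> complex"
  assumes f: "continuous_on UNIV f" and f1: "\<And>x. norm (f x) \<le> 1"
  shows "f \<in> BMO"
  unfolding BMO_def mem_Collect_eq
proof (intro conjI allI impI exI)
  fix K :: "'a set" assume K: "compact K"
  have "integrable lborel (\<lambda>x. indicator K x *\<^sub>R f x)"
    by (intro borel_integrable_compact K continuous_on_subset[OF f]) auto
  then show "f absolutely_integrable_on K"
    unfolding set_integrable_def by (subst integrable_completion) auto
next
  have [measurable]: "f \<in> borel_measurable borel" by (rule borel_measurable_continuous_onI[OF f])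
  fix x :: 'a and r :: real assume r: "r > 0"
  let ?m = "measure lebesgue (ball x r)"
  have m: "?m > 0" using content_ball_pos[OF r, of x] by simp
  have fin: "emeasure lebesgue (ball x r) < \<infinity>" using emeasure_lborel_ball_finite[of x r] by simp
  \<comment> \<open>Stated for a general value type, as it serves the complex average as well as the
    real mean oscillation. A non-integrable function has integral 0, so the bound holds for it
    too.\<close>
  have bound: "norm (LINT y:ball x r|lebesgue. h y) \<le> A * ?m"
    if "\<And>y. norm (h y) \<le> A" "A \<ge> 0" for A and h :: "'a \<Rightarrow> 'b::{banach, second_countable_topology}"
  proof (cases "set_integrable lebesgue (ball x r) h")
    case True
    have "norm (LINT y:ball x r|lebesgue. h y) \<le> (LINT y|lebesgue. A * indicator (ball x r) y)"
      unfolding set_lebesgue_integral_def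
    proof (rule Bochner_Integration.integral_norm_bound_integral)
      show "integrable lebesgue (\<lambda>y. indicator (ball x r) y *\<^sub>R h y)" using True by (simp add: set_integrable_def)
      show "integrable lebesgue (\<lambda>y. A * indicator (ball x r) y)"
        using fin by (intro integrable_mult_right integrable_real_indicator) auto
      show "norm (indicator (ball x r) y *\<^sub>R h y) \<le> A * indicator (ball x r) y" for y
        using that by (simp add: indicator_def)
    qed
    then show ?thesis by simp
  next
    case False
    then show ?thesis using that m
      by (simp add: set_lebesgue_integral_def set_integrable_def not_integrable_integral_eq)
  qed
  have av: "norm (ball_average f x r) \<le> 1"
    using bound[of f 1] f1 m by (simp add: ball_average_def norm_divide)
  have "norm (LINT y:ball x r|lebesgue. norm (f y - ball_average f x r)) \<le> 2 * ?m"
  proof (rule bound)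
    fix y show "norm (norm (f y - ball_average f x r)) \<le> 2"
      using norm_triangle_ineq4[of "f y" "ball_average f x r"] f1[of y] av by simp
  qed simp
  then show "(LINT y:ball x r|lebesgue. norm (f y - ball_average f x r)) / ?m \<le> 2"
    using m by (simp add: divide_le_eq)
qed

text \<open>Dilating a bump by 2^(k + i) shifts the scale by k + i. Scale j therefore interacts with
  bump i as scale j + k + i interacts with \<open>hat\<close>, that is, mainly when j + k + i is
  near 0.\<close>

lemma dconv_lbump:
  fixes \<psi> :: "'a::euclidean_space \<Rightarrow> complex"
  assumes "integrable lborel \<psi>"
  shows "dconv \<psi> j (lbump M k a) x =
    (\<Sum>i<M. dconv \<psi> (j + k + int i) hat ((2 powi (-(k + int i))) *\<^sub>R (x - a))) / of_nat M"
proof -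
  let ?h = "\<lambda>i v. \<psi> v * hat ((2 powi (-(k + int i))) *\<^sub>R (x - a) - (2 powi (-(j + k + int i))) *\<^sub>R v)"
  have arg: "(2 powi (-(k + int i))) *\<^sub>R (x - (2 powi (-j)) *\<^sub>R v - a) =
     (2 powi (-(k + int i))) *\<^sub>R (x - a) - (2 powi (-(j + k + int i))) *\<^sub>R v" for i and v :: 'a
  proof -
    have "(2::real) powi (-(k + int i)) * 2 powi (-j) = 2 powi (-(j + k + int i))"
      by (subst power_int_add[symmetric]) (auto simp: algebra_simps)
    then show ?thesis by (simp add: scaleR_right_diff_distrib)
  qed
  have "dconv \<psi> j (lbump M k a) x = (LINT v|lborel. (\<Sum>i<M. ?h i v) / of_nat M)"
    unfolding dconv_def lbump_def arg by (simp add: sum_distrib_left)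
  also have "\<dots> = (LINT v|lborel. (\<Sum>i<M. ?h i v)) / of_nat M" by (rule integral_divide_zero)
  also have "(LINT v|lborel. (\<Sum>i<M. ?h i v)) = (\<Sum>i<M. (LINT v|lborel. ?h i v))"
    by (intro Bochner_Integration.integral_sum dconv_integrable[OF assms hat_measurable norm_hat_le])
  finally show ?thesis by (simp add: dconv_def)
qed

text \<open>The sequence \<open>t\<close> below increases geometrically up to the scale \<open>2^l \<approx> d\<close> and
  decreases geometrically afterwards, so any \<open>\<ell>\<^sup>r\<close> sum is comparable to any upper bound \<open>T\<close>
  of its terms.\<close>

lemma bump_scale_sum:
  fixes d s r T :: real and k :: int
  assumes s: "0 < s" "s < 1" and r: "r > 0" and d: "d \<ge> 0"
    and t: "\<And>i. t i = 2 powr (- (of_int (k + int i) * s)) / (1 + 2 powi (-(k + int i)) * d)"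
    and T: "\<And>i. i < M \<Longrightarrow> t i \<le> T"
    and z: "z = 2 powr (- (min s (1 - s) * r))"
  shows "(\<Sum>i<M. t i powr r) \<le> 4 / (1 - z) * (2 * T) powr r"
proof (cases "M = 0")
  case True
  have "z < 1" using s r powr_less_mono[of "- (min s (1 - s) * r)" 0 2] by (auto simp: z)
  then show ?thesis using True by simp
next
  case False
  have pos: "t i > 0" for i unfolding t using d by (intro divide_pos_pos add_pos_nonneg) auto
  have T0: "T > 0" using T[of 0] pos[of 0] False by simp
  have z01: "0 < z" "z < 1" using s r powr_less_mono[of "- (min s (1 - s) * r)" 0 2] by (auto simp: z)
  define l where "l i = k + int i" for i
  have q: "2 powi (-(l i)) = (2::real) powr (- of_int (l i))" for i
    by (simp add: two_powi_eq_powr)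
  \<comment> \<open>The rate is s on one half of the scales and 1 - s on the other; \<open>z\<close>
    belongs to the slower of the two and serves both.\<close>
  have step: "t i powr r \<le> (2 * T) powr r * z ^ nat \<bar>int i - int i'\<bar>"
    if "t i \<le> 2 * t i' * 2 powr (- (\<sigma> * \<bar>real i - real i'\<bar>))" "i' < M" "\<sigma> \<ge> min s (1 - s)" for i i' \<sigma>
  proof -
    have "t i \<le> 2 * T * 2 powr (- (min s (1 - s) * \<bar>real i - real i'\<bar>))"
    proof (rule order_trans[OF that(1)], rule mult_mono)
      show "2 powr (- (\<sigma> * \<bar>real i - real i'\<bar>)) \<le> (2::real) powr (- (min s (1 - s) * \<bar>real i - real i'\<bar>))"
        using that(3) by (intro powr_mono) (auto intro: mult_right_mono)
    qed (use T[OF that(2)] T0 in auto)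
    then have "t i powr r \<le> (2 * T * 2 powr (- (min s (1 - s) * \<bar>real i - real i'\<bar>))) powr r"
      using r pos[of i] by (intro powr_mono2) auto
    also have "\<dots> = (2 * T) powr r * (2 powr (- (min s (1 - s) * \<bar>real i - real i'\<bar>))) powr r"
      using T0 by (subst powr_mult) auto
    also have "(2 powr (- (min s (1 - s) * \<bar>real i - real i'\<bar>))) powr r = z ^ nat \<bar>int i - int i'\<bar>"
    proof -
      have "real (nat \<bar>int i - int i'\<bar>) = \<bar>real i - real i'\<bar>" by simp
      then show ?thesis unfolding z by (simp add: powr_powr powr_power mult_ac)
    qed
    finally show ?thesis .
  qed
  have geo: "(\<Sum>i\<in>S. z ^ nat \<bar>int i - int i'\<bar>) \<le> 2 / (1 - z)" if "S \<subseteq> {..<M}" for S i'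
  proof -
    have "(\<Sum>i\<in>S. z ^ nat \<bar>int i - int i'\<bar>) = (\<Sum>j\<in>int ` S. z ^ nat \<bar>j + (- int i')\<bar>)"
      by (subst sum.reindex) auto
    also have "\<dots> \<le> 2 / (1 - z)"
      using z01 finite_subset[OF that] by (intro sum_int_geometric_le) auto
    finally show ?thesis .
  qed
  have part: "(\<Sum>i\<in>S. t i powr r) \<le> 2 / (1 - z) * (2 * T) powr r"
    if S: "S \<subseteq> {..<M}" "S \<noteq> {} \<Longrightarrow> \<exists>i'\<in>S. \<exists>\<sigma>\<ge>min s (1 - s). \<forall>i\<in>S. t i \<le> 2 * t i' * 2 powr (- (\<sigma> * \<bar>real i - real i'\<bar>))" for S
  proof (cases "S = {}")
    case True
    then show ?thesis using z01 by simp
  next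
    case False
    obtain i' \<sigma> where i': "i' \<in> S" "\<sigma> \<ge> min s (1 - s)" "\<forall>i\<in>S. t i \<le> 2 * t i' * 2 powr (- (\<sigma> * \<bar>real i - real i'\<bar>))"
      using S(2)[OF False] by blast
    have "(\<Sum>i\<in>S. t i powr r) \<le> (\<Sum>i\<in>S. (2 * T) powr r * z ^ nat \<bar>int i - int i'\<bar>)"
      using i' S(1) by (intro sum_mono step) auto
    also have "\<dots> = (2 * T) powr r * (\<Sum>i\<in>S. z ^ nat \<bar>int i - int i'\<bar>)" by (rule sum_distrib_left[symmetric])
    also have "\<dots> \<le> (2 * T) powr r * (2 / (1 - z))" by (intro mult_left_mono geo S(1)) auto
    finally show ?thesis by (simp only: mult.commute)
  qed
  \<comment> \<open>On \<open>S1\<close> the denominator of \<open>t i\<close> lies between 1 and 2,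
    so \<open>t i\<close> is about 2^(-ls) and essentially largest at the first index. On
    \<open>S2\<close> it is about 2^(l (1 - s)) / d and essentially largest at the last index. These
    indices are the peaks from which the geometric decay is measured.\<close>
  define S1 where "S1 = {i. i < M \<and> 2 powi (-(l i)) * d \<le> 1}"
  define S2 where "S2 = {i. i < M \<and> \<not> 2 powi (-(l i)) * d \<le> 1}"
  have t': "t i = 2 powr (- (of_int (l i) * s)) / (1 + 2 powi (-(l i)) * d)" for i
    unfolding t l_def ..
  have c: "2 powi (-(l i)) * d \<ge> 0" for i using d by simp
  have "(\<Sum>i\<in>S1. t i powr r) \<le> 2 / (1 - z) * (2 * T) powr r"
  proof (rule part)
    assume ne: "S1 \<noteq> {}"
    have fin: "finite S1" by (simp add: S1_def)
    define i' where "i' = Min S1"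
    have i': "i' \<in> S1" unfolding i'_def using Min_in[OF fin ne] .
    have "t i \<le> 2 * t i' * 2 powr (- (s * \<bar>real i - real i'\<bar>))" if "i \<in> S1" for i
    proof -
      have "i' \<le> i" unfolding i'_def using fin that by (rule Min_le)
      have up: "t i \<le> 2 powr (- (of_int (l i) * s))"
      proof -
        have "2 powr (- (of_int (l i) * s)) / (1 + 2 powi (-(l i)) * d) \<le> 2 powr (- (of_int (l i) * s)) / 1"
          using c[of i] by (intro divide_left_mono) auto
        then show ?thesis unfolding t' by simp
      qed
      have low: "2 powr (- (of_int (l i') * s)) \<le> 2 * t i'"
        unfolding t' using i' c[of i'] by (simp add: S1_def field_simps)
      have "2 powr (- (of_int (l i) * s)) = 2 powr (- (of_int (l i') * s)) * 2 powr (- (s * \<bar>real i - real i'\<bar>))"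
        using \<open>i' \<le> i\<close> by (subst powr_add[symmetric]) (simp add: l_def algebra_simps)
      also have "\<dots> \<le> 2 * t i' * 2 powr (- (s * \<bar>real i - real i'\<bar>))" by (intro mult_right_mono low) simp
      finally show ?thesis using up by linarith
    qed
    then show "\<exists>i'\<in>S1. \<exists>\<sigma>\<ge>min s (1 - s). \<forall>i\<in>S1. t i \<le> 2 * t i' * 2 powr (- (\<sigma> * \<bar>real i - real i'\<bar>))"
      using i' by (intro bexI[of _ i'] exI[of _ s]) auto
  qed (auto simp: S1_def)
  moreover have "(\<Sum>i\<in>S2. t i powr r) \<le> 2 / (1 - z) * (2 * T) powr r"
  proof (rule part)
    assume ne: "S2 \<noteq> {}"
    have fin: "finite S2" by (simp add: S2_def)
    define i' where "i' = Max S2"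
    have i': "i' \<in> S2" unfolding i'_def using Max_in[OF fin ne] .
    have d0: "d > 0" using i' d by (cases "d = 0") (auto simp: S2_def)
    have pw: "2 powr (- (of_int (l i) * s)) / (2 powi (-(l i)) * d) = 2 powr (of_int (l i) * (1 - s)) / d" for i
    proof -
      have "2 powr (- (of_int (l i) * s)) / 2 powi (-(l i)) = (2::real) powr (of_int (l i) * (1 - s))"
        unfolding q powr_diff[symmetric] by (simp add: algebra_simps)
      then show ?thesis by (metis divide_divide_eq_left)
    qed
    have "t i \<le> 2 * t i' * 2 powr (- ((1 - s) * \<bar>real i - real i'\<bar>))" if "i \<in> S2" for i
    proof -
      have "i \<le> i'" unfolding i'_def using fin that by (rule Max_ge)
      have ci: "2 powi (-(l i)) * d > 1" using that by (auto simp: S2_def)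
      have ci': "2 powi (-(l i')) * d > 1" using i' by (auto simp: S2_def)
      have up: "t i \<le> 2 powr (of_int (l i) * (1 - s)) / d"
        unfolding t' pw[symmetric] using ci d0 by (intro divide_left_mono mult_pos_pos) auto
      have low: "2 powr (of_int (l i') * (1 - s)) / d \<le> 2 * t i'"
      proof -
        have "2 powr (- (of_int (l i') * s)) / (2 powi (-(l i')) * d) \<le> 2 powr (- (of_int (l i') * s)) / ((1 + 2 powi (-(l i')) * d) / 2)"
        proof (intro divide_left_mono mult_pos_pos)
          show "(1 + 2 powi (-(l i')) * d) / 2 \<le> 2 powi (-(l i')) * d"
          proof -
            have "(1 + X) / 2 \<le> X" if "1 < X" for X :: real using that by simp
            from this[OF ci'] show ?thesis .
          qed
        qed (use ci' d0 in auto)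
        then show ?thesis unfolding t' pw[symmetric] by (simp add: mult.commute)
      qed
      have "2 powr (of_int (l i) * (1 - s)) / d = (2 powr (of_int (l i') * (1 - s)) / d) * 2 powr (- ((1 - s) * \<bar>real i - real i'\<bar>))"
      proof -
        have "2 powr (of_int (l i) * (1 - s)) = (2::real) powr (of_int (l i') * (1 - s)) * 2 powr (- ((1 - s) * \<bar>real i - real i'\<bar>))"
          using \<open>i \<le> i'\<close> by (subst powr_add[symmetric]) (simp add: l_def algebra_simps)
        then show ?thesis by simp
      qed
      also have "\<dots> \<le> 2 * t i' * 2 powr (- ((1 - s) * \<bar>real i - real i'\<bar>))" by (intro mult_right_mono low) simp
      finally show ?thesis using up by linarith
    qed
    then show "\<exists>i'\<in>S2. \<exists>\<sigma>\<ge>min s (1 - s). \<forall>i\<in>S2. t i \<le> 2 * t i' * 2 powr (- (\<sigma> * \<bar>real i - real i'\<bar>))"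
      using i' by (intro bexI[of _ i'] exI[of _ "1 - s"]) auto
  qed (auto simp: S2_def)
  moreover have "(\<Sum>i<M. t i powr r) = (\<Sum>i\<in>S1. t i powr r) + (\<Sum>i\<in>S2. t i powr r)"
    by (subst sum.union_disjoint[symmetric]) (auto simp: S1_def S2_def intro!: sum.cong)
  ultimately show ?thesis by simp
qed

text \<open>At x the j-th weighted term is at most (Ch / M) times the sum over i of 2^(-\<epsilon>
  |j + k + i|) \<open>t x i\<close>. In the l^r norm over j the exponential factors sum to a
  constant, and \<open>bump_scale_sum\<close> bounds what remains by a multiple of
  \<open>T x\<close>, so the l^q norm is at most a constant times \<open>T x / M\<close>. The
  integral of \<open>t x i powr p\<close> is the same number for every i; the L^p norm of
  \<open>T\<close> is therefore M^(1/p) times a constant.\<close>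

lemma TL_norm_lbump:
  fixes \<psi> :: "'a::euclidean_space \<Rightarrow> complex"
  assumes gen: "TL_generator \<psi>" and dim: "DIM('a) \<ge> 2" and s: "0 < s" "s < 1" and q: "q > 0"
  obtains C where "C \<ge> 0"
    "\<And>M k a. M > 0 \<Longrightarrow> TL_norm \<psi> s (real DIM('a) / s) q (regular_distribution (lbump M k a)) \<le>
       ennreal (C * real M powr (s / real DIM('a) - 1))"
proof -
  define p where "p = real DIM('a) / s"
  have sp: "s * p = real DIM('a)" using s by (simp add: p_def)
  have p: "p > real DIM('a)" using s dim by (simp add: p_def field_simps)
  have p0: "p > 0" using p by linarith
  have sch: "\<psi> \<in> schwartz" using gen by (simp add: TL_generator_def)
  have \<psi>m[measurable]: "\<psi> \<in> borel_measurable borel" by (rule schwartz_measurable[OF sch])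
  have i\<psi>: "integrable lborel \<psi>"
    by (rule schwartz_integrable[OF sch])
  obtain Ch where Ch: "Ch \<ge> 0"
    "\<And>m y. (1 + norm y) * norm (dconv \<psi> m hat y) \<le> Ch * min 1 (2 powi (-m))"
    using hat_estimate[OF gen dim] by metis
  \<comment> \<open>At most 1, so that r-th powers are subadditive, and at most \<open>q\<close>,
    for the embedding in \<open>lq_norm_le\<close>.\<close>
  define r where "r = (if q = \<infinity> then 1 else min 1 (enn2real q))"
  have r: "0 < r" "r \<le> 1" "ennreal r \<le> q"
  proof -
    show "0 < r" using q by (auto simp: r_def enn2real_positive_iff less_top)
    show "r \<le> 1" by (auto simp: r_def)
    show "ennreal r \<le> q"
    proof (cases "q = \<infinity>")
      case False
      then have "q = ennreal (enn2real q)" by (simp add: less_top)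
      moreover have "ennreal r \<le> ennreal (enn2real q)" using False by (intro ennreal_leI) (auto simp: r_def)
      ultimately show ?thesis by metis
    qed simp
  qed
  \<comment> \<open>For m \<ge> 0 the weight 2^(ms) against 2^(-m) leaves the rate 1 - s; for m < 0
    the weight alone decays at rate s.\<close>
  define \<epsilon> where "\<epsilon> = min s (1 - s)"
  define z where "z = 2 powr (- (\<epsilon> * r))"
  have z: "0 < z" "z < 1" using s r powr_less_mono[of "- (\<epsilon> * r)" 0 2] by (auto simp: z_def \<epsilon>_def)
  have est: "2 powr (of_int m * s) * norm (dconv \<psi> m hat y) \<le> Ch * 2 powr (- (\<epsilon> * \<bar>of_int m\<bar>)) / (1 + norm y)" for m y
  proof -
    have y: "1 + norm y > 0" by (simp add: add_pos_nonneg)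
    have "2 powr (of_int m * s) * min 1 (2 powi (-m)) \<le> 2 powr (- (\<epsilon> * \<bar>of_int m\<bar>))"
    proof (cases "m \<ge> 0")
      case True
      have "2 powi (-m) = (2::real) powr (- of_int m)" by (simp add: two_powi_eq_powr)
      then have "2 powr (of_int m * s) * min 1 (2 powi (-m)) \<le> 2 powr (of_int m * s) * 2 powr (- of_int m)"
        by (intro mult_left_mono) auto
      also have "\<dots> = 2 powr (- ((1 - s) * \<bar>of_int m\<bar>))"
        using True by (subst powr_add[symmetric]) (simp add: algebra_simps)
      also have "\<dots> \<le> 2 powr (- (\<epsilon> * \<bar>of_int m\<bar>))"
        by (intro powr_mono) (auto simp: \<epsilon>_def intro!: mult_right_mono)
      finally show ?thesis .
    next
      case False
      have "2 powr (of_int m * s) * min 1 (2 powi (-m)) \<le> 2 powr (of_int m * s) * (1::real)"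
        by (intro mult_left_mono) auto
      also have "\<dots> = 2 powr (- (s * \<bar>of_int m\<bar>))" using False by (simp add: mult.commute)
      also have "\<dots> \<le> 2 powr (- (\<epsilon> * \<bar>of_int m\<bar>))"
        by (intro powr_mono) (auto simp: \<epsilon>_def intro!: mult_right_mono)
      finally show ?thesis .
    qed
    then have "Ch * (2 powr (of_int m * s) * min 1 (2 powi (-m))) \<le> Ch * 2 powr (- (\<epsilon> * \<bar>of_int m\<bar>))"
      by (intro mult_left_mono Ch(1))
    moreover have "2 powr (of_int m * s) * ((1 + norm y) * norm (dconv \<psi> m hat y)) \<le> 2 powr (of_int m * s) * (Ch * min 1 (2 powi (-m)))"
      by (intro mult_left_mono Ch(2)) auto
    ultimately have "(2 powr (of_int m * s) * norm (dconv \<psi> m hat y)) * (1 + norm y) \<le> Ch * 2 powr (- (\<epsilon> * \<bar>of_int m\<bar>))"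
      by (simp only: mult_ac)
    then show ?thesis using y by (simp only: pos_le_divide_eq)
  qed
  define I where "I = (LINT y::'a|lborel. (1 + norm y) powr (- p))"
  have iI: "integrable lborel (\<lambda>y::'a. (1 + norm y) powr (- p))" by (rule integrable_radial_powr[OF p])
  have I0: "I \<ge> 0" by (simp add: I_def)
  define G where "G = (2 / (1 - z) * (4 / (1 - z))) powr (1 / r)"
  have G0: "G \<ge> 0" by (simp add: G_def)
  define C where "C = 2 * Ch * G * I powr (1 / p)"
  show ?thesis
  proof (rule that[of C])
    show "C \<ge> 0" using Ch(1) G0 by (simp add: C_def)
    fix M :: nat and k :: int and a :: 'a assume M: "M > 0"
    let ?f = "lbump M k a"
    have fm: "?f \<in> borel_measurable borel" by (intro borel_measurable_continuous_onI lbump_continuous)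
    define t where "t x i = 2 powr (- (of_int (k + int i) * s)) / (1 + 2 powi (-(k + int i)) * norm (x - a))" for x :: 'a and i
    have t0: "t x i \<ge> 0" for x i unfolding t_def by (intro divide_nonneg_nonneg add_nonneg_nonneg) auto
    \<comment> \<open>An upper bound for the \<open>t x i\<close> which, unlike their maximum, has a
      p-th power that is integrated term by term.\<close>
    define T where "T x = (\<Sum>i<M. t x i powr p) powr (1 / p)" for x
    have T0: "T x \<ge> 0" for x by (simp add: T_def)
    have tT: "t x i \<le> T x" if "i < M" for x i
    proof -
      have "(t x i powr p) powr (1 / p) \<le> T x"
        unfolding T_def using that p0 by (intro powr_mono2 member_le_sum) auto
      then show ?thesis using t0 p0 by (simp add: powr_powr)
    qed
    define b where "b j x = 2 powr (of_int j * s) * norm (dconv \<psi> j ?f x)" for j x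
    have b0: "b j x \<ge> 0" for j x by (simp add: b_def)
    have b: "b j x \<le> (\<Sum>i<M. Ch / real M * (2 powr (- (\<epsilon> * \<bar>of_int (j + (k + int i))\<bar>)) * t x i))" for j x
    proof -
      have "b j x \<le> 2 powr (of_int j * s) * ((\<Sum>i<M. norm (dconv \<psi> (j + k + int i) hat ((2 powi (-(k + int i))) *\<^sub>R (x - a)))) / real M)"
        unfolding b_def dconv_lbump[OF i\<psi>] norm_divide norm_of_nat
        by (intro mult_left_mono divide_right_mono norm_sum) auto
      also have "\<dots> = (\<Sum>i<M. 2 powr (of_int j * s) * norm (dconv \<psi> (j + k + int i) hat ((2 powi (-(k + int i))) *\<^sub>R (x - a))) / real M)"
        by (simp add: sum_distrib_left sum_divide_distrib)
      also have "\<dots> \<le> (\<Sum>i<M. Ch / real M * (2 powr (- (\<epsilon> * \<bar>of_int (j + (k + int i))\<bar>)) * t x i))"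
      proof (intro sum_mono)
        fix i
        let ?m = "j + (k + int i)" and ?y = "(2 powi (-(k + int i))) *\<^sub>R (x - a)"
        have ny: "norm ?y = 2 powi (-(k + int i)) * norm (x - a)" by simp
        have sp: "2 powr (of_int j * s) = 2 powr (- (of_int (k + int i) * s)) * 2 powr (of_int ?m * s)"
          by (subst powr_add[symmetric]) (simp add: algebra_simps)
        have "2 powr (of_int j * s) * norm (dconv \<psi> ?m hat ?y) \<le> 2 powr (- (of_int (k + int i) * s)) * (Ch * 2 powr (- (\<epsilon> * \<bar>of_int ?m\<bar>)) / (1 + norm ?y))"
          unfolding sp mult.assoc by (intro mult_left_mono est) auto
        also have "\<dots> = Ch * (2 powr (- (\<epsilon> * \<bar>of_int ?m\<bar>)) * t x i)"
          unfolding t_def ny by (simp only: times_divide_eq_right mult_ac)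
        finally have "2 powr (of_int j * s) * norm (dconv \<psi> ?m hat ?y) / real M \<le> Ch * (2 powr (- (\<epsilon> * \<bar>of_int ?m\<bar>)) * t x i) / real M"
          by (rule divide_right_mono) simp
        then show "2 powr (of_int j * s) * norm (dconv \<psi> (j + k + int i) hat ?y) / real M \<le> Ch / real M * (2 powr (- (\<epsilon> * \<bar>of_int ?m\<bar>)) * t x i)"
          by (simp only: add.assoc times_divide_eq_left)
      qed
      finally show ?thesis .
    qed
    have lq: "lq_norm q (\<lambda>j. ennreal (b j x)) \<le> ennreal (2 * Ch * G / real M * T x)" for x
    proof -
      define S where "S = (Ch / real M) powr r * (2 / (1 - z)) * (4 / (1 - z) * (2 * T x) powr r)"
      have "lq_norm q (\<lambda>j. ennreal (b j x)) \<le> ennreal (S powr (1 / r))"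
      proof (rule lq_norm_le[OF q r(1,3) b0])
        show "S \<ge> 0" unfolding S_def using z by (intro mult_nonneg_nonneg) auto
        fix J :: "int set" assume J: "finite J"
        have "(\<Sum>j\<in>J. b j x powr r) \<le> (\<Sum>j\<in>J. \<Sum>i<M. (Ch / real M) powr r * (z ^ nat \<bar>j + (k + int i)\<bar> * t x i powr r))"
        proof (rule sum_mono)
          fix j
          have "b j x powr r \<le> (\<Sum>i<M. Ch / real M * (2 powr (- (\<epsilon> * \<bar>of_int (j + (k + int i))\<bar>)) * t x i)) powr r"
            using r b0 b by (intro powr_mono2) auto
          also have "\<dots> \<le> (\<Sum>i<M. (Ch / real M * (2 powr (- (\<epsilon> * \<bar>of_int (j + (k + int i))\<bar>)) * t x i)) powr r)"
            using r Ch(1) t0 by (intro powr_sum_le_sum_powr) auto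
          also have "\<dots> = (\<Sum>i<M. (Ch / real M) powr r * (z ^ nat \<bar>j + (k + int i)\<bar> * t x i powr r))"
          proof (intro sum.cong refl)
            fix i
            have "(2 powr (- (\<epsilon> * \<bar>of_int (j + (k + int i))\<bar>))) powr r = z ^ nat \<bar>j + (k + int i)\<bar>"
            proof -
              have "real (nat \<bar>j + (k + int i)\<bar>) = \<bar>of_int (j + (k + int i))\<bar>" by simp
              then show ?thesis by (simp add: z_def powr_powr powr_power mult_ac)
            qed
            then show "(Ch / real M * (2 powr (- (\<epsilon> * \<bar>of_int (j + (k + int i))\<bar>)) * t x i)) powr r = (Ch / real M) powr r * (z ^ nat \<bar>j + (k + int i)\<bar> * t x i powr r)"
              using Ch(1) t0 by (subst powr_mult; (subst powr_mult)?) auto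
          qed
          finally show "b j x powr r \<le> \<dots>" .
        qed
        also have "\<dots> = (\<Sum>i<M. (Ch / real M) powr r * (\<Sum>j\<in>J. z ^ nat \<bar>j + (k + int i)\<bar>) * t x i powr r)"
          by (subst sum.swap) (simp only: sum_distrib_left sum_distrib_right mult.assoc)
        also have "\<dots> \<le> (\<Sum>i<M. (Ch / real M) powr r * (2 / (1 - z)) * t x i powr r)"
          using z by (intro sum_mono mult_right_mono mult_left_mono sum_int_geometric_le J) auto
        also have "\<dots> = (Ch / real M) powr r * (2 / (1 - z)) * (\<Sum>i<M. t x i powr r)" by (rule sum_distrib_left[symmetric])
        also have "\<dots> \<le> S"
          unfolding S_def
          using z tT by (intro mult_left_mono bump_scale_sum[OF s r(1) norm_ge_zero[of "x - a"]])
            (auto simp: t_def z_def \<epsilon>_def)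
        finally show "(\<Sum>j\<in>J. b j x powr r) \<le> S" .
      qed
      also have "S powr (1 / r) = 2 * Ch * G / real M * T x"
      proof -
        have S: "S = (Ch / real M) powr r * ((2 / (1 - z) * (4 / (1 - z))) * (2 * T x) powr r)" by (simp only: S_def mult.assoc)
        have nn: "2 / (1 - z) * (4 / (1 - z)) \<ge> 0" using z by (intro mult_nonneg_nonneg) auto
        have "S powr (1 / r) = ((Ch / real M) powr r) powr (1 / r) * (G * ((2 * T x) powr r) powr (1 / r))"
          unfolding S G_def using nn by (subst powr_mult; (subst powr_mult)?) auto
        also have "\<dots> = Ch / real M * (G * (2 * T x))"
          using r(1) Ch(1) T0[of x] by (simp add: powr_powr)
        finally show ?thesis by simp
      qed
      finally show ?thesis .
    qed
    let ?K = "(2 * Ch * G / real M) powr p"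
    have K0: "2 * Ch * G / real M \<ge> 0" using Ch(1) G0 by simp
    \<comment> \<open>Substituting x = a + 2^(k + i) y, the Jacobian cancels the p-th power of the
      weight because \<open>s * p = n\<close>: all bumps have the same size, whatever their
      width.\<close>
    have int_t: "(\<integral>\<^sup>+x. ennreal (t x i powr p) \<partial>lborel) = ennreal I" for i
    proof -
      let ?c = "2 powi (k + int i) :: real"
      have "(\<integral>\<^sup>+x. ennreal (t x i powr p) \<partial>lborel) = ennreal (\<bar>?c\<bar> ^ DIM('a)) * (\<integral>\<^sup>+y. ennreal (t (a + ?c *\<^sub>R y) i powr p) \<partial>lborel)"
        unfolding t_def by (intro nn_integral_lborel_affine) auto
      also have "\<dots> = (\<integral>\<^sup>+y. ennreal (\<bar>?c\<bar> ^ DIM('a)) * ennreal (t (a + ?c *\<^sub>R y) i powr p) \<partial>lborel)"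
        by (intro nn_integral_cmult[symmetric]) (simp add: t_def)
      also have "\<dots> = (\<integral>\<^sup>+y. ennreal ((1 + norm (y::'a)) powr (- p)) \<partial>lborel)"
      proof (rule nn_integral_cong)
        fix y :: 'a
        have cc: "2 powi (-(k + int i)) * ?c = 1" by (simp flip: power_int_add)
        have "2 powi (-(k + int i)) * norm (a + ?c *\<^sub>R y - a) = (2 powi (-(k + int i)) * ?c) * norm y" by simp
        then have ty: "t (a + ?c *\<^sub>R y) i = 2 powr (- (of_int (k + int i) * s)) / (1 + norm y)"
          unfolding t_def cc by simp
        have c1: "\<bar>?c\<bar> ^ DIM('a) = 2 powr (of_int (k + int i) * real DIM('a))"
          by (simp add: two_powi_eq_powr powr_power mult.commute)
        have ex: "- (of_int (k + int i) * s) * p = - (of_int (k + int i) * real DIM('a))"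
          unfolding sp[symmetric] by (simp only: mult.assoc mult_minus_left)
        have "t (a + ?c *\<^sub>R y) i powr p = 2 powr (- (of_int (k + int i) * real DIM('a))) * (1 + norm y) powr (- p)"
        proof -
          have "t (a + ?c *\<^sub>R y) i powr p = (2 powr (- (of_int (k + int i) * s))) powr p / (1 + norm y) powr p"
            unfolding ty by (subst powr_divide) auto
          then show ?thesis
            unfolding powr_powr ex powr_minus_divide[of "1 + norm y"] by (simp only: times_divide_eq_right mult_1_right)
        qed
        then have "\<bar>?c\<bar> ^ DIM('a) * t (a + ?c *\<^sub>R y) i powr p = (1 + norm y) powr (- p)"
          unfolding c1 by (simp flip: powr_add add: mult.assoc[symmetric] del: of_int_add)
        then show "ennreal (\<bar>?c\<bar> ^ DIM('a)) * ennreal (t (a + ?c *\<^sub>R y) i powr p) = ennreal ((1 + norm y) powr (- p))"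
          by (subst ennreal_mult[symmetric]) auto
      qed
      also have "\<dots> = ennreal I"
        unfolding I_def by (intro nn_integral_eq_integral iI) auto
      finally show ?thesis .
    qed
    have "TL_norm \<psi> s p q (regular_distribution ?f) = epowr (\<integral>\<^sup>+x. epowr (lq_norm q (\<lambda>j. ennreal (b j x))) p \<partial>lebesgue) (1 / p)"
      unfolding regular_TL_norm[OF \<psi>m fm] Lp_norm_def b_def ..
    also have "\<dots> \<le> epowr (\<integral>\<^sup>+x. (\<Sum>i<M. ennreal ?K * ennreal (t x i powr p)) \<partial>lebesgue) (1 / p)"
    proof (intro epowr_mono nn_integral_mono)
      fix x :: 'a
      have "epowr (lq_norm q (\<lambda>j. ennreal (b j x))) p \<le> epowr (ennreal (2 * Ch * G / real M * T x)) p"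
        by (intro epowr_mono lq p0)
      also have "\<dots> = ennreal ((2 * Ch * G / real M * T x) powr p)"
        using K0 T0 by (intro epowr_ennreal mult_nonneg_nonneg)
      also have "(2 * Ch * G / real M * T x) powr p = ?K * (\<Sum>i<M. t x i powr p)"
      proof -
        have "T x powr p = (\<Sum>i<M. t x i powr p)"
          unfolding T_def using p0 by (simp add: powr_powr sum_nonneg)
        then show ?thesis using K0 T0 by (subst powr_mult) auto
      qed
      also have "ennreal (?K * (\<Sum>i<M. t x i powr p)) = (\<Sum>i<M. ennreal (?K * t x i powr p))"
        unfolding sum_distrib_left by (intro sum_ennreal[symmetric]) auto
      also have "\<dots> = (\<Sum>i<M. ennreal ?K * ennreal (t x i powr p))"
        by (intro sum.cong refl ennreal_mult) auto
      finally show "epowr (lq_norm q (\<lambda>j. ennreal (b j x))) p \<le> (\<Sum>i<M. ennreal ?K * ennreal (t x i powr p))" .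
    qed (use p0 in simp)
    also have "(\<integral>\<^sup>+x. (\<Sum>i<M. ennreal ?K * ennreal (t x i powr p)) \<partial>lebesgue) = (\<Sum>i<M. ennreal ?K * ennreal I)"
    proof -
      have "(\<integral>\<^sup>+x. (\<Sum>i<M. ennreal ?K * ennreal (t x i powr p)) \<partial>lebesgue) = (\<Sum>i<M. (\<integral>\<^sup>+x. ennreal ?K * ennreal (t x i powr p) \<partial>lborel))"
        unfolding nn_integral_completion by (intro nn_integral_sum) (simp add: t_def)
      also have "\<dots> = (\<Sum>i<M. ennreal ?K * (\<integral>\<^sup>+x. ennreal (t x i powr p) \<partial>lborel))"
        by (intro sum.cong refl nn_integral_cmult) (simp add: t_def)
      finally show ?thesis by (simp only: int_t)
    qed
    also have "\<dots> = ennreal (real M * (?K * I))"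
      using I0 by (simp add: ennreal_mult ennreal_of_nat_eq_real_of_nat)
    also have "epowr \<dots> (1 / p) = ennreal ((real M * (?K * I)) powr (1 / p))"
      using I0 by (intro epowr_ennreal mult_nonneg_nonneg) auto
    also have "(real M * (?K * I)) powr (1 / p) = C * real M powr (s / real DIM('a) - 1)"
    proof -
      have "(real M * (?K * I)) powr (1 / p) = real M powr (1 / p) * (?K powr (1 / p) * I powr (1 / p))"
        using I0 by (subst powr_mult; (subst powr_mult)?) auto
      also have "?K powr (1 / p) = 2 * Ch * G / real M"
      proof -
        have "(X powr p) powr (1 / p) = X" if "X \<ge> 0" for X using that p0 by (simp add: powr_powr)
        from this[OF K0] show ?thesis .
      qed
      also have "real M powr (1 / p) * (2 * Ch * G / real M * I powr (1 / p)) = C * (real M powr (1 / p) / real M)"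
        by (simp add: C_def)
      also have "real M powr (1 / p) / real M = real M powr (1 / p - 1)"
        using M by (simp add: powr_diff)
      also have "\<dots> = real M powr (s / real DIM('a) - 1)" by (simp add: p_def)
      finally show ?thesis .
    qed
    finally show "TL_norm \<psi> s (real DIM('a) / s) q (regular_distribution ?f) \<le> ennreal (C * real M powr (s / real DIM('a) - 1))"
      unfolding p_def .
  qed
qed

section \<open>Quasiconformality\<close>

lemma lbump_TL_functions:
  fixes \<psi> :: "'a::euclidean_space \<Rightarrow> complex"
  assumes "TL_norm \<psi> s (real DIM('a) / s) q (regular_distribution (lbump M k a)) \<le> ennreal c"
  shows "lbump M k a \<in> TL_functions \<psi> s q"
proof -
  have "tempered_distribution (regular_distribution (lbump M k a))"
    by (rule tempered_regular_distribution[OF borel_measurable_continuous_onI[OF lbump_continuous] norm_lbump_le])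
  moreover have "TL_norm \<psi> s (real DIM('a) / s) q (regular_distribution (lbump M k a)) < \<infinity>"
    using assms le_less_trans ennreal_less_top by (metis infinity_ennreal_def)
  ultimately show ?thesis
    using bounded_continuous_BMO[OF lbump_continuous norm_lbump_le]
    by (simp add: TL_functions_def TL_space_def)
qed

text \<open>On the line the complement of a ball would split into two rays; from dimension 2 on it
  is connected, and its preimage under the homeomorphism supplies the continuum running to
  infinity.\<close>

lemma connected_complement_ball:
  assumes "DIM('a::euclidean_space) \<ge> 2"
  shows "connected (- ball (a::'a) r)"
  using assms connected_complement_bounded_convex[of "ball a r"] by simp

theorem proposition4p1:
  fixes \<phi> :: "real ^ 'n \<Rightarrow> real ^ 'n"
    and \<psi> :: "real ^ 'n \<Rightarrow> complex"
    and s :: real and q :: ennreal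
  assumes "CARD('n) \<ge> 2"
    and "TL_generator \<psi>"
    and "homeomorphism_of_space \<phi>"
    and "0 < s" and "s < 1" and "0 < q"
    and "induces_bounded_map \<psi> s q \<phi>"
  shows "quasiconformal \<phi>"
proof -
  have dim: "DIM(real ^ 'n) \<ge> 2" using assms(1) by simp
  let ?p = "real DIM(real ^ 'n) / s"
  obtain \<phi>' where hom: "homeomorphism UNIV UNIV \<phi> \<phi>'"
    using assms(3) by (auto simp: homeomorphism_of_space_def)
  have cont: "continuous_on UNIV \<phi>" "continuous_on UNIV \<phi>'" and inv: "\<And>x. \<phi>' (\<phi> x) = x" "\<And>y. \<phi> (\<phi>' y) = y"
    using hom by (auto simp: homeomorphism_def)
  obtain C0 where C0: "\<And>f. continuous_on UNIV f \<Longrightarrow> f \<in> TL_functions \<psi> s q \<Longrightarrow>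
      TL_fun_norm \<psi> s q (f \<circ> \<phi>) \<le> ennreal C0 * TL_fun_norm \<psi> s q f"
    using assms(7) unfolding induces_bounded_map_def by blast
  obtain c where c: "c > 0" and lower:
    "\<forall>g x0 r E F y y'. continuous_on UNIV g \<longrightarrow> (\<forall>x. norm (g x) \<le> 1) \<longrightarrow> r > 0 \<longrightarrow>
       connected E \<longrightarrow> x0 \<in> E \<longrightarrow> y \<in> E \<longrightarrow> dist y x0 = r \<longrightarrow> (\<forall>x. x \<in> E \<longrightarrow> g x = 1) \<longrightarrow>
       connected F \<longrightarrow> y' \<in> F \<longrightarrow> dist y' x0 = r \<longrightarrow> (\<exists>y''\<in>F. dist y'' x0 \<ge> 2 * r) \<longrightarrow> (\<forall>x. x \<in> F \<longrightarrow> g x = 0) \<longrightarrow>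
       ennreal c \<le> TL_norm \<psi> s ?p q (regular_distribution g)"
    by (rule TL_norm_lower_bound[OF assms(2,4,6)]) (rule that; assumption)
  obtain C1 where C1: "C1 \<ge> 0" and upper:
    "\<And>M k a. M > 0 \<Longrightarrow> TL_norm \<psi> s ?p q (regular_distribution (lbump M k a)) \<le>
       ennreal (C1 * real M powr (s / real DIM(real ^ 'n) - 1))"
    by (rule TL_norm_lbump[OF assms(2) dim assms(4,5,6)]) (rule that; (assumption | simp only:))
  define e where "e = s / real DIM(real ^ 'n) - 1"
  have "e < 0" using assms(4,5) dim by (simp add: e_def divide_less_eq)
  \<comment> \<open>\<open>C0\<close> is an arbitrary real number. Its absolute value majorises it
    and makes the product nonnegative.\<close>
  then have "(\<lambda>M. \<bar>C0\<bar> * (C1 * real M powr e)) \<longlonglongrightarrow> \<bar>C0\<bar> * (C1 * 0)"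
    by (intro tendsto_mult tendsto_const tendsto_neg_powr filterlim_real_sequentially)
  then have "\<forall>\<^sub>F M in sequentially. \<bar>C0\<bar> * (C1 * real M powr e) < c"
    using c by (intro order_tendstoD) auto
  then obtain M0 where M0: "\<And>M. M \<ge> M0 \<Longrightarrow> \<bar>C0\<bar> * (C1 * real M powr e) < c"
    by (auto simp: eventually_sequentially)
  \<comment> \<open>\<open>M\<close> depends only on the operator bound and on the constants of the
    two norm estimates, not on a point or a radius. The distortion bound obtained from it is
    therefore uniform.\<close>
  define M where "M = max 1 M0"
  have M: "M > 0" "\<bar>C0\<bar> * (C1 * real M powr e) < c" using M0[of M] by (auto simp: M_def)
  have small: "TL_norm \<psi> s ?p q (regular_distribution (lbump M k a \<circ> \<phi>)) < ennreal c" for k a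
  proof -
    have u: "TL_norm \<psi> s ?p q (regular_distribution (lbump M k a)) \<le> ennreal (C1 * real M powr e)"
      unfolding e_def by (rule upper[OF M(1)])
    have "TL_norm \<psi> s ?p q (regular_distribution (lbump M k a \<circ> \<phi>)) \<le> ennreal C0 * TL_norm \<psi> s ?p q (regular_distribution (lbump M k a))"
      using C0[OF lbump_continuous lbump_TL_functions[OF u]] by (simp add: TL_fun_norm_def)
    also have "\<dots> \<le> ennreal \<bar>C0\<bar> * ennreal (C1 * real M powr e)"
      by (intro mult_mono u ennreal_leI) auto
    also have "\<dots> = ennreal (\<bar>C0\<bar> * (C1 * real M powr e))" using C1 by (intro ennreal_mult[symmetric]) auto
    also have "\<dots> < ennreal c" using M(2) c by (intro ennreal_lessI)
    finally show ?thesis .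
  qed
  \<comment> \<open>The truncated logarithm falls from 1 to 0 between the radii 2^k and 2^(k + M).
    One more factor 2 pays for rounding the smallest distance up to the power 2^k.\<close>
  define H where "H = (2::real) ^ (M + 1)"
  have bound: "distortion \<phi> x r \<le> H" if r: "r > 0" for x r
  proof (rule ccontr)
    assume neg: "\<not> distortion \<phi> x r \<le> H"
    let ?d = "\<lambda>y. norm (\<phi> y - \<phi> x)"
    have S: "compact (sphere x r)" "sphere x r \<noteq> {}" using r dim by auto
    have cd: "continuous_on (sphere x r) ?d"
      by (intro continuous_intros continuous_on_subset[OF cont(1)]) auto
    obtain y' where y': "y' \<in> sphere x r" "\<And>y. y \<in> sphere x r \<Longrightarrow> ?d y \<le> ?d y'"
      using continuous_attains_sup[OF S cd] by blast
    obtain y where y: "y \<in> sphere x r" "\<And>z. z \<in> sphere x r \<Longrightarrow> ?d y \<le> ?d z"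
      using continuous_attains_inf[OF S cd] by blast
    have sup: "(SUP y\<in>sphere x r. ?d y) = ?d y'"
      using y' by (intro cSup_eq_maximum) auto
    have inf: "(INF y\<in>sphere x r. ?d y) = ?d y"
      using y by (intro cInf_eq_minimum) auto
    have l: "?d y > 0"
    proof -
      have "y \<noteq> x" using y(1) r by auto
      then have "\<phi> y \<noteq> \<phi> x" using inv(1) by metis
      then show ?thesis by simp
    qed
    have "H < ?d y' / ?d y" using neg unfolding distortion_def sup inf by simp
    then have big: "H * ?d y < ?d y'" using l by (simp add: pos_less_divide_eq)
    define k where "k = \<lceil>log 2 (?d y)\<rceil>"
    have k: "?d y \<le> 2 powi k" "2 powi k \<le> 2 * ?d y"
    proof -
      note pk = two_powi_eq_powr[of k]
      have eq: "2 powr (log 2 (?d y)) = ?d y" using l by simp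
      have "2 powr (log 2 (?d y)) \<le> 2 powr (of_int k)" unfolding k_def by (intro powr_mono) auto
      then show "?d y \<le> 2 powi k" unfolding eq pk .
      have "2 powr (of_int k) \<le> 2 powr (1 + log 2 (?d y))" unfolding k_def by (intro powr_mono) linarith+
      then show "2 powi k \<le> 2 * ?d y" unfolding powr_add eq pk by simp
    qed
    have far: "2 powi (k + int M) \<le> ?d y'"
    proof -
      have "(2::real) powi (k + int M) = 2 powi k * 2 ^ M" by (simp add: power_int_add)
      also have "\<dots> \<le> 2 * ?d y * 2 ^ M" using k(2) by (intro mult_right_mono) auto
      also have "\<dots> = H * ?d y" by (simp add: H_def)
      finally show ?thesis using big by linarith
    qed
    define g where "g = lbump M k (\<phi> x) \<circ> \<phi>"
    \<comment> \<open>The closed radii put the minimiser \<open>y\<close> into \<open>E\<close> and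
      the maximiser \<open>y'\<close> into \<open>F\<close>, so both sets reach the sphere of radius
      r. As images under \<open>\<phi>'\<close> they inherit connectedness from the ball and from
      its complement.\<close>
    define E where "E = \<phi>' ` cball (\<phi> x) (?d y)"
    define F where "F = \<phi>' ` (- ball (\<phi> x) (?d y'))"
    have img: "z \<in> \<phi>' ` S \<longleftrightarrow> \<phi> z \<in> S" for z S
      using inv by (metis image_eqI image_iff)
    have inE: "z \<in> E \<longleftrightarrow> ?d z \<le> ?d y" for z
      unfolding E_def img by (simp add: dist_norm norm_minus_commute)
    have inF: "z \<in> F \<longleftrightarrow> ?d y' \<le> ?d z" for z
      unfolding F_def img by (simp add: dist_norm norm_minus_commute not_less)
    \<comment> \<open>A bounded \<open>F\<close> would lie in a compact ball, whose image under
      \<open>\<phi>\<close> is bounded, while \<open>\<phi>\<close> maps \<open>F\<close> onto the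
      complement of a ball.\<close>
    have unb: "\<exists>y''\<in>F. dist y'' x \<ge> 2 * r"
    proof (rule ccontr)
      assume "\<not> ?thesis"
      then have "F \<subseteq> cball x (2 * r)" by (auto simp: dist_commute)
      moreover have "compact (\<phi> ` cball x (2 * r))"
        by (intro compact_continuous_image continuous_on_subset[OF cont(1)]) auto
      ultimately have "bounded (\<phi> ` F)" using bounded_subset compact_imp_bounded image_mono by metis
      moreover have "\<phi> ` F = - ball (\<phi> x) (?d y')" unfolding F_def image_image inv(2) by simp
      ultimately have "bounded (ball (\<phi> x) (?d y') \<union> - ball (\<phi> x) (?d y'))" by (simp only: bounded_Un bounded_ball)
      then show False using not_bounded_UNIV[where 'a="real ^ 'n"] by simp
    qed
    have "ennreal c \<le> TL_norm \<psi> s ?p q (regular_distribution g)"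
    proof (rule lower[rule_format, of g r E x y F y'])
      show "continuous_on UNIV g"
        unfolding g_def by (intro continuous_on_compose cont(1) continuous_on_subset[OF lbump_continuous]) auto
      show "norm (g z) \<le> 1" for z by (simp add: g_def norm_lbump_le)
      show "r > 0" by fact
      show "connected E" unfolding E_def
        by (intro connected_continuous_image continuous_on_subset[OF cont(2)]) auto
      show "x \<in> E" "y \<in> E" using l by (auto simp: inE)
      show "dist y x = r" "dist y' x = r" using y(1) y'(1) by (auto simp: dist_commute)
      show "connected F" unfolding F_def
        by (intro connected_continuous_image continuous_on_subset[OF cont(2)] connected_complement_ball dim) auto
      show "y' \<in> F" by (simp add: inF)
      show "g z = 1" if "z \<in> E" for z
        unfolding g_def o_def using that k(1) inE by (intro lbump_eq_1 M(1)) force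
      show "g z = 0" if "z \<in> F" for z
        unfolding g_def o_def using that far inF by (intro lbump_eq_0) force
    qed (rule unb)
    then show False using small[of k "\<phi> x"] unfolding g_def by (simp add: not_le[symmetric])
  qed
  have "Limsup (at_right 0) (\<lambda>r. ereal (distortion \<phi> x r)) \<le> ereal H" for x
  proof (rule Limsup_bounded)
    show "\<forall>\<^sub>F r in at_right 0. ereal (distortion \<phi> x r) \<le> ereal H"
      using bound by (auto simp: eventually_at_right_field intro!: exI[of _ 1])
  qed
  then show ?thesis using assms(3) unfolding quasiconformal_def by blast
qed

end
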